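(* Let $n\ge 3$ and $d\ge 6$ be integers, and let $X(n,d)$ be the affine algebraic variety of all polynomial mappings $F:\mathbb{C}^n\to\mathbb{C}^n$ of degree at most $d$ with $\mathrm{Jac}(F)=1$. If $X(n,d)$ is irreducible, then a generic element of $X(n,d)$ is a counterexample to the Jacobian Conjecture (that is, there is a nonempty Zariski open, hence dense, subset $U\subset X(n,d)$ such that no $F\in U$ is a polynomial automorphism of $\mathbb{C}^n$).
   Context: A polynomial mapping $F=(F_1,\dots,F_n):\mathbb{C}^n\to\mathbb{C}^n$ has degree at most $d$ if every component $F_i\in\mathbb{C}[x_1,\dots,x_n]$ has total degree at most $d$. The space $\Omega(n,d)$ of all such mappings is identified with an affine space $\mathbb{C}^M$ via the coefficients of the components. $\mathrm{Jac}(F)=\det(\partial F_i/\partial x_j)_{i,j}\in\mathbb{C}[x_1,\dots,x_n]$, and $\mathrm{Jac}(F)=1$ means that it is the constant polynomial $1$. $X(n,d)=\{F\in\Omega(n,d):\mathrm{Jac}(F)=1\}$ is a Zariski closed subset of $\Omega(n,d)\cong\mathbb{C}^M$, with the induced Zariski topology. A polynomial automorphism of $\mathbb{C}^n$ is a polynomial mapping $\mathbb{C}^n\to\mathbb{C}^n$ that has a two-sided inverse which is also a polynomial mapping (of any degree). A counterexample to the Jacobian Conjecture in $X(n,d)$ is an element $F\in X(n,d)$ that is not a polynomial automorphism. "A generic element has property $P$" means that $P$ holds for all elements of some nonempty Zariski open subset of the irreducible variety in question. *)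

theory Defs
  imports "HOL-Analysis.Analysis" "HOL-Library.Poly_Mapping"
begin

section \<open>Multivariate polynomials\<close>

text \<open>
  A monomial is a finitely supported exponent vector, and a polynomial is a finitely supported
  coefficient function on monomials. The multiplication provided by \<^theory>\<open>HOL-Library.Poly_Mapping\<close>
  is convolution, which is the product of polynomials.
\<close>

type_synonym 'v monom = "'v \<Rightarrow>\<^sub>0 nat"
type_synonym ('v, 'a) mpoly = "'v monom \<Rightarrow>\<^sub>0 'a"

definition mon_degree :: "'v monom \<Rightarrow> nat" where
  "mon_degree m = (\<Sum>v\<in>Poly_Mapping.keys m. Poly_Mapping.lookup m v)"

definition mon_eval :: "('v \<Rightarrow> 'a::comm_semiring_1) \<Rightarrow> 'v monom \<Rightarrow> 'a" where
  "mon_eval a m = (\<Prod>v\<in>Poly_Mapping.keys m. a v ^ Poly_Mapping.lookup m v)"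

definition mp_eval :: "('v \<Rightarrow> 'a::comm_semiring_1) \<Rightarrow> ('v, 'a) mpoly \<Rightarrow> 'a" where
  "mp_eval a p = (\<Sum>m\<in>Poly_Mapping.keys p. Poly_Mapping.lookup p m * mon_eval a m)"

definition mp_vars :: "('v, 'a::zero) mpoly \<Rightarrow> 'v set" where
  "mp_vars p = (\<Union>m\<in>Poly_Mapping.keys p. Poly_Mapping.keys m)"

text \<open>
  The formal partial derivative. If \<open>v\<close> does not occur in \<open>m\<close> then the subtraction of exponents
  truncates, but the coefficient is zero.
\<close>

definition mp_pderiv :: "'v \<Rightarrow> ('v, 'a::comm_semiring_1) mpoly \<Rightarrow> ('v, 'a) mpoly" where
  "mp_pderiv v p = (\<Sum>m\<in>Poly_Mapping.keys p.
     Poly_Mapping.single (m - Poly_Mapping.single v 1)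
       (of_nat (Poly_Mapping.lookup m v) * Poly_Mapping.lookup p m))"

lemma mon_eval_superset:
  assumes "finite S" "Poly_Mapping.keys m \<subseteq> S"
  shows "mon_eval a m = (\<Prod>v\<in>S. a v ^ Poly_Mapping.lookup m v)"
  unfolding mon_eval_def
  by (rule prod.mono_neutral_left) (use assms in \<open>auto simp: in_keys_iff\<close>)

lemma mp_eval_superset:
  assumes "finite S" "Poly_Mapping.keys p \<subseteq> S"
  shows "mp_eval a p = (\<Sum>m\<in>S. Poly_Mapping.lookup p m * mon_eval a m)"
  unfolding mp_eval_def
  by (rule sum.mono_neutral_left) (use assms in \<open>auto simp: in_keys_iff\<close>)

lemma mon_eval_add: "mon_eval a (m + m') = mon_eval a m * mon_eval a m'"
proof -
  let ?S = "Poly_Mapping.keys m \<union> Poly_Mapping.keys m'"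
  have k: "Poly_Mapping.keys (m + m') \<subseteq> ?S" by (rule Poly_Mapping.keys_add)
  show ?thesis
    by (simp add: mon_eval_superset[of ?S] k lookup_add power_add prod.distrib)
qed

lemma mp_eval_zero [simp]: "mp_eval a 0 = 0"
  by (simp add: mp_eval_def)

lemma mp_eval_one [simp]: "mp_eval a 1 = 1"
  by (simp add: mp_eval_def mon_eval_def)

lemma mp_eval_single: "mp_eval a (Poly_Mapping.single m c) = c * mon_eval a m"
  by (simp add: mp_eval_def)

lemma mp_eval_add: "mp_eval a (p + q) = mp_eval a p + mp_eval a q"
proof -
  let ?S = "Poly_Mapping.keys p \<union> Poly_Mapping.keys q"
  have k: "Poly_Mapping.keys (p + q) \<subseteq> ?S" by (rule Poly_Mapping.keys_add)
  show ?thesis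
    by (simp add: mp_eval_superset[of ?S] k lookup_add distrib_right sum.distrib)
qed

lemma mp_eval_sum: "mp_eval a (\<Sum>i\<in>I. f i) = (\<Sum>i\<in>I. mp_eval a (f i))"
  by (induction I rule: infinite_finite_induct) (auto simp: mp_eval_add)

lemma mp_monom_expansion:
  "p = (\<Sum>m\<in>Poly_Mapping.keys p. Poly_Mapping.single m (Poly_Mapping.lookup p m))"
  by (rule poly_mapping_eqI)
     (simp add: lookup_sum lookup_single when_def sum.delta in_keys_iff)

lemma mp_eval_mult: "mp_eval a (p * q) = mp_eval a p * mp_eval a q"
proof -
  let ?m = "\<lambda>p m. Poly_Mapping.single m (Poly_Mapping.lookup p m)"
  have "p * q = (\<Sum>m\<in>Poly_Mapping.keys p. ?m p m) * (\<Sum>m\<in>Poly_Mapping.keys q. ?m q m)"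
    by (simp only: mp_monom_expansion[symmetric])
  also have "\<dots> = (\<Sum>m\<in>Poly_Mapping.keys p. \<Sum>m'\<in>Poly_Mapping.keys q. ?m p m * ?m q m')"
    by (rule sum_product)
  finally have "mp_eval a (p * q) =
      (\<Sum>m\<in>Poly_Mapping.keys p. \<Sum>m'\<in>Poly_Mapping.keys q.
         (Poly_Mapping.lookup p m * mon_eval a m) * (Poly_Mapping.lookup q m' * mon_eval a m'))"
    by (simp only: mp_eval_sum mult_single mp_eval_single mon_eval_add ac_simps)
  also have "\<dots> = mp_eval a p * mp_eval a q"
    unfolding mp_eval_def by (rule sum_product[symmetric])
  finally show ?thesis .
qed

lemma mp_vars_one [simp]: "mp_vars 1 = {}"
  by (simp add: mp_vars_def)

lemma mp_vars_mult: "mp_vars (p * q) \<subseteq> mp_vars p \<union> mp_vars q"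
proof
  fix v assume "v \<in> mp_vars (p * q)"
  then obtain m where m: "m \<in> Poly_Mapping.keys (p * q)" "v \<in> Poly_Mapping.keys m"
    by (auto simp: mp_vars_def)
  with keys_mult[of p q] obtain b c where
    "m = b + c" "b \<in> Poly_Mapping.keys p" "c \<in> Poly_Mapping.keys q" by blast
  with m(2) Poly_Mapping.keys_add[of b c] show "v \<in> mp_vars p \<union> mp_vars q"
    by (auto simp: mp_vars_def)
qed


section \<open>Polynomial mappings\<close>

text \<open>
  The finite type \<open>'n\<close> indexes both the variables and the components, so \<open>n = CARD('n)\<close>.
\<close>

type_synonym 'n poly_map = "('n, complex) mpoly ^ 'n"

definition pm_eval :: "'n::finite poly_map \<Rightarrow> complex ^ 'n \<Rightarrow> complex ^ 'n" where
  "pm_eval F x = (\<chi> i. mp_eval (($) x) (F $ i))"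

definition jacobian :: "'n::finite poly_map \<Rightarrow> ('n, complex) mpoly" where
  "jacobian F = det (\<chi> i j. mp_pderiv j (F $ i))"

definition poly_automorphism :: "'n::finite poly_map \<Rightarrow> bool" where
  "poly_automorphism F \<longleftrightarrow>
     (\<exists>G. pm_eval G \<circ> pm_eval F = id \<and> pm_eval F \<circ> pm_eval G = id)"

definition Omega :: "nat \<Rightarrow> 'n::finite poly_map set" where
  "Omega d = {F. \<forall>i. \<forall>m\<in>Poly_Mapping.keys (F $ i). mon_degree m \<le> d}"

definition X_var :: "nat \<Rightarrow> 'n::finite poly_map set" where
  "X_var d = {F \<in> Omega d. jacobian F = 1}"

definition jc_counterexample :: "nat \<Rightarrow> 'n::finite poly_map \<Rightarrow> bool" where
  "jc_counterexample d F \<longleftrightarrow> F \<in> X_var d \<and> \<not> poly_automorphism F"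


section \<open>The Zariski topology\<close>

text \<open>
  The coordinates of the affine space \<open>Omega d\<close> are indexed by the pairs of a component and a
  monomial of degree at most \<open>d\<close>; a regular function on \<open>Omega d\<close> is a polynomial in these
  coordinates.
\<close>

definition coord_index :: "nat \<Rightarrow> ('n::finite \<times> 'n monom) set" where
  "coord_index d = {(i, m). mon_degree m \<le> d}"

definition coords :: "'n::finite poly_map \<Rightarrow> 'n \<times> 'n monom \<Rightarrow> complex" where
  "coords F = (\<lambda>(i, m). Poly_Mapping.lookup (F $ i) m)"

definition coord_polys :: "nat \<Rightarrow> ('n::finite \<times> 'n monom, complex) mpoly set" where
  "coord_polys d = {p. mp_vars p \<subseteq> coord_index d}"

definition zero_locus ::
  "nat \<Rightarrow> ('n::finite \<times> 'n monom, complex) mpoly set \<Rightarrow> 'n poly_map set" where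
  "zero_locus d S = {F \<in> Omega d. \<forall>p\<in>S. mp_eval (coords F) p = 0}"

definition zariski :: "nat \<Rightarrow> 'n::finite poly_map topology" where
  "zariski d = topology (\<lambda>U. \<exists>S\<subseteq>coord_polys d. U = Omega d - zero_locus d S)"

lemma istopology_zariski:
  "istopology (\<lambda>U :: 'n::finite poly_map set.
     \<exists>S\<subseteq>coord_polys d. U = Omega d - zero_locus d S)"
  unfolding istopology_def
proof (intro conjI allI impI)
  fix U V :: "'n::finite poly_map set"
  assume "\<exists>S\<subseteq>coord_polys d. U = Omega d - zero_locus d S"
    and "\<exists>S\<subseteq>coord_polys d. V = Omega d - zero_locus d S"
  then obtain S T where S: "S \<subseteq> coord_polys d" "U = Omega d - zero_locus d S"
    and T: "T \<subseteq> coord_polys d" "V = Omega d - zero_locus d T" by blast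
  let ?P = "(\<lambda>(p, q). p * q) ` (S \<times> T)"
  have "?P \<subseteq> coord_polys d"
    using S(1) T(1) mp_vars_mult by (fastforce simp: coord_polys_def)
  moreover have "U \<inter> V = Omega d - zero_locus d ?P"
    unfolding S(2) T(2) zero_locus_def by (auto simp: mp_eval_mult)
  ultimately show "\<exists>S\<subseteq>coord_polys d. U \<inter> V = Omega d - zero_locus d S" by blast
next
  fix K :: "'n::finite poly_map set set"
  assume "\<forall>U\<in>K. \<exists>S\<subseteq>coord_polys d. U = Omega d - zero_locus d S"
  then obtain f where f: "\<And>U. U \<in> K \<Longrightarrow> f U \<subseteq> coord_polys d \<and> U = Omega d - zero_locus d (f U)"
    by metis
  have "\<Union>K = (\<Union>U\<in>K. Omega d - zero_locus d (f U))" using f by auto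
  also have "\<dots> = Omega d - zero_locus d (\<Union>U\<in>K. f U)"
    unfolding zero_locus_def by auto
  finally have "\<Union>K = Omega d - zero_locus d (\<Union>U\<in>K. f U)" .
  moreover have "(\<Union>U\<in>K. f U) \<subseteq> coord_polys d" using f by blast
  ultimately show "\<exists>S\<subseteq>coord_polys d. \<Union>K = Omega d - zero_locus d S" by blast
qed

lemma openin_zariski:
  "openin (zariski d) U \<longleftrightarrow> (\<exists>S\<subseteq>coord_polys d. U = Omega d - zero_locus d S)"
  by (simp add: zariski_def topology_inverse'[OF istopology_zariski])

lemma topspace_zariski [simp]: "topspace (zariski d :: 'n::finite poly_map topology) = Omega d"
proof -
  have "openin (zariski d) (Omega d :: 'n poly_map set)"
    unfolding openin_zariski
    by (intro exI[where x = "{1}"] conjI) (auto simp: zero_locus_def coord_polys_def)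
  moreover have "U \<subseteq> Omega d" if "openin (zariski d) U" for U :: "'n poly_map set"
    using that by (auto simp: openin_zariski)
  ultimately show ?thesis by (auto simp: topspace_def)
qed

lemma closedin_zariski:
  fixes Z :: "'n::finite poly_map set"
  shows "closedin (zariski d) Z \<longleftrightarrow> (\<exists>S\<subseteq>coord_polys d. Z = zero_locus d S)"
proof -
  have sub: "zero_locus d S \<subseteq> Omega d" for S :: "('n \<times> 'n monom, complex) mpoly set"
    by (auto simp: zero_locus_def)
  have "Omega d - Z = Omega d - zero_locus d S \<longleftrightarrow> Z = zero_locus d S" if "Z \<subseteq> Omega d" for S
    using that sub[of S] by blast
  then show ?thesis
    unfolding closedin_def openin_zariski topspace_zariski using sub by metis
qed

definition X_zariski :: "nat \<Rightarrow> 'n::finite poly_map topology" where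
  "X_zariski d = subtopology (zariski d) (X_var d)"

lemma topspace_X_zariski [simp]: "topspace (X_zariski d) = X_var d"
  by (auto simp: X_zariski_def X_var_def)

definition irreducible_space :: "'a topology \<Rightarrow> bool" where
  "irreducible_space T \<longleftrightarrow> topspace T \<noteq> {} \<and>
     (\<forall>A B. closedin T A \<and> closedin T B \<and> A \<union> B = topspace T \<longrightarrow>
        A = topspace T \<or> B = topspace T)"

end

theory Submission
  imports Defs
begin

text \<open>
  The Jacobian Conjecture fails in dimension three: assigning to a binary cubic with a marked simple
  root its coefficients, in suitable affine coordinates, is a Keller mapping of degree seven which is
  three-to-one; one more variable lowers the degree to six. Given a non-injective Keller mapping
  \<open>F0\<close>, the monomials in its components up to any given degree are linearly independent together with a
  suitable variable. This is an open condition on \<open>F\<close>, and it fails for automorphisms \<open>F\<close>, whose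
  inverses have bounded degree. So the generic element of an irreducible \<open>X_var d\<close> is a counterexample
  unless \<open>n = 3\<close> and \<open>d = 6\<close>.

  In this last case \<open>X_var d\<close> is reducible. Indeed 33 coefficients are algebraically independent on the
  mappings with identity linear part, since they can be prescribed generically on a family of
  triangular mappings, so if \<open>X_var d\<close> were irreducible all tangent spaces would have dimension
  at least 33. But at a certain composition of elementary mappings the dimension is 31.
\<close>

text \<open>Having no inverse of degree at most \<open>K\<close> is one condition for each
  \<open>K\<close>; a bound on the degree of the inverse that depends on n and d alone turns these
  countably many conditions into one open set. The bound comes from counting monomials and is far
  from sharp, which does no harm. The suitable variable is one in which two points with the same
  image differ. Dimension three with degree six stands apart because the cubic map has degree seven
  and lowering the degree spends a fourth variable. Dimension theory is replaced by derivations: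
  coordinates that are algebraically independent modulo a prime ideal carry as many independent
  vector fields, whose values at points are tangent vectors. The number 33 is 25 + 5 + 3: the
  coefficients of a polynomial in two linear forms with terms of degrees two to six, those of a
  polynomial in one form, and three parameters for the directions. Constant and linear coefficients
  are frozen first, so that 33 and 31 count nonlinear coefficients only.\<close>

definition Var :: "'v \<Rightarrow> ('v, 'a::comm_semiring_1) mpoly" where
  "Var v = Poly_Mapping.single (Poly_Mapping.single v 1) 1"

abbreviation Const :: "'a \<Rightarrow> ('v, 'a::comm_semiring_1) mpoly" where
  "Const c \<equiv> Poly_Mapping.single 0 c"

section \<open>Evaluation, variables and induction for polynomials\<close>

lemma mon_eval_zero [simp]: "mon_eval a 0 = 1"
  by (simp add: mon_eval_def)

lemma mon_eval_single [simp]: "mon_eval a (Poly_Mapping.single v k) = a v ^ k"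
  by (cases "k = 0") (simp_all add: mon_eval_def)

lemma mp_eval_Const [simp]: "mp_eval a (Const c) = c"
  by (simp add: mp_eval_single)

lemma mp_eval_Var [simp]: "mp_eval a (Var v) = a v"
  by (simp add: mp_eval_single Var_def)

lemma mp_eval_uminus: "mp_eval a (- p) = - mp_eval a (p :: ('v, 'a::comm_ring_1) mpoly)"
proof -
  have "mp_eval a (- p) + mp_eval a p = 0"
    by (simp flip: mp_eval_add)
  then show ?thesis by (simp add: eq_neg_iff_add_eq_0)
qed

lemma mp_eval_diff: "mp_eval a (p - q) = mp_eval a p - mp_eval a (q :: ('v, 'a::comm_ring_1) mpoly)"
  using mp_eval_add[of a p "- q"] by (simp add: mp_eval_uminus)

lemma mp_eval_power: "mp_eval a (p ^ k) = mp_eval a p ^ k"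
  by (induction k) (simp_all add: mp_eval_mult)

lemma mp_eval_prod: "mp_eval a (\<Prod>i\<in>I. f i) = (\<Prod>i\<in>I. mp_eval a (f i))"
  by (induction I rule: infinite_finite_induct) (auto simp: mp_eval_mult)

lemma mp_eval_of_nat: "mp_eval a (of_nat k) = of_nat k"
  by (induction k) (simp_all add: mp_eval_add)

lemma mp_eval_of_int: "mp_eval a (of_int k :: ('v, 'a::comm_ring_1) mpoly) = of_int k"
  by (cases k) (simp_all add: mp_eval_of_nat mp_eval_diff mp_eval_uminus mp_eval_add)

lemma mp_eval_numeral: "mp_eval a (numeral k) = numeral k"
  using mp_eval_of_nat[of a "numeral k"] by simp

lemmas mp_eval_simps = mp_eval_add mp_eval_mult mp_eval_power mp_eval_sum mp_eval_prod
  mp_eval_uminus mp_eval_diff mp_eval_of_nat mp_eval_of_int mp_eval_numeral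

lemma mp_eval_det:
  fixes A :: "('v, complex) mpoly ^ 'n::finite ^ 'n"
  shows "mp_eval a (det A) = det (\<chi> i j. mp_eval a (A $ i $ j))"
  unfolding det_def by (simp add: mp_eval_simps)

lemma single_conv_Const: "Poly_Mapping.single m c = Const c * Poly_Mapping.single m 1"
  by (simp add: mult_single)

lemma single_power: "Poly_Mapping.single m c ^ k = Poly_Mapping.single (\<Sum>i<k. m) (c ^ k)"
  by (induction k) (simp_all add: mult_single add.commute flip: single_one)

lemma Var_power: "(Var v :: ('v, 'a::comm_semiring_1) mpoly) ^ k =
    Poly_Mapping.single (Poly_Mapping.single v k) 1"
proof -
  have "(\<Sum>i<k. Poly_Mapping.single v (1::nat)) = Poly_Mapping.single v k"
    by (induction k) (simp_all flip: single_add)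
  then show ?thesis by (simp only: Var_def single_power power_one)
qed

lemma single_monom_prod:
  assumes "finite S" "Poly_Mapping.keys m \<subseteq> S"
  shows "(Poly_Mapping.single m 1 :: ('v, 'a::comm_semiring_1) mpoly) =
    (\<Prod>v\<in>S. Var v ^ Poly_Mapping.lookup m v)"
proof -
  have prod: "(\<Prod>v\<in>S. Poly_Mapping.single (f v) 1) =
      (Poly_Mapping.single (\<Sum>v\<in>S. f v) 1 :: ('v, 'a) mpoly)" for f :: "'v \<Rightarrow> 'v monom"
    using assms(1) by (induction S) (simp_all add: mult_single)
  have "(\<Sum>v\<in>S. Poly_Mapping.single v (Poly_Mapping.lookup m v)) = m"
    using assms by (intro poly_mapping_eqI)
      (auto simp: lookup_sum lookup_single when_def sum.delta in_keys_iff)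
  then show ?thesis by (simp only: Var_power prod)
qed

lemma mp_vars_single_subset: "mp_vars (Poly_Mapping.single m c) \<subseteq> Poly_Mapping.keys m"
  by (auto simp: mp_vars_def)

lemma mp_vars_add: "mp_vars (p + q) \<subseteq> mp_vars p \<union> mp_vars q"
  using Poly_Mapping.keys_add[of p q] by (auto simp: mp_vars_def)

lemma mp_vars_sum: "mp_vars (\<Sum>i\<in>I. f i) \<subseteq> (\<Union>i\<in>I. mp_vars (f i))"
proof (induction I rule: infinite_finite_induct)
  case (insert i I)
  then show ?case using mp_vars_add[of "f i" "\<Sum>i\<in>I. f i"] by auto
qed (auto simp: mp_vars_def)

lemma finite_mp_vars [simp]: "finite (mp_vars p)"
  by (auto simp: mp_vars_def)

text \<open>Claims that are stable under sums and products, such as the chain rule, reduce to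
  constants and variables without an expansion into monomials. The set \<open>V\<close> confines the
  variable case to indices for which hypotheses are available.\<close>

lemma mp_induct [consumes 1, case_names Const Var add mult]:
  assumes "mp_vars p \<subseteq> V"
    and const: "\<And>c. P (Const c)"
    and var: "\<And>v. v \<in> V \<Longrightarrow> P (Var v)"
    and add: "\<And>p q. P p \<Longrightarrow> P q \<Longrightarrow> P (p + q)"
    and mult: "\<And>p q. P p \<Longrightarrow> P q \<Longrightarrow> P (p * q)"
  shows "P (p :: ('v, 'a::comm_semiring_1) mpoly)"
proof -
  have one: "P 1" using const[of 1] by simp
  have pow: "P (q ^ k)" if "P q" for q k
    using that by (induction k) (auto simp: one mult)
  have mon: "P (Poly_Mapping.single m c)" if "Poly_Mapping.keys m \<subseteq> V" for m c
  proof -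
    have "P (\<Prod>v\<in>S. Var v ^ Poly_Mapping.lookup m v)" if "finite S" "S \<subseteq> V" for S
      using that by (induction S) (auto simp: one mult pow var)
    then have "P (Poly_Mapping.single m 1)"
      using that by (subst single_monom_prod[OF finite_keys order_refl]) auto
    then show ?thesis by (subst single_conv_Const) (rule mult[OF const])
  qed
  have "P (\<Sum>m\<in>M. Poly_Mapping.single m (Poly_Mapping.lookup p m))"
    if "finite M" "M \<subseteq> Poly_Mapping.keys p" for M
    using that
  proof (induction M)
    case empty
    then show ?case using const[of 0] by simp
  next
    case (insert m M)
    then show ?case using assms(1)
      by (auto intro!: add mon simp: mp_vars_def)
  qed
  from this[OF finite_keys order_refl] show ?thesis
    by (simp flip: mp_monom_expansion)
qed

subsection \<open>Partial derivatives\<close>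

lemma lookup_mp_pderiv:
  "Poly_Mapping.lookup (mp_pderiv v p) m =
     of_nat (Poly_Mapping.lookup m v + 1) * Poly_Mapping.lookup p (m + Poly_Mapping.single v 1)"
proof -
  let ?m' = "m + Poly_Mapping.single v 1"
  have eq: "(of_nat (Poly_Mapping.lookup k v) * Poly_Mapping.lookup p k
        when k - Poly_Mapping.single v 1 = m)
      = (if k = ?m' then of_nat (Poly_Mapping.lookup m v + 1) * Poly_Mapping.lookup p ?m' else 0)" for k
  proof (cases "Poly_Mapping.lookup k v = 0")
    case True
    then have "k \<noteq> ?m'" by (auto simp: lookup_add)
    with True show ?thesis by simp
  next
    case False
    have "(k - Poly_Mapping.single v 1) + Poly_Mapping.single v 1 = k"
      using False by (intro poly_mapping_eqI) (auto simp: lookup_add lookup_minus lookup_single when_def)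
    then have "k - Poly_Mapping.single v 1 = m \<longleftrightarrow> k = ?m'" by auto
    then show ?thesis by (auto simp: lookup_add when_def)
  qed
  have "Poly_Mapping.lookup (mp_pderiv v p) m =
      (\<Sum>k\<in>Poly_Mapping.keys p. if k = ?m'
        then of_nat (Poly_Mapping.lookup m v + 1) * Poly_Mapping.lookup p ?m' else 0)"
    unfolding mp_pderiv_def lookup_sum lookup_single eq ..
  also have "\<dots> = of_nat (Poly_Mapping.lookup m v + 1) * Poly_Mapping.lookup p ?m'"
    by (auto simp: sum.delta in_keys_iff)
  finally show ?thesis .
qed

lemma mp_pderiv_add: "mp_pderiv v (p + q) = mp_pderiv v p + mp_pderiv v q"
  by (rule poly_mapping_eqI) (simp add: lookup_mp_pderiv lookup_add algebra_simps)

lemma mp_pderiv_zero [simp]: "mp_pderiv v 0 = 0"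
  by (simp add: mp_pderiv_def)

lemma mp_pderiv_sum: "mp_pderiv v (\<Sum>i\<in>I. f i) = (\<Sum>i\<in>I. mp_pderiv v (f i))"
  by (induction I rule: infinite_finite_induct) (auto simp: mp_pderiv_add)

lemma mp_pderiv_single:
  "mp_pderiv v (Poly_Mapping.single m c) =
     Poly_Mapping.single (m - Poly_Mapping.single v 1) (of_nat (Poly_Mapping.lookup m v) * c)"
  by (simp add: mp_pderiv_def)

lemma mp_pderiv_single_mult:
  fixes c c' :: "'a::comm_semiring_1"
  shows "mp_pderiv v (Poly_Mapping.single m c * Poly_Mapping.single m' c') =
     mp_pderiv v (Poly_Mapping.single m c) * Poly_Mapping.single m' c' +
     Poly_Mapping.single m c * mp_pderiv v (Poly_Mapping.single m' c')"
proof -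
  let ?e = "Poly_Mapping.single v (1::nat)"
  have shift: "(k - ?e) + k' = k + k' - ?e" if "Poly_Mapping.lookup k v \<noteq> 0" for k k' :: "'b monom"
    using that by (intro poly_mapping_eqI) (auto simp: lookup_add lookup_minus lookup_single when_def)
  have 1: "Poly_Mapping.single (m - ?e + m') (of_nat (Poly_Mapping.lookup m v) * c * c') =
      Poly_Mapping.single (m + m' - ?e) (of_nat (Poly_Mapping.lookup m v) * c * c')"
    using shift[of m m'] by (cases "Poly_Mapping.lookup m v = 0") auto
  have 2: "Poly_Mapping.single (m + (m' - ?e)) (c * (of_nat (Poly_Mapping.lookup m' v) * c')) =
      Poly_Mapping.single (m + m' - ?e) (c * (of_nat (Poly_Mapping.lookup m' v) * c'))"
    using shift[of m' m] by (cases "Poly_Mapping.lookup m' v = 0") (auto simp: add.commute)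
  show ?thesis
    unfolding mp_pderiv_single mult_single 1 2
    by (simp add: lookup_add algebra_simps flip: single_add)
qed

lemma mp_pderiv_mult:
  "mp_pderiv v (p * q) = mp_pderiv v p * q + p * (mp_pderiv v q :: ('v, 'a::comm_semiring_1) mpoly)"
proof -
  let ?s = "\<lambda>p m. Poly_Mapping.single m (Poly_Mapping.lookup p m)"
  let ?K = "Poly_Mapping.keys p" and ?L = "Poly_Mapping.keys q"
  have "mp_pderiv v ((\<Sum>m\<in>?K. ?s p m) * (\<Sum>m\<in>?L. ?s q m)) =
      mp_pderiv v (\<Sum>m\<in>?K. ?s p m) * (\<Sum>m\<in>?L. ?s q m) +
      (\<Sum>m\<in>?K. ?s p m) * mp_pderiv v (\<Sum>m\<in>?L. ?s q m)"
    by (simp only: sum_product mp_pderiv_sum mp_pderiv_single_mult sum.distrib)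
  then show ?thesis by (simp flip: mp_monom_expansion)
qed

lemma mp_pderiv_Const [simp]: "mp_pderiv v (Const c) = 0"
  by (simp add: mp_pderiv_single)

lemma mp_pderiv_one [simp]: "mp_pderiv v 1 = 0"
  using mp_pderiv_Const[of v 1] by simp

lemma mp_pderiv_Var: "mp_pderiv v (Var u) = (if u = v then 1 else 0)"
  by (auto simp: Var_def mp_pderiv_single lookup_single)

lemma mp_pderiv_Var_simps [simp]:
  "mp_pderiv v (Var v) = 1" "u \<noteq> v \<Longrightarrow> mp_pderiv v (Var u) = 0"
  by (simp_all add: mp_pderiv_Var)

lemma mp_pderiv_uminus: "mp_pderiv v (- p) = - mp_pderiv v (p :: ('v, 'a::comm_ring_1) mpoly)"
  by (rule poly_mapping_eqI) (simp add: lookup_mp_pderiv)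

lemma mp_pderiv_diff:
  "mp_pderiv v (p - q) = mp_pderiv v p - mp_pderiv v (q :: ('v, 'a::comm_ring_1) mpoly)"
  by (rule poly_mapping_eqI) (simp add: lookup_mp_pderiv lookup_minus algebra_simps)

lemma mp_pderiv_of_nat [simp]: "mp_pderiv v (of_nat k) = 0"
  by (induction k) (simp_all add: mp_pderiv_add)

lemma mp_pderiv_numeral [simp]: "mp_pderiv v (numeral k) = 0"
  using mp_pderiv_of_nat[of v "numeral k"] by simp

lemma mp_pderiv_power:
  "mp_pderiv v (p ^ Suc k) = of_nat (Suc k) * p ^ k * (mp_pderiv v p :: ('v, 'a::comm_semiring_1) mpoly)"
  by (induction k) (simp_all add: mp_pderiv_mult algebra_simps)

lemma mp_pderiv_power_numeral:
  "mp_pderiv v (p ^ numeral k) =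
    numeral k * p ^ pred_numeral k * (mp_pderiv v p :: ('v, 'a::comm_semiring_1) mpoly)"
  using mp_pderiv_power[of v p "pred_numeral k"] by (simp add: numeral_eq_Suc[symmetric] flip: numeral_eq_Suc)

lemmas mp_pderiv_simps = mp_pderiv_add mp_pderiv_mult mp_pderiv_diff mp_pderiv_uminus
  mp_pderiv_sum mp_pderiv_power_numeral

lemma mp_vars_pderiv: "mp_vars (mp_pderiv v p) \<subseteq> mp_vars p"
proof
  fix u assume "u \<in> mp_vars (mp_pderiv v p)"
  then obtain m where m: "Poly_Mapping.lookup (mp_pderiv v p) m \<noteq> 0" "u \<in> Poly_Mapping.keys m"
    by (auto simp: mp_vars_def in_keys_iff)
  from m(1) have "Poly_Mapping.lookup p (m + Poly_Mapping.single v 1) \<noteq> 0"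
    by (auto simp: lookup_mp_pderiv)
  moreover have "u \<in> Poly_Mapping.keys (m + Poly_Mapping.single v 1)"
    using m(2) by (auto simp: in_keys_iff lookup_add)
  ultimately show "u \<in> mp_vars p" by (auto simp: mp_vars_def in_keys_iff)
qed

lemma mp_pderiv_not_var:
  fixes p :: "('v, 'a::comm_semiring_1) mpoly"
  shows "v \<notin> mp_vars p \<Longrightarrow> mp_pderiv v p = 0"
proof (rule poly_mapping_eqI)
  fix m :: "'v monom" assume v: "v \<notin> mp_vars p"
  have "v \<in> Poly_Mapping.keys (m + Poly_Mapping.single v 1)"
    by (auto simp: in_keys_iff lookup_add lookup_single)
  with v have "m + Poly_Mapping.single v 1 \<notin> Poly_Mapping.keys p"
    unfolding mp_vars_def by blast
  then have "Poly_Mapping.lookup p (m + Poly_Mapping.single v 1) = 0"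
    by (simp add: in_keys_iff)
  then show "Poly_Mapping.lookup (mp_pderiv v p) m = Poly_Mapping.lookup 0 m"
    by (simp add: lookup_mp_pderiv)
qed

text \<open>Both sides respect sums and products, so \<open>mp_induct\<close> suffices. The lemma
  links the formal \<open>mp_pderiv\<close> to complex derivatives along curves, whose uniqueness
  later yields identities between formal expressions.\<close>

lemma mp_eval_chain_rule:
  fixes p :: "('v, complex) mpoly"
  assumes "mp_vars p \<subseteq> V" "finite V"
    and "\<And>v. v \<in> V \<Longrightarrow> ((\<lambda>t. c t v) has_field_derivative c' v) (at t)"
  shows "((\<lambda>t. mp_eval (c t) p) has_field_derivative
     (\<Sum>v\<in>V. mp_eval (c t) (mp_pderiv v p) * c' v)) (at t)"
  using assms(1)
proof (induction rule: mp_induct)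
  case (Const k)
  then show ?case by simp
next
  case (Var v)
  have "(\<Sum>u\<in>V. mp_eval (c t) (mp_pderiv u (Var v)) * c' u) = (\<Sum>u\<in>V. if u = v then c' u else 0)"
    by (rule sum.cong) (auto simp: mp_pderiv_Var)
  also have "\<dots> = c' v" using Var assms(2) by simp
  finally show ?case using assms(3)[OF Var] by simp
next
  case (add p q)
  from DERIV_add[OF this] show ?case
    by (simp add: mp_eval_add mp_pderiv_add distrib_right sum.distrib)
next
  case (mult p q)
  from DERIV_mult[OF this] show ?case
    by (simp add: mp_eval_add mp_eval_mult mp_pderiv_mult algebra_simps sum.distrib sum_distrib_left)
qed

subsection \<open>Nonvanishing\<close>

text \<open>Kronecker substitution: the weights are powers of \<open>B\<close>, and exponents below
  \<open>B\<close> are the digits of the weighted sum in base \<open>B\<close>.\<close>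

lemma weight_injective:
  assumes "finite V"
  shows "\<exists>w :: 'v \<Rightarrow> nat. inj_on (\<lambda>f. \<Sum>v\<in>V. w v * f v)
           {f. (\<forall>v\<in>V. f v < B) \<and> (\<forall>v. v \<notin> V \<longrightarrow> f v = 0)}"
  using assms
proof (induction V)
  case empty
  then show ?case by (auto simp: inj_on_def)
next
  case (insert y V)
  then obtain w :: "'v \<Rightarrow> nat" where w: "inj_on (\<lambda>f. \<Sum>v\<in>V. w v * f v)
      {f. (\<forall>v\<in>V. f v < B) \<and> (\<forall>v. v \<notin> V \<longrightarrow> f v = 0)}" by blast
  \<comment> \<open>\<open>y\<close> becomes the last digit, and all earlier weights shift by one
    place.\<close>
  let ?w = "\<lambda>v. if v = y then 1 else B * w v"
  have val: "(\<Sum>v\<in>insert y V. ?w v * f v) = f y + B * (\<Sum>v\<in>V. w v * f v)" for f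
    using insert.hyps by (auto simp: sum_distrib_left mult.assoc intro!: sum.cong)
  show ?case
  proof (intro exI inj_onI)
    fix f g
    assume f: "f \<in> {f. (\<forall>v\<in>insert y V. f v < B) \<and> (\<forall>v. v \<notin> insert y V \<longrightarrow> f v = 0)}"
      and g: "g \<in> {f. (\<forall>v\<in>insert y V. f v < B) \<and> (\<forall>v. v \<notin> insert y V \<longrightarrow> f v = 0)}"
      and "(\<Sum>v\<in>insert y V. ?w v * f v) = (\<Sum>v\<in>insert y V. ?w v * g v)"
    then have eq: "f y + B * (\<Sum>v\<in>V. w v * f v) = g y + B * (\<Sum>v\<in>V. w v * g v)"
      by (simp only: val)
    from f g have lt: "f y < B" "g y < B" by auto
    have "f y = (f y + B * (\<Sum>v\<in>V. w v * f v)) mod B" using lt by simp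
    also have "\<dots> = g y" using lt by (simp add: eq)
    finally have y: "f y = g y" .
    with eq lt have "(\<Sum>v\<in>V. w v * f v) = (\<Sum>v\<in>V. w v * g v)" by simp
    moreover have "(\<Sum>v\<in>V. w v * (h(y := 0)) v) = (\<Sum>v\<in>V. w v * h v)" for h
      using insert.hyps by (auto intro!: sum.cong)
    ultimately have "(\<Sum>v\<in>V. w v * (f(y := 0)) v) = (\<Sum>v\<in>V. w v * (g(y := 0)) v)"
      by simp
    then have "f(y := 0) = g(y := 0)"
      by (rule inj_onD[OF w]) (use f g insert.hyps in auto)
    with y show "f = g" by (metis fun_upd_triv fun_upd_upd)
  qed
qed

text \<open>On the curve \<open>t ^ w v\<close> the distinct monomials of each polynomial become
  distinct powers of \<open>t\<close>, so nothing cancels and a nonzero univariate polynomial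
  remains. One curve serves the whole finite set.\<close>

lemma finite_zeros_on_weight_curve:
  fixes Ps :: "('v, complex) mpoly set"
  assumes "finite Ps" "0 \<notin> Ps"
  shows "\<exists>w :: 'v \<Rightarrow> nat. \<forall>p\<in>Ps. finite {t. mp_eval (\<lambda>v. t ^ w v) p = 0}"
proof -
  define V where "V = (\<Union>p\<in>Ps. mp_vars p)"
  \<comment> \<open>Larger than every exponent that occurs.\<close>
  define B where "B = Suc (\<Sum>p\<in>Ps. \<Sum>m\<in>Poly_Mapping.keys p. \<Sum>v\<in>Poly_Mapping.keys m. Poly_Mapping.lookup m v)"
  have fin: "finite V" unfolding V_def using assms(1) by auto
  obtain w :: "'v \<Rightarrow> nat" where w: "inj_on (\<lambda>f. \<Sum>v\<in>V. w v * f v)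
      {f. (\<forall>v\<in>V. f v < B) \<and> (\<forall>v. v \<notin> V \<longrightarrow> f v = 0)}"
    using weight_injective[OF fin] by blast
  define W where "W = (\<lambda>m. \<Sum>v\<in>V. w v * Poly_Mapping.lookup m v)"
  have small: "Poly_Mapping.lookup m v < B" if p: "p \<in> Ps" "m \<in> Poly_Mapping.keys p" for p m v
  proof (cases "v \<in> Poly_Mapping.keys m")
    case True
    then have "Poly_Mapping.lookup m v \<le> (\<Sum>v\<in>Poly_Mapping.keys m. Poly_Mapping.lookup m v)"
      by (intro member_le_sum) auto
    also have "\<dots> \<le> (\<Sum>m\<in>Poly_Mapping.keys p. \<Sum>v\<in>Poly_Mapping.keys m. Poly_Mapping.lookup m v)"
      by (rule member_le_sum[where f = "\<lambda>m. \<Sum>v\<in>Poly_Mapping.keys m. Poly_Mapping.lookup m v"]) (use p in auto)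
    also have "\<dots> < B"
      unfolding B_def less_Suc_eq_le
      by (rule member_le_sum[where f = "\<lambda>p. \<Sum>m\<in>Poly_Mapping.keys p. \<Sum>v\<in>Poly_Mapping.keys m. Poly_Mapping.lookup m v"])
        (use p assms(1) in auto)
    finally show ?thesis .
  next
    case False
    then show ?thesis by (auto simp: in_keys_iff B_def)
  qed
  have sub: "Poly_Mapping.keys m \<subseteq> V" if "p \<in> Ps" "m \<in> Poly_Mapping.keys p" for p m
    using that by (auto simp: V_def mp_vars_def)
  have out: "Poly_Mapping.lookup m v = 0" if "p \<in> Ps" "m \<in> Poly_Mapping.keys p" "v \<notin> V" for p m v
    using sub[OF that(1,2)] that(3) by (meson in_keys_iff subsetD)
  have "finite {t. mp_eval (\<lambda>v. t ^ w v) p = 0}" if p: "p \<in> Ps" for p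
  proof -
    let ?K = "Poly_Mapping.keys p"
    define q where "q = (\<Sum>m\<in>?K. monom (Poly_Mapping.lookup p m) (W m))"
    have W_inj: "m = m'" if "W m = W m'" "m \<in> ?K" "m' \<in> ?K" for m m'
    proof -
      have "Poly_Mapping.lookup m = Poly_Mapping.lookup m'"
        by (rule inj_onD[OF w]) (use that small[OF p] out[OF p] in \<open>auto simp: W_def\<close>)
      then show ?thesis by (simp add: lookup_inject)
    qed
    have ev: "mp_eval (\<lambda>v. t ^ w v) p = poly q t" for t
    proof -
      have "mon_eval (\<lambda>v. t ^ w v) m = t ^ W m" if "m \<in> ?K" for m
        using mon_eval_superset[OF fin sub[OF p that]]
        by (simp add: W_def power_sum power_mult)
      then show ?thesis
        unfolding mp_eval_def q_def by (simp add: poly_sum poly_monom)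
    qed
    from p assms(2) have "p \<noteq> 0" by auto
    then obtain m0 where m0: "m0 \<in> ?K" by (metis all_not_in_conv keys_eq_empty)
    have "coeff q (W m0) = (\<Sum>m\<in>?K. if W m = W m0 then Poly_Mapping.lookup p m else 0)"
      by (simp add: q_def coeff_sum)
    also have "\<dots> = (\<Sum>m\<in>?K. if m = m0 then Poly_Mapping.lookup p m else 0)"
      by (rule sum.cong) (use W_inj m0 in auto)
    also have "\<dots> \<noteq> 0" using m0 by (simp add: in_keys_iff)
    finally have "q \<noteq> 0" by auto
    then show ?thesis unfolding ev by (rule poly_roots_finite)
  qed
  then show ?thesis by blast
qed

text \<open>The generic choice used throughout: for identities of polynomials, for directions in
  which leading forms survive, and for parameter values off a hypersurface.\<close>

lemma common_nonvanishing_point: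
  fixes Ps :: "('v, complex) mpoly set"
  assumes "finite Ps" "0 \<notin> Ps"
  obtains a where "\<And>p. p \<in> Ps \<Longrightarrow> mp_eval a p \<noteq> 0"
proof -
  obtain w :: "'v \<Rightarrow> nat" where w: "\<forall>p\<in>Ps. finite {t. mp_eval (\<lambda>v. t ^ w v) p = 0}"
    using finite_zeros_on_weight_curve[OF assms] by blast
  then have "finite (\<Union>p\<in>Ps. {t. mp_eval (\<lambda>v. t ^ w v) p = 0})"
    using assms(1) by auto
  then obtain t where "t \<notin> (\<Union>p\<in>Ps. {t. mp_eval (\<lambda>v. t ^ w v) p = 0})"
    by (metis ex_new_if_finite infinite_UNIV_char_0)
  then show thesis by (intro that[of "\<lambda>v. t ^ w v"]) auto
qed

lemma mp_eq_iff_eval_eq: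
  fixes p q :: "('v, complex) mpoly"
  shows "p = q \<longleftrightarrow> (\<forall>a. mp_eval a p = mp_eval a q)"
proof
  assume "\<forall>a. mp_eval a p = mp_eval a q"
  then have "\<forall>a. mp_eval a (p - q) = 0" by (simp add: mp_eval_diff)
  with common_nonvanishing_point[of "{p - q}"] show "p = q" by force
qed simp

subsection \<open>Degrees\<close>

lemma mon_degree_superset:
  assumes "finite S" "Poly_Mapping.keys m \<subseteq> S"
  shows "mon_degree m = (\<Sum>v\<in>S. Poly_Mapping.lookup m v)"
  unfolding mon_degree_def
  by (rule sum.mono_neutral_left) (use assms in \<open>auto simp: in_keys_iff\<close>)

lemma mon_degree_add: "mon_degree (m + m') = mon_degree m + mon_degree m'"
proof -
  let ?S = "Poly_Mapping.keys m \<union> Poly_Mapping.keys m'"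
  have "Poly_Mapping.keys (m + m') \<subseteq> ?S" by (rule Poly_Mapping.keys_add)
  then show ?thesis
    by (simp add: mon_degree_superset[of ?S] lookup_add sum.distrib)
qed

lemma mon_degree_zero [simp]: "mon_degree 0 = 0"
  by (simp add: mon_degree_def)

lemma mon_degree_single [simp]: "mon_degree (Poly_Mapping.single v k) = k"
  by (cases "k = 0") (simp_all add: mon_degree_def)

lemma mon_degree_eq_0: "mon_degree m = 0 \<longleftrightarrow> m = 0"
  by (auto simp: mon_degree_def in_keys_iff intro!: poly_mapping_eqI)

definition deg_le :: "nat \<Rightarrow> ('v, 'a::zero) mpoly \<Rightarrow> bool" where
  "deg_le d p \<longleftrightarrow> (\<forall>m\<in>Poly_Mapping.keys p. mon_degree m \<le> d)"

lemma deg_le_mono: "deg_le d p \<Longrightarrow> d \<le> e \<Longrightarrow> deg_le e p"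
  by (auto simp: deg_le_def)

lemma deg_le_add: "deg_le d p \<Longrightarrow> deg_le d q \<Longrightarrow> deg_le d (p + q)"
  using Poly_Mapping.keys_add[of p q] by (auto simp: deg_le_def)

lemma deg_le_uminus: "deg_le d p \<Longrightarrow> deg_le d (- p :: ('v, 'a::comm_ring_1) mpoly)"
  by (auto simp: deg_le_def in_keys_iff)

lemma deg_le_diff: "deg_le d p \<Longrightarrow> deg_le d q \<Longrightarrow> deg_le d (p - q :: ('v, 'a::comm_ring_1) mpoly)"
  using deg_le_add[of d p "- q"] deg_le_uminus[of d q] by simp

lemma deg_le_mult: "deg_le d p \<Longrightarrow> deg_le e q \<Longrightarrow> deg_le (d + e) (p * q)"
  using keys_mult[of p q] by (fastforce simp: deg_le_def mon_degree_add intro: add_mono)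

lemma deg_le_sum: "(\<And>i. i \<in> I \<Longrightarrow> deg_le d (f i)) \<Longrightarrow> deg_le d (\<Sum>i\<in>I. f i)"
  by (induction I rule: infinite_finite_induct) (auto intro: deg_le_add simp: deg_le_def[of _ 0])

lemma deg_le_Const [simp]: "deg_le d (Const c)"
  by (auto simp: deg_le_def)

lemma deg_le_one [simp]: "deg_le d (1 :: ('v, 'a::comm_semiring_1) mpoly)"
  unfolding single_one[symmetric] by (rule deg_le_Const)

lemma deg_le_Var: "deg_le (Suc d) (Var v)"
  by (auto simp: deg_le_def Var_def)

lemma deg_le_power:
  "deg_le d p \<Longrightarrow> deg_le (k * d) (p ^ k :: ('v, 'a::comm_semiring_1) mpoly)"
  by (induction k) (auto intro: deg_le_mult)

lemma deg_le_prod: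
  "(\<And>i. i \<in> I \<Longrightarrow> deg_le (e i) (f i)) \<Longrightarrow>
    deg_le (\<Sum>i\<in>I. e i) (\<Prod>i\<in>I. f i :: ('v, 'a::comm_semiring_1) mpoly)"
  by (induction I rule: infinite_finite_induct) (auto intro: deg_le_mult)

lemma deg_le_numeral [simp]: "deg_le d (numeral k :: ('v, 'a::comm_semiring_1) mpoly)"
  unfolding single_numeral[symmetric] by (rule deg_le_Const)

lemma deg_le_pderiv: "deg_le (Suc d) p \<Longrightarrow> deg_le d (mp_pderiv v p)"
  unfolding deg_le_def
proof
  fix m assume p: "\<forall>m\<in>Poly_Mapping.keys p. mon_degree m \<le> Suc d"
    and "m \<in> Poly_Mapping.keys (mp_pderiv v p)"
  then have "m + Poly_Mapping.single v 1 \<in> Poly_Mapping.keys p"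
    by (auto simp: in_keys_iff lookup_mp_pderiv)
  with p have "mon_degree (m + Poly_Mapping.single v 1) \<le> Suc d" by blast
  then show "mon_degree m \<le> d" by (simp add: mon_degree_add)
qed

lemma finite_mon_degree_le: "finite {m :: 'v::finite monom. mon_degree m \<le> d}"
proof (rule finite_imageD)
  show "inj_on Poly_Mapping.lookup {m :: 'v monom. mon_degree m \<le> d}"
    by (auto simp: inj_on_def lookup_inject)
  have "Poly_Mapping.lookup m v \<le> d" if "mon_degree m \<le> d" for m :: "'v monom" and v
    using that member_le_sum[of v UNIV "Poly_Mapping.lookup m"]
    by (simp add: mon_degree_superset[of UNIV])
  then have "Poly_Mapping.lookup ` {m :: 'v monom. mon_degree m \<le> d} \<subseteq> PiE UNIV (\<lambda>_. {..d})"
    by auto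
  then show "finite (Poly_Mapping.lookup ` {m :: 'v monom. mon_degree m \<le> d})"
    by (rule finite_subset) (rule finite_PiE, auto)
qed

lemma finite_coord_index: "finite (coord_index d :: ('n::finite \<times> 'n monom) set)"
proof -
  have "coord_index d = (UNIV :: 'n set) \<times> {m. mon_degree m \<le> d}"
    by (auto simp: coord_index_def)
  then show ?thesis by (simp add: finite_mon_degree_le)
qed

subsection \<open>Linear systems\<close>

text \<open>
  Fraction-free Gaussian elimination: the pivots stay inside a class of functions closed under
  ring operations, and their product witnesses injectivity on a basic open set.
\<close>

lemma injective_system_open:
  fixes M :: "'f \<Rightarrow> 'k \<Rightarrow> 'j \<Rightarrow> complex" and R :: "('f \<Rightarrow> complex) \<Rightarrow> bool"
  assumes "finite J"
    and "\<And>k j. k \<in> K \<Longrightarrow> j \<in> J \<Longrightarrow> R (\<lambda>F. M F k j)"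
    and one: "R (\<lambda>_. 1)"
    and mult: "\<And>f g. R f \<Longrightarrow> R g \<Longrightarrow> R (\<lambda>F. f F * g F)"
    and diff: "\<And>f g. R f \<Longrightarrow> R g \<Longrightarrow> R (\<lambda>F. f F - g F)"
    and "\<And>v. \<forall>k\<in>K. (\<Sum>j\<in>J. M F0 k j * v j) = 0 \<Longrightarrow> \<forall>j\<in>J. v j = 0"
  shows "\<exists>\<delta>. R \<delta> \<and> \<delta> F0 \<noteq> 0 \<and> (\<forall>F v. \<delta> F \<noteq> 0 \<longrightarrow>
           (\<forall>k\<in>K. (\<Sum>j\<in>J. M F k j * v j) = 0) \<longrightarrow> (\<forall>j\<in>J. v j = 0))"
  using assms(1,2,6)
proof (induction J arbitrary: M)
  case empty
  then show ?case using one by (intro exI[of _ "\<lambda>_. 1"]) auto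
next
  case (insert j0 J M)
  \<comment> \<open>Otherwise the unit vector at \<open>j0\<close> would lie in the kernel at
    \<open>F0\<close>. Each unknown uses up a single pivot equation, so \<open>K\<close> may be
    infinite, as in systems indexed by all points.\<close>
  have "\<exists>k0\<in>K. M F0 k0 j0 \<noteq> 0"
  proof (rule ccontr)
    assume "\<not> ?thesis"
    then have "\<forall>k\<in>K. (\<Sum>j\<in>insert j0 J. M F0 k j * (if j = j0 then 1 else 0)) = 0"
      using insert.hyps by (auto intro!: sum.neutral)
    from insert.prems(2)[OF this] show False by auto
  qed
  then obtain k0 where k0: "k0 \<in> K" "M F0 k0 j0 \<noteq> 0" by blast
  define M' where "M' F k j = M F k0 j0 * M F k j - M F k j0 * M F k0 j" for F k j
  have M'_sum: "(\<Sum>j\<in>J. M' F k j * v j) =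
      M F k0 j0 * (\<Sum>j\<in>J. M F k j * v j) - M F k j0 * (\<Sum>j\<in>J. M F k0 j * v j)" for F k v
    by (simp add: M'_def sum_subtractf sum_distrib_left algebra_simps)
  have "\<exists>\<delta>. R \<delta> \<and> \<delta> F0 \<noteq> 0 \<and> (\<forall>F v. \<delta> F \<noteq> 0 \<longrightarrow>
           (\<forall>k\<in>K. (\<Sum>j\<in>J. M' F k j * v j) = 0) \<longrightarrow> (\<forall>j\<in>J. v j = 0))"
  proof (rule insert.IH)
    show "R (\<lambda>F. M' F k j)" if "k \<in> K" "j \<in> J" for k j
      unfolding M'_def using that k0(1) by (intro diff mult insert.prems(1)) auto
    show "\<forall>j\<in>J. v j = 0" if v: "\<forall>k\<in>K. (\<Sum>j\<in>J. M' F0 k j * v j) = 0" for v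
    proof -
      \<comment> \<open>Solving the pivot equation for \<open>j0\<close> lifts a kernel vector of
        the reduced system to one of the full system.\<close>
      define u where "u = v(j0 := - (\<Sum>j\<in>J. M F0 k0 j * v j) / M F0 k0 j0)"
      have sum_u: "(\<Sum>j\<in>J. M F0 k j * u j) = (\<Sum>j\<in>J. M F0 k j * v j)" for k
        using insert.hyps by (intro sum.cong) (auto simp: u_def)
      have "(\<Sum>j\<in>insert j0 J. M F0 k j * u j) = 0" if "k \<in> K" for k
      proof -
        have "M F0 k0 j0 * (\<Sum>j\<in>insert j0 J. M F0 k j * u j) = (\<Sum>j\<in>J. M' F0 k j * v j)"
          using insert.hyps k0(2) unfolding M'_sum
          by (simp add: sum_u) (simp add: u_def field_simps)
        with v that k0(2) show ?thesis by simp
      qed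
      with insert.prems(2)[of u] have "\<forall>j\<in>insert j0 J. u j = 0" by blast
      then show ?thesis using insert.hyps by (auto simp: u_def split: if_splits)
    qed
  qed
  then obtain \<delta> where \<delta>: "R \<delta>" "\<delta> F0 \<noteq> 0" and inj: "\<And>F v j. \<delta> F \<noteq> 0 \<Longrightarrow>
      \<forall>k\<in>K. (\<Sum>j\<in>J. M' F k j * v j) = 0 \<Longrightarrow> j \<in> J \<Longrightarrow> v j = 0" by blast
  show ?case
  proof (intro exI[of _ "\<lambda>F. \<delta> F * M F k0 j0"] conjI allI impI)
    show "R (\<lambda>F. \<delta> F * M F k0 j0)" using \<delta>(1) k0(1) by (intro mult insert.prems(1)) auto
    show "\<delta> F0 * M F0 k0 j0 \<noteq> 0" using \<delta>(2) k0(2) by simp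
    fix F v assume nz: "\<delta> F * M F k0 j0 \<noteq> 0"
      and v: "\<forall>k\<in>K. (\<Sum>j\<in>insert j0 J. M F k j * v j) = 0"
    have tail: "(\<Sum>j\<in>J. M F k j * v j) = - (M F k j0 * v j0)" if "k \<in> K" for k
      using v that insert.hyps by (auto simp: eq_neg_iff_add_eq_0 add.commute)
    have "\<forall>k\<in>K. (\<Sum>j\<in>J. M' F k j * v j) = 0"
      using k0(1) by (simp add: M'_sum tail)
    then have "v j = 0" if "j \<in> J" for j
      using inj[OF _ _ that] nz by auto
    moreover from this have "M F k0 j0 * v j0 = 0" using tail[OF k0(1)] by simp
    ultimately show "\<forall>j\<in>insert j0 J. v j = 0" using nz by auto
  qed
qed

text \<open>Here elimination runs over the equations: each pivot spends one equation and one
  unknown, so the inequality of cardinalities persists.\<close>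

lemma underdetermined_system:
  fixes M :: "'k \<Rightarrow> 'j \<Rightarrow> 'a::field"
  assumes "finite K" "finite J" "card K < card J"
  shows "\<exists>v. (\<exists>j\<in>J. v j \<noteq> 0) \<and> (\<forall>k\<in>K. (\<Sum>j\<in>J. M k j * v j) = 0)"
  using assms
proof (induction K arbitrary: M J)
  case empty
  then have "J \<noteq> {}" by auto
  then show ?case by (intro exI[of _ "\<lambda>_. 1"]) auto
next
  case (insert k0 K M J)
  show ?case
  proof (cases "\<forall>j\<in>J. M k0 j = 0")
    case True
    with insert.IH[OF insert.prems(1), of M] insert.prems insert.hyps show ?thesis by auto
  next
    case False
    then obtain j0 where j0: "j0 \<in> J" "M k0 j0 \<noteq> 0" by blast
    define M' where "M' k j = M k j - M k j0 / M k0 j0 * M k0 j" for k j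
    have "card K < card (J - {j0})" using insert.prems insert.hyps j0 by (simp add: card_Diff_singleton)
    from insert.IH[OF _ this, of M'] insert.prems(1)
    obtain v where v: "\<exists>j\<in>J - {j0}. v j \<noteq> 0" "\<forall>k\<in>K. (\<Sum>j\<in>J - {j0}. M' k j * v j) = 0"
      by auto
    define u where "u = v(j0 := - (\<Sum>j\<in>J - {j0}. M k0 j * v j) / M k0 j0)"
    have sum_u: "(\<Sum>j\<in>J. M k j * u j) =
        M k j0 * u j0 + (\<Sum>j\<in>J - {j0}. M k j * v j)" for k
      using j0 insert.prems(1) by (subst sum.remove[of J j0]) (auto simp: u_def intro!: sum.cong)
    have "(\<Sum>j\<in>J. M k j * u j) = 0" if "k \<in> insert k0 K" for k
    proof (cases "k = k0")
      case True
      then show ?thesis unfolding sum_u using j0 by (simp add: u_def)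
    next
      case False
      with that v(2) have "(\<Sum>j\<in>J - {j0}. M' k j * v j) = 0" by auto
      then show ?thesis unfolding sum_u
        by (simp add: M'_def u_def left_diff_distrib sum_subtractf sum_distrib_left mult.assoc
            flip: sum_divide_distrib)
    qed
    moreover have "\<exists>j\<in>J. u j \<noteq> 0" using v(1) by (auto simp: u_def)
    ultimately show ?thesis by blast
  qed
qed

subsection \<open>Regular functions on the space of polynomial mappings\<close>

text \<open>Agreement is required on \<open>Omega d\<close> only: evaluation at a point is a
  polynomial in finitely many coefficients just as long as the degree is bounded.\<close>

definition regular :: "nat \<Rightarrow> ('n::finite poly_map \<Rightarrow> complex) \<Rightarrow> bool" where
  "regular d \<phi> \<longleftrightarrow> (\<exists>p\<in>coord_polys d. \<forall>F\<in>Omega d. \<phi> F = mp_eval (coords F) p)"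

lemma regular_cong:
  assumes "regular d \<psi>" "\<And>F. F \<in> Omega d \<Longrightarrow> \<phi> F = \<psi> F"
  shows "regular d \<phi>"
proof -
  from assms(1) obtain p where "p \<in> coord_polys d" "\<forall>F\<in>Omega d. \<psi> F = mp_eval (coords F) p"
    unfolding regular_def by blast
  then show ?thesis unfolding regular_def using assms(2) by (intro bexI[of _ p]) simp_all
qed

lemma regular_const [simp]: "regular d (\<lambda>_. c)"
  unfolding regular_def
  by (intro bexI[of _ "Const c"]) (auto simp: coord_polys_def mp_vars_def)

lemma regular_add: "regular d \<phi> \<Longrightarrow> regular d \<psi> \<Longrightarrow> regular d (\<lambda>F. \<phi> F + \<psi> F)"
  unfolding regular_def
proof (elim bexE)
  fix p q
  assume *: "p \<in> coord_polys d" "q \<in> coord_polys d"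
    "\<forall>F\<in>Omega d. \<phi> F = mp_eval (coords F) p" "\<forall>F\<in>Omega d. \<psi> F = mp_eval (coords F) q"
  show "\<exists>r\<in>coord_polys d. \<forall>F\<in>Omega d. \<phi> F + \<psi> F = mp_eval (coords F) r"
  proof (rule bexI[of _ "p + q"])
    show "p + q \<in> coord_polys d"
      using *(1,2) mp_vars_add[of p q] by (auto simp: coord_polys_def)
  qed (use * in \<open>simp add: mp_eval_add\<close>)
qed

lemma regular_mult: "regular d \<phi> \<Longrightarrow> regular d \<psi> \<Longrightarrow> regular d (\<lambda>F. \<phi> F * \<psi> F)"
  unfolding regular_def
proof (elim bexE)
  fix p q
  assume *: "p \<in> coord_polys d" "q \<in> coord_polys d"
    "\<forall>F\<in>Omega d. \<phi> F = mp_eval (coords F) p" "\<forall>F\<in>Omega d. \<psi> F = mp_eval (coords F) q"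
  show "\<exists>r\<in>coord_polys d. \<forall>F\<in>Omega d. \<phi> F * \<psi> F = mp_eval (coords F) r"
  proof (rule bexI[of _ "p * q"])
    show "p * q \<in> coord_polys d"
      using *(1,2) mp_vars_mult[of p q] by (auto simp: coord_polys_def)
  qed (use * in \<open>simp add: mp_eval_mult\<close>)
qed

lemma regular_uminus: "regular d \<phi> \<Longrightarrow> regular d (\<lambda>F. - \<phi> F)"
  using regular_mult[OF regular_const[of d "-1"]] by simp

lemma regular_diff: "regular d \<phi> \<Longrightarrow> regular d \<psi> \<Longrightarrow> regular d (\<lambda>F. \<phi> F - \<psi> F)"
  using regular_add[OF _ regular_uminus, of d \<phi> \<psi>] by simp

lemma regular_sum: "(\<And>i. i \<in> I \<Longrightarrow> regular d (\<phi> i)) \<Longrightarrow> regular d (\<lambda>F. \<Sum>i\<in>I. \<phi> i F)"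
  by (induction I rule: infinite_finite_induct) (auto intro: regular_add)

lemma regular_prod: "(\<And>i. i \<in> I \<Longrightarrow> regular d (\<phi> i)) \<Longrightarrow> regular d (\<lambda>F. \<Prod>i\<in>I. \<phi> i F)"
  by (induction I rule: infinite_finite_induct) (auto intro: regular_mult)

lemma regular_power: "regular d \<phi> \<Longrightarrow> regular d (\<lambda>F. \<phi> F ^ k)"
  by (induction k) (auto intro: regular_mult)

lemma regular_det:
  fixes A :: "'n::finite poly_map \<Rightarrow> 'm::finite \<Rightarrow> 'm \<Rightarrow> complex"
  assumes "\<And>i j. regular d (\<lambda>F. A F i j)"
  shows "regular d (\<lambda>F. det (\<chi> i j. A F i j))"
  unfolding det_def by (intro regular_sum regular_mult regular_prod) (simp_all add: assms)

lemma regular_coord: "regular d (\<lambda>F. Poly_Mapping.lookup (F $ i) m)"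
proof (cases "mon_degree m \<le> d")
  case True
  then have "Var (i, m) \<in> coord_polys d"
    by (auto simp: coord_polys_def mp_vars_def Var_def coord_index_def)
  then show ?thesis
    unfolding regular_def by (intro bexI[of _ "Var (i, m)"]) (simp_all add: coords_def)
next
  \<comment> \<open>Not a coordinate of \<open>Omega d\<close>, but the coefficient is zero
    there.\<close>
  case False
  show ?thesis
    by (rule regular_cong[of _ "\<lambda>_. 0"]) (use False in \<open>force simp: Omega_def in_keys_iff\<close>)+
qed

lemma Omega_deg_le: "F \<in> Omega d \<longleftrightarrow> (\<forall>i. deg_le d (F $ i))"
  by (simp add: Omega_def deg_le_def)

lemma mp_eval_deg_le:
  fixes p :: "('n::finite, 'a::comm_semiring_1) mpoly"
  assumes "deg_le d p"
  shows "mp_eval x p = (\<Sum>m | mon_degree m \<le> d. Poly_Mapping.lookup p m * mon_eval x m)"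
  using assms by (intro mp_eval_superset) (auto simp: finite_mon_degree_le deg_le_def)

lemma regular_eval: "regular d (\<lambda>F. mp_eval x (F $ i))"
  by (rule regular_cong[of _ "\<lambda>F. \<Sum>m | mon_degree m \<le> d. Poly_Mapping.lookup (F $ i) m * mon_eval x m"])
    (auto simp: Omega_deg_le mp_eval_deg_le intro!: regular_sum regular_mult regular_coord)

lemma regular_eval_pderiv: "regular d (\<lambda>F. mp_eval x (mp_pderiv j (F $ i)))"
proof (rule regular_cong)
  fix F :: "'a poly_map" assume "F \<in> Omega d"
  then have "deg_le d (mp_pderiv j (F $ i))"
    using deg_le_pderiv deg_le_mono[of d "F $ i" "Suc d"] by (auto simp: Omega_deg_le)
  from mp_eval_deg_le[OF this]
  show "mp_eval x (mp_pderiv j (F $ i)) = (\<Sum>m | mon_degree m \<le> d.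
      of_nat (Poly_Mapping.lookup m j + 1) * Poly_Mapping.lookup (F $ i) (m + Poly_Mapping.single j 1)
      * mon_eval x m)"
    by (simp add: lookup_mp_pderiv)
qed (intro regular_sum regular_mult regular_coord regular_const)

lemma mp_eval_jacobian:
  "mp_eval x (jacobian F) = det (\<chi> i j. mp_eval x (mp_pderiv j (F $ i)))"
  by (simp add: jacobian_def mp_eval_det)

lemma regular_eval_jacobian: "regular d (\<lambda>F. mp_eval x (jacobian F))"
  unfolding mp_eval_jacobian by (intro regular_det regular_eval_pderiv)

lemma X_var_subset: "X_var d \<subseteq> Omega d"
  by (auto simp: X_var_def)

lemma closedin_regular_zero:
  assumes "regular d \<phi>"
  shows "closedin (X_zariski d) {F \<in> X_var d. \<phi> F = 0}"
proof -
  obtain p where p: "p \<in> coord_polys d" "\<forall>F\<in>Omega d. \<phi> F = mp_eval (coords F) p"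
    using assms by (auto simp: regular_def)
  then have "closedin (zariski d) (zero_locus d {p})" by (auto simp: closedin_zariski)
  moreover have "{F \<in> X_var d. \<phi> F = 0} = X_var d \<inter> zero_locus d {p}"
    using p X_var_subset[of d] by (auto simp: zero_locus_def subset_iff)
  ultimately show ?thesis
    unfolding X_zariski_def by (auto simp: closedin_subtopology)
qed

lemma openin_regular_nonzero:
  assumes "regular d \<phi>"
  shows "openin (X_zariski d) {F \<in> X_var d. \<phi> F \<noteq> 0}"
proof -
  have "{F \<in> X_var d. \<phi> F \<noteq> 0} = topspace (X_zariski d) - {F \<in> X_var d. \<phi> F = 0}" by auto
  then show ?thesis
    using openin_diff[OF openin_topspace closedin_regular_zero[OF assms]] by simp
qed

lemma irreducible_spaceD:
  assumes "irreducible_space T" "closedin T A" "closedin T B" "A \<union> B = topspace T"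
  shows "A = topspace T \<or> B = topspace T"
  using assms by (simp add: irreducible_space_def)

text \<open>Irreducibility in algebraic form: the regular functions, restricted to
  \<open>X_var d\<close>, have no zero divisors.\<close>

lemma irreducible_product:
  assumes "irreducible_space (X_zariski d :: 'n::finite poly_map topology)"
    and "regular d \<phi>" "regular d \<psi>"
    and "\<And>F :: 'n poly_map. F \<in> X_var d \<Longrightarrow> \<phi> F * \<psi> F = 0"
  shows "(\<forall>F\<in>X_var d. \<phi> F = 0) \<or> (\<forall>F\<in>X_var d. \<psi> F = 0)"
proof -
  have "{F \<in> X_var d. \<phi> F = 0} \<union> {F \<in> X_var d. \<psi> F = 0} = topspace (X_zariski d)"
    using assms(4) by auto
  from irreducible_spaceD[OF assms(1) closedin_regular_zero[OF assms(2)] closedin_regular_zero[OF assms(3)] this]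
  show ?thesis by auto
qed

lemma irreducible_dense:
  assumes "irreducible_space T" "openin T U" "U \<noteq> {}"
  shows "T closure_of U = topspace T"
proof -
  have "closedin T (T closure_of U)" "closedin T (topspace T - U)"
    using assms(2) by auto
  moreover have "T closure_of U \<union> (topspace T - U) = topspace T"
    using closure_of_subset[OF openin_subset[OF assms(2)]] closure_of_subset_topspace[of T U] by auto
  ultimately have "T closure_of U = topspace T \<or> topspace T - U = topspace T"
    by (rule irreducible_spaceD[OF assms(1)])
  moreover have "topspace T - U \<noteq> topspace T"
    using assms(3) openin_subset[OF assms(2)] by auto
  ultimately show ?thesis by simp
qed

subsection \<open>The degree of the inverse of an automorphism\<close>

lemma mon_eval_scale: "mon_eval (\<lambda>v. t * b v) m = t ^ mon_degree m * mon_eval b m"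
  by (simp add: mon_eval_def mon_degree_def power_mult_distrib prod.distrib power_sum)

text \<open>Let \<open>e\<close> be the degree of \<open>g\<close>. Along a generic line through the
  origin, the term with the largest relevant index \<open>J\<close> has degree at least
  \<open>J * e\<close>. If \<open>e > D\<close>, the lower terms cannot cancel it, since their
  degrees are at most \<open>D + (J - 1) * e\<close>.\<close>

lemma mp_root_degree_bound:
  fixes g :: "('v, complex) mpoly" and pp :: "nat \<Rightarrow> ('v, complex) mpoly"
  assumes deg: "\<And>j. deg_le D (pp j)" and nz: "j0 \<le> N" "pp j0 \<noteq> 0"
    and root: "\<And>y. (\<Sum>j\<le>N. mp_eval y (pp j) * mp_eval y g ^ j) = 0"
  shows "deg_le D g"
proof (rule ccontr)
  assume "\<not> deg_le D g"
  then obtain m1 where m1: "m1 \<in> Poly_Mapping.keys g" "mon_degree m1 > D"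
    by (auto simp: deg_le_def not_le)
  define e where "e = Max (mon_degree ` Poly_Mapping.keys g)"
  have e_max: "mon_degree m \<le> e" if "m \<in> Poly_Mapping.keys g" for m
    using that by (auto simp: e_def)
  have "e \<in> mon_degree ` Poly_Mapping.keys g" unfolding e_def using m1 by (intro Max_in) auto
  then obtain m0 where m0: "m0 \<in> Poly_Mapping.keys g" "mon_degree m0 = e" by auto
  have eD: "e > D" using e_max[OF m1(1)] m1(2) by simp
  \<comment> \<open>The leading form of \<open>g\<close>; its value at \<open>b\<close> is the
    coefficient of \<open>t ^ e\<close> on the line through \<open>b\<close>.\<close>
  define h where "h = (\<Sum>m\<in>{m \<in> Poly_Mapping.keys g. mon_degree m = e}.
      Poly_Mapping.single m (Poly_Mapping.lookup g m))"
  have "Poly_Mapping.lookup h m0 = Poly_Mapping.lookup g m0"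
    using m0 by (simp add: h_def lookup_sum lookup_single when_def sum.delta)
  then have "h \<noteq> 0" using m0(1) by (auto simp: in_keys_iff)
  define J where "J = (GREATEST j. j \<le> N \<and> pp j \<noteq> 0)"
  have J: "J \<le> N \<and> pp J \<noteq> 0"
    unfolding J_def by (rule GreatestI_nat[of _ j0 N]) (use nz in auto)
  have above_J: "pp j = 0" if "j \<le> N" "j > J" for j
    using Greatest_le_nat[of "\<lambda>j. j \<le> N \<and> pp j \<noteq> 0" j N] that by (fastforce simp: J_def)
  obtain b where b: "mp_eval b h \<noteq> 0" "mp_eval b (pp J) \<noteq> 0"
    using common_nonvanishing_point[of "{h, pp J}"] \<open>h \<noteq> 0\<close> J by (metis finite.emptyI finite.insertI insert_iff singletonD)
  define U where "U p = (\<Sum>m\<in>Poly_Mapping.keys p.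
      monom (Poly_Mapping.lookup p m * mon_eval b m) (mon_degree m))" for p
  have poly_U: "poly (U p) t = mp_eval (\<lambda>v. t * b v) p" for p t
    by (simp add: U_def mp_eval_def poly_sum poly_monom mon_eval_scale mult_ac)
  have deg_U: "degree (U p) \<le> k" if "deg_le k p" for p k
    unfolding U_def using that
    by (intro degree_sum_le) (auto simp: deg_le_def intro: order_trans[OF degree_monom_le])
  have "coeff (U g) e = (\<Sum>m\<in>Poly_Mapping.keys g.
      if mon_degree m = e then Poly_Mapping.lookup g m * mon_eval b m else 0)"
    by (simp add: U_def coeff_sum)
  also have "\<dots> = mp_eval b h"
    by (simp add: h_def mp_eval_sum mp_eval_single flip: sum.inter_filter)
  finally have "degree (U g) \<ge> e" using b(1) by (intro le_degree) auto
  with deg_U[of e g] e_max have deg_g: "degree (U g) = e" by (auto simp: deg_le_def)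
  have U_J: "U (pp J) \<noteq> 0" using poly_U[of "pp J" 1] b(2) by auto
  have "poly (\<Sum>j\<le>J. U (pp j) * U g ^ j) t = 0" for t
  proof -
    have "(\<Sum>j\<le>N. mp_eval y (pp j) * mp_eval y g ^ j) = (\<Sum>j\<le>J. mp_eval y (pp j) * mp_eval y g ^ j)" for y
      by (rule sum.mono_neutral_right) (use J above_J in auto)
    with root show ?thesis by (simp add: poly_sum poly_U)
  qed
  then have sum0: "(\<Sum>j\<le>J. U (pp j) * U g ^ j) = 0" using poly_all_0_iff_0 by blast
  have "U g \<noteq> 0" using deg_g eD by auto
  show False
  proof (cases J)
    case 0
    with sum0 U_J show False by simp
  next
    case (Suc J')
    have "U (pp J) * U g ^ J = - (\<Sum>j\<le>J'. U (pp j) * U g ^ j)"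
      using sum0 by (simp add: Suc eq_neg_iff_add_eq_0 add.commute)
    moreover have "degree (\<Sum>j\<le>J'. U (pp j) * U g ^ j) \<le> D + J' * e"
    proof (rule degree_sum_le)
      fix j assume "j \<in> {..J'}"
      then have "degree (U (pp j) * U g ^ j) \<le> D + j * e"
        using degree_mult_le[of "U (pp j)" "U g ^ j"] degree_power_le[of "U g" j] deg_U[OF deg, of j]
        by (simp add: deg_g mult.commute)
      also have "\<dots> \<le> D + J' * e" using \<open>j \<in> {..J'}\<close> by simp
      finally show "degree (U (pp j) * U g ^ j) \<le> D + J' * e" .
    qed auto
    moreover have "degree (U (pp J) * U g ^ J) \<ge> J * e"
      using U_J \<open>U g \<noteq> 0\<close> by (simp add: degree_mult_eq degree_power_eq deg_g)
    ultimately show False using eD Suc by simp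
  qed
qed

text \<open>Exponents are bounded separately rather than in total because the count is then an exact
  power, which keeps the comparison of dimensions short.\<close>

definition box :: "nat \<Rightarrow> 'n::finite monom set" where
  "box a = {m. \<forall>v. Poly_Mapping.lookup m v \<le> a}"

lemma box_finite_card: "finite (box a :: 'n::finite monom set)"
  "card (box a :: 'n monom set) = (a + 1) ^ CARD('n)"
proof -
  have img: "Poly_Mapping.lookup ` (box a :: 'n monom set) = PiE UNIV (\<lambda>_. {..a})"
  proof
    show "PiE UNIV (\<lambda>_. {..a}) \<subseteq> Poly_Mapping.lookup ` (box a :: 'n monom set)"
    proof
      fix f :: "'n \<Rightarrow> nat" assume "f \<in> PiE UNIV (\<lambda>_. {..a})"
      then show "f \<in> Poly_Mapping.lookup ` box a"
        by (intro image_eqI[of _ _ "Abs_poly_mapping f"]) (auto simp: box_def)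
    qed
  qed (auto simp: box_def)
  have inj: "inj_on Poly_Mapping.lookup (box a :: 'n monom set)"
    by (auto simp: inj_on_def lookup_inject)
  have fin: "finite (PiE UNIV (\<lambda>_::'n. {..a}))" by (rule finite_PiE) auto
  show "finite (box a :: 'n monom set)"
    using fin finite_imageD[OF _ inj] img by simp
  have "card (box a :: 'n monom set) = card (PiE UNIV (\<lambda>_::'n. {..a}))"
    using card_image[OF inj] img by simp
  then show "card (box a :: 'n monom set) = (a + 1) ^ CARD('n)" by (simp add: card_PiE)
qed

lemma deg_le_subset_box: "deg_le D p \<Longrightarrow> Poly_Mapping.keys p \<subseteq> box D"
proof
  fix m assume "deg_le D p" "m \<in> Poly_Mapping.keys p"
  then have "mon_degree m \<le> D" by (auto simp: deg_le_def)
  moreover have "Poly_Mapping.lookup m v \<le> mon_degree m" for v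
    by (simp add: mon_degree_superset[of UNIV] member_le_sum)
  ultimately show "m \<in> box D" by (auto simp: box_def intro: order_trans)
qed

text \<open>The products of powers of the components with powers of the variable \<open>i\<close>
  outnumber the monomials available to them, so a nontrivial relation holds between \<open>F\<close>
  and this variable. Substituting \<open>x = G y\<close> makes \<open>G $ i\<close> a root of a
  polynomial whose coefficients have degree at most \<open>n * a\<close>, and
  \<open>mp_root_degree_bound\<close> applies.\<close>

lemma automorphism_inverse_degree:
  fixes F G :: "'n::finite poly_map"
  assumes F: "F \<in> Omega d" and GF: "pm_eval G \<circ> pm_eval F = id" and FG: "pm_eval F \<circ> pm_eval G = id"
  shows "deg_le (CARD('n) * (CARD('n) * d + 1) ^ CARD('n)) (G $ i)"
proof -
  let ?n = "CARD('n)"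
  \<comment> \<open>Chosen so that \<open>(D + 1) ^ n \<le> a * (a + 1) ^ n\<close>, which is less
    than the number \<open>(a + 1) ^ (n + 1)\<close> of products; \<open>D\<close> bounds their
    degrees.\<close>
  define a where "a = (?n * d + 1) ^ ?n"
  define D where "D = ?n * (a * d) + a"
  define Pf where "Pf = (\<lambda>(\<alpha> :: 'n monom, j). (\<Prod>k\<in>UNIV. (F $ k) ^ Poly_Mapping.lookup \<alpha> k) * Var i ^ j)"
  let ?C = "box a \<times> {..a} :: ('n monom \<times> nat) set"
  have finC: "finite ?C" by (simp add: box_finite_card)
  have keys_Pf: "Poly_Mapping.keys (Pf c) \<subseteq> box D" if "c \<in> ?C" for c
  proof -
    obtain \<alpha> j where c: "c = (\<alpha>, j)" by (cases c)
    have "deg_le (Poly_Mapping.lookup \<alpha> k * d) (F $ k ^ Poly_Mapping.lookup \<alpha> k)" for k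
      by (rule deg_le_power) (use F in \<open>simp add: Omega_deg_le\<close>)
    then have "deg_le ((\<Sum>k\<in>UNIV. Poly_Mapping.lookup \<alpha> k * d) + j * 1) (Pf c)"
      unfolding Pf_def c prod.case
      by (intro deg_le_mult deg_le_prod deg_le_power)
        (use F in \<open>auto simp: Omega_deg_le deg_le_Var[of 0, simplified]\<close>)
    moreover have "(\<Sum>k\<in>UNIV. Poly_Mapping.lookup \<alpha> k * d) \<le> (\<Sum>k\<in>(UNIV :: 'n set). a * d)"
      using that by (intro sum_mono mult_right_mono) (auto simp: c box_def)
    moreover have "j \<le> a" using that by (simp add: c)
    ultimately show ?thesis
      by (intro deg_le_subset_box) (auto elim!: deg_le_mono simp: D_def)
  qed
  have "card (box D :: 'n monom set) < card ?C"
  proof -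
    have "D + 1 \<le> (?n * d + 1) * (a + 1)" by (simp add: D_def algebra_simps)
    then have "(D + 1) ^ ?n \<le> ((?n * d + 1) * (a + 1)) ^ ?n" by (rule power_mono) simp
    also have "\<dots> = a * (a + 1) ^ ?n" by (simp only: power_mult_distrib a_def[symmetric])
    also have "\<dots> < (a + 1) ^ ?n * (a + 1)" by simp
    finally show ?thesis by (simp add: box_finite_card card_cartesian_product)
  qed
  from underdetermined_system[OF box_finite_card(1) finC this, of "\<lambda>k c. Poly_Mapping.lookup (Pf c) k"]
  obtain v where v: "\<exists>c\<in>?C. v c \<noteq> 0"
    "\<forall>k\<in>box D. (\<Sum>c\<in>?C. Poly_Mapping.lookup (Pf c) k * v c) = 0"
    by (elim exE conjE)
  have ev0: "(\<Sum>c\<in>?C. v c * mp_eval x (Pf c)) = 0" for x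
  proof -
    have "(\<Sum>c\<in>?C. v c * mp_eval x (Pf c)) =
        (\<Sum>c\<in>?C. \<Sum>k\<in>box D. v c * (Poly_Mapping.lookup (Pf c) k * mon_eval x k))"
      by (rule sum.cong) (auto simp: mp_eval_superset[OF box_finite_card(1) keys_Pf] sum_distrib_left)
    also have "\<dots> = (\<Sum>k\<in>box D. mon_eval x k * (\<Sum>c\<in>?C. Poly_Mapping.lookup (Pf c) k * v c))"
      by (subst sum.swap) (simp add: sum_distrib_left mult_ac)
    also have "\<dots> = 0" using v(2) by simp
    finally show ?thesis .
  qed
  \<comment> \<open>The relation is regrouped by powers of the variable \<open>i\<close>, with the
    components of \<open>F\<close> replaced by fresh variables.\<close>
  define pp where "pp j = (\<Sum>\<alpha>\<in>box a. Poly_Mapping.single \<alpha> (if j \<le> a then v (\<alpha>, j) else 0))" for j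
  have lookup_pp: "Poly_Mapping.lookup (pp j) \<alpha> = (if j \<le> a then v (\<alpha>, j) else 0)" if "\<alpha> \<in> box a" for \<alpha> j
    using that by (simp add: pp_def lookup_sum lookup_single when_def sum.delta box_finite_card)
  have root: "(\<Sum>j\<le>a. mp_eval y (pp j) * mp_eval y (G $ i) ^ j) = 0" for y
  proof -
    define z where "z = pm_eval G (\<chi> k. y k)"
    have "pm_eval F z = (\<chi> k. y k)" using FG unfolding z_def by (metis comp_apply id_apply)
    then have Fz: "mp_eval (($) z) (F $ k) = y k" for k by (simp add: pm_eval_def vec_eq_iff)
    have zi: "z $ i = mp_eval y (G $ i)" by (simp add: z_def pm_eval_def vec_lambda_inverse)
    have "0 = (\<Sum>(\<alpha>, j)\<in>?C. v (\<alpha>, j) * (mon_eval y \<alpha> * mp_eval y (G $ i) ^ j))"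
      using ev0[of "($) z"]
      by (simp add: Pf_def mp_eval_simps Fz zi case_prod_unfold mon_eval_superset[of UNIV])
    also have "\<dots> = (\<Sum>j\<le>a. \<Sum>\<alpha>\<in>box a. v (\<alpha>, j) * (mon_eval y \<alpha> * mp_eval y (G $ i) ^ j))"
      by (subst sum.swap) (simp add: sum.cartesian_product)
    also have "\<dots> = (\<Sum>j\<le>a. mp_eval y (pp j) * mp_eval y (G $ i) ^ j)"
      by (rule sum.cong) (auto simp: pp_def mp_eval_sum mp_eval_single sum_distrib_right mult.assoc)
    finally show ?thesis by simp
  qed
  obtain \<alpha> j where nz: "\<alpha> \<in> box a" "j \<le> a" "v (\<alpha>, j) \<noteq> 0" using v(1) by auto
  then have "pp j \<noteq> 0" using lookup_pp[of \<alpha> j] by auto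
  moreover have "deg_le (?n * a) (pp j)" for j
    unfolding pp_def
  proof (rule deg_le_sum)
    fix \<alpha> :: "'n monom" assume \<alpha>: "\<alpha> \<in> box a"
    have "mon_degree \<alpha> \<le> ?n * a"
      using \<alpha> sum_bounded_above[of UNIV "Poly_Mapping.lookup \<alpha>" a]
      by (simp add: mon_degree_superset[of UNIV] box_def)
    then show "deg_le (?n * a) (Poly_Mapping.single \<alpha> (if j \<le> a then v (\<alpha>, j) else 0))"
      by (auto simp: deg_le_def)
  qed
  ultimately show ?thesis
    unfolding a_def[symmetric] by (intro mp_root_degree_bound[OF _ nz(2) _ root])
qed

subsection \<open>One non-injective mapping makes the generic mapping a counterexample\<close>

lemma mp_const_of_pderiv_zero:
  fixes P :: "('v, complex) mpoly"
  assumes "\<And>v. mp_pderiv v P = 0"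
  shows "P = Const (Poly_Mapping.lookup P 0)"
proof (rule poly_mapping_eqI)
  fix m :: "'v monom"
  show "Poly_Mapping.lookup P m = Poly_Mapping.lookup (Const (Poly_Mapping.lookup P 0)) m"
  proof (cases "m = 0")
    case False
    then obtain v where v: "Poly_Mapping.lookup m v \<noteq> 0" by (metis lookup_zero poly_mapping_eqI)
    let ?m = "m - Poly_Mapping.single v 1"
    have "?m + Poly_Mapping.single v 1 = m"
      using v by (intro poly_mapping_eqI) (auto simp: lookup_add lookup_minus lookup_single when_def)
    with lookup_mp_pderiv[of v P ?m] assms[of v]
    have "of_nat (Poly_Mapping.lookup ?m v + 1) * Poly_Mapping.lookup P m = 0" by simp
    then have "Poly_Mapping.lookup P m = 0"
      by (metis Suc_eq_plus1 mult_eq_0_iff of_nat_neq_0)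
    then show ?thesis using False by (simp add: lookup_single)
  qed simp
qed

text \<open>Induction on the degree of \<open>P\<close>. Differentiating \<open>P(F(x)) = 0\<close>
  shows that the transposed Jacobian matrix kills the gradient of \<open>P\<close> at
  \<open>F(x)\<close>. The matrix is invertible, so the partial derivatives of \<open>P\<close>
  vanish along \<open>F\<close> as well and are zero by induction; then \<open>P\<close> is a
  constant, with value zero.\<close>

lemma Keller_components_independent:
  fixes F :: "'n::finite poly_map"
  assumes jac: "jacobian F = 1"
    and "\<And>x. mp_eval (($) (pm_eval F x)) P = 0"
  shows "P = 0"
proof -
  have "P = 0" if "deg_le k P" "\<And>x. mp_eval (($) (pm_eval F x)) P = 0" for k P
    using that
  proof (induction k arbitrary: P)
    case 0
    then have "P = Const (Poly_Mapping.lookup P 0)"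
      by (intro poly_mapping_eqI) (force simp: deg_le_def lookup_single when_def in_keys_iff mon_degree_eq_0)
    with 0(2)[of 0] show ?case by (metis mp_eval_Const single_zero)
  next
    case (Suc k)
    have vanish: "mp_eval (($) (pm_eval F x)) (mp_pderiv v P) = 0" for x v
    proof -
      define A where "A = (\<chi> i j. mp_eval (($) x) (mp_pderiv j (F $ i)))"
      define w where "w = (\<chi> i. mp_eval (($) (pm_eval F x)) (mp_pderiv i P))"
      have "(transpose A *v w) $ j = 0" for j
      proof -
        \<comment> \<open>The line through \<open>x\<close> in the direction of the coordinate
          \<open>j\<close>.\<close>
        define c where "c t u = x $ u + (if u = j then t else 0)" for t :: complex and u
        have c: "((\<lambda>t. c t u) has_field_derivative (if u = j then 1 else 0)) (at 0)" for u
          unfolding c_def by (auto intro!: derivative_eq_intros)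
        have c0: "c 0 = ($) x" by (auto simp: c_def fun_eq_iff)
        have inner: "((\<lambda>t. mp_eval (c t) (F $ i)) has_field_derivative A $ i $ j) (at 0)" for i
          using mp_eval_chain_rule[where V = UNIV and c = c and t = 0 and p = "F $ i"
              and c' = "\<lambda>u. if u = j then 1 else 0", OF subset_UNIV finite c]
          by (simp add: c0 A_def if_distrib cong: if_cong)
        have "((\<lambda>t. mp_eval (\<lambda>i. mp_eval (c t) (F $ i)) P) has_field_derivative
            (\<Sum>i\<in>UNIV. mp_eval (\<lambda>i. mp_eval (c 0) (F $ i)) (mp_pderiv i P) * A $ i $ j)) (at 0)"
          by (rule mp_eval_chain_rule[OF subset_UNIV finite inner])
        moreover have "mp_eval (\<lambda>i. mp_eval (c t) (F $ i)) P = 0" for t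
        proof -
          have "($) (pm_eval F (\<chi> u. c t u)) = (\<lambda>i. mp_eval (c t) (F $ i))"
            by (simp add: pm_eval_def fun_eq_iff vec_lambda_inverse)
          with Suc.prems(2)[of "\<chi> u. c t u"] show ?thesis by simp
        qed
        ultimately have "(\<Sum>i\<in>UNIV. mp_eval (\<lambda>i. mp_eval (c 0) (F $ i)) (mp_pderiv i P) * A $ i $ j) = 0"
          by (simp add: DERIV_unique[OF _ DERIV_const])
        moreover have "(\<lambda>i. mp_eval (c 0) (F $ i)) = ($) (pm_eval F x)"
          by (simp add: c0 pm_eval_def fun_eq_iff)
        ultimately show ?thesis
          by (simp add: matrix_vector_mult_def transpose_def w_def mult.commute)
      qed
      then have "transpose A *v w = 0" by (simp add: vec_eq_iff)
      moreover have "det (transpose A) = 1"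
        using mp_eval_jacobian[of "($) x" F] jac by (simp add: A_def det_transpose)
      then have "invertible (transpose A)" by (simp add: invertible_det_nz)
      then obtain B where "B ** transpose A = mat 1" by (auto simp: invertible_def)
      ultimately have "w = 0" using matrix_left_invertible_ker[of "transpose A"] by blast
      then show ?thesis by (simp add: w_def vec_eq_iff)
    qed
    have "mp_pderiv v P = 0" for v
      by (rule Suc.IH[OF deg_le_pderiv[OF Suc.prems(1)] vanish])
    then have "P = Const (Poly_Mapping.lookup P 0)" by (rule mp_const_of_pderiv_zero)
    with Suc.prems(2)[of 0] show ?case by (metis mp_eval_Const single_zero)
  qed
  moreover have "deg_le (Max (insert 0 (mon_degree ` Poly_Mapping.keys P))) P"
    by (auto simp: deg_le_def)
  ultimately show ?thesis using assms(2) by blast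
qed

text \<open>The linear system asks for a combination of \<open>x $ i\<close> and the monomials in
  \<open>F(x)\<close> that vanishes at all points \<open>x\<close>. An automorphism provides a
  nontrivial solution through its inverse, whereas \<open>F0\<close> admits only the trivial one,
  and this is an open condition.\<close>

lemma generic_counterexample:
  fixes F0 :: "'n::finite poly_map"
  assumes irr: "irreducible_space (X_zariski d :: 'n poly_map topology)"
    and F0: "F0 \<in> X_var d" and coll: "pm_eval F0 a = pm_eval F0 b" "a \<noteq> b"
  shows "\<exists>U :: 'n poly_map set. openin (X_zariski d) U \<and> U \<noteq> {} \<and>
           X_zariski d closure_of U = topspace (X_zariski d) \<and>
           (\<forall>F\<in>U. jc_counterexample d F)"
proof -
  \<comment> \<open>The degree bound for inverses, uniform over \<open>Omega d\<close>.\<close>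
  define K where "K = CARD('n) * (CARD('n) * d + 1) ^ CARD('n)"
  obtain i where i: "a $ i \<noteq> b $ i" using coll(2) by (auto simp: vec_eq_iff)
  define J where "J = insert None (Some ` {m :: 'n monom. mon_degree m \<le> K})"
  define M where "M F x j = (case j of None \<Rightarrow> x $ i | Some m \<Rightarrow> mon_eval (($) (pm_eval F x)) m)"
    for F :: "'n poly_map" and x j
  have sum_M: "(\<Sum>j\<in>J. M F x j * v j) = x $ i * v None +
      mp_eval (($) (pm_eval F x)) (\<Sum>m | mon_degree m \<le> K. Poly_Mapping.single m (v (Some m)))"
    for F x v
    unfolding J_def
    by (subst sum.insert)
      (auto simp: finite_mon_degree_le M_def sum.reindex mp_eval_sum mp_eval_single mult.commute)
  have "\<exists>\<delta>. regular d \<delta> \<and> \<delta> F0 \<noteq> 0 \<and> (\<forall>F v. \<delta> F \<noteq> 0 \<longrightarrow>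
      (\<forall>x\<in>UNIV. (\<Sum>j\<in>J. M F x j * v j) = 0) \<longrightarrow> (\<forall>j\<in>J. v j = 0))"
  proof (rule injective_system_open[where R = "regular d"])
    show "finite J" by (simp add: J_def finite_mon_degree_le)
    show "regular d (\<lambda>F. M F x j)" for x j
      by (cases j) (simp_all add: M_def mon_eval_superset[of UNIV] pm_eval_def
          regular_prod regular_power regular_eval)
    show "\<forall>j\<in>J. v j = 0" if "\<forall>x\<in>UNIV. (\<Sum>j\<in>J. M F0 x j * v j) = 0" for v
    proof -
      let ?P = "\<Sum>m | mon_degree m \<le> K. Poly_Mapping.single m (v (Some m)) :: ('n, complex) mpoly"
      have ev: "x $ i * v None + mp_eval (($) (pm_eval F0 x)) ?P = 0" for x
        using that unfolding sum_M by blast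
      \<comment> \<open>Comparing the relations at \<open>a\<close> and \<open>b\<close>, where the
        polynomial parts agree, isolates \<open>v None\<close>.\<close>
      have "a $ i * v None + mp_eval (($) (pm_eval F0 b)) ?P = b $ i * v None + mp_eval (($) (pm_eval F0 b)) ?P"
        using ev[of a] unfolding ev[of b] coll(1) .
      with i have v0: "v None = 0" by simp
      have "jacobian F0 = 1" using F0 by (simp add: X_var_def)
      moreover have "mp_eval (($) (pm_eval F0 x)) ?P = 0" for x
        using ev[of x] unfolding v0 by simp
      ultimately have "?P = 0" by (rule Keller_components_independent)
      then have zero: "Poly_Mapping.lookup ?P m = 0" for m by (metis lookup_zero)
      have "v (Some m) = 0" if "mon_degree m \<le> K" for m
        using that zero[of m] by (simp add: lookup_sum lookup_single when_def sum.delta finite_mon_degree_le)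
      with v0 show ?thesis by (auto simp: J_def)
    qed
  qed (auto intro: regular_mult regular_diff)
  then obtain \<delta> where \<delta>: "regular d \<delta>" "\<delta> F0 \<noteq> 0" and inj: "\<forall>F v. \<delta> F \<noteq> 0 \<longrightarrow>
      (\<forall>x\<in>UNIV. (\<Sum>j\<in>J. M F x j * v j) = 0) \<longrightarrow> (\<forall>j\<in>J. v j = 0)" by (elim exE conjE)
  define U where "U = {F \<in> X_var d. \<delta> F \<noteq> 0}"
  have "openin (X_zariski d) U" unfolding U_def by (rule openin_regular_nonzero[OF \<delta>(1)])
  moreover have "U \<noteq> {}" using F0 \<delta>(2) by (auto simp: U_def)
  moreover have "jc_counterexample d F" if "F \<in> U" for F
    unfolding jc_counterexample_def
  proof
    show X: "F \<in> X_var d" using that by (simp add: U_def)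
    show "\<not> poly_automorphism F"
    proof
      assume "poly_automorphism F"
      then obtain G where G: "pm_eval G \<circ> pm_eval F = id" "pm_eval F \<circ> pm_eval G = id"
        by (auto simp: poly_automorphism_def)
      have "deg_le K (G $ i)"
        unfolding K_def
        by (rule automorphism_inverse_degree[OF _ G]) (use X X_var_subset[of d] in auto)
      \<comment> \<open>The relation says that \<open>G $ i\<close> at \<open>F(x)\<close> equals
        \<open>x $ i\<close>; the entry -1 at \<open>None\<close> makes it nontrivial.\<close>
      define v where "v j = (case j of None \<Rightarrow> -1 | Some m \<Rightarrow> Poly_Mapping.lookup (G $ i) m)" for j
      have "(\<Sum>m | mon_degree m \<le> K. Poly_Mapping.single m (v (Some m))) = G $ i"
        by (rule poly_mapping_eqI)
          (use \<open>deg_le K (G $ i)\<close> in \<open>auto simp: lookup_sum lookup_single when_def sum.delta'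
            finite_mon_degree_le v_def deg_le_def in_keys_iff\<close>)
      moreover have "mp_eval (($) (pm_eval F x)) (G $ i) = x $ i" for x
      proof -
        have "pm_eval G (pm_eval F x) = x" using G(1) by (metis comp_apply id_apply)
        then have "pm_eval G (pm_eval F x) $ i = x $ i" by simp
        then show ?thesis unfolding pm_eval_def[of G] by simp
      qed
      ultimately have "\<forall>x. (\<Sum>j\<in>J. M F x j * v j) = 0"
        by (simp add: sum_M) (simp add: v_def)
      moreover have "\<delta> F \<noteq> 0" using that by (simp add: U_def)
      ultimately have "\<forall>j\<in>J. v j = 0" using inj by simp
      then have "v None = 0" by (simp add: J_def)
      then show False by (simp add: v_def)
    qed
  qed
  ultimately show ?thesis using irreducible_dense[OF irr, of U] by (intro exI[of _ U]) simp
qed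

subsection \<open>Non-injective Keller mappings\<close>

text \<open>A permutation that moves some \<open>i \<notin> S\<close> picks a zero from a unit row.
  This reduces determinants over an index type of unspecified size to a few rows.\<close>

lemma det_unit_rows:
  fixes A :: "'a::comm_ring_1 ^ 'n::finite ^ 'n"
  assumes "\<And>i j. i \<notin> S \<Longrightarrow> A $ i $ j = (if i = j then 1 else 0)"
  shows "det A = (\<Sum>p | p permutes S. of_int (sign p) * (\<Prod>i\<in>S. A $ i $ p i))"
proof -
  have "det A = (\<Sum>p | p permutes S. of_int (sign p) * (\<Prod>i\<in>UNIV. A $ i $ p i))"
    unfolding det_def
  proof (rule sum.mono_neutral_right)
    show "{p. p permutes S} \<subseteq> {p. p permutes UNIV}" by (auto intro: permutes_subset)
    show "\<forall>p\<in>{p. p permutes UNIV} - {p. p permutes S}. of_int (sign p) * (\<Prod>i\<in>UNIV. A $ i $ p i) = 0"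
    proof
      fix p :: "'n \<Rightarrow> 'n" assume p: "p \<in> {p. p permutes UNIV} - {p. p permutes S}"
      then obtain i where i: "i \<notin> S" "p i \<noteq> i" by (auto simp: permutes_def)
      then have "A $ i $ p i = 0" by (simp add: assms)
      then have "(\<Prod>i\<in>UNIV. A $ i $ p i) = 0" by (intro prod_zero) auto
      then show "of_int (sign p) * (\<Prod>i\<in>UNIV. A $ i $ p i) = 0" by simp
    qed
  qed (simp add: finite_permutations)
  also have "\<dots> = (\<Sum>p | p permutes S. of_int (sign p) * (\<Prod>i\<in>S. A $ i $ p i))"
  proof (rule sum.cong[OF refl])
    fix p assume "p \<in> {p. p permutes S}"
    then have "A $ i $ p i = 1" if "i \<notin> S" for i
      using that by (simp add: assms permutes_not_in)
    then have "(\<Prod>i\<in>UNIV. A $ i $ p i) = (\<Prod>i\<in>S. A $ i $ p i)"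
      by (intro prod.mono_neutral_right) auto
    then show "of_int (sign p) * (\<Prod>i\<in>UNIV. A $ i $ p i) = of_int (sign p) * (\<Prod>i\<in>S. A $ i $ p i)"
      by simp
  qed
  finally show ?thesis .
qed

lemma det_three_rows:
  fixes A :: "'a::comm_ring_1 ^ 'n::finite ^ 'n"
  assumes "distinct [a, b, c]"
    and "\<And>i j. i \<notin> {a, b, c} \<Longrightarrow> A $ i $ j = (if i = j then 1 else 0)"
  shows "det A = A$a$a * (A$b$b * A$c$c - A$b$c * A$c$b) - A$a$b * (A$b$a * A$c$c - A$b$c * A$c$a)
     + A$a$c * (A$b$a * A$c$b - A$b$b * A$c$a)"
proof -
  have neq: "a \<noteq> b" "a \<noteq> c" "b \<noteq> c" "b \<noteq> a" "c \<noteq> a" "c \<noteq> b" using assms(1) by auto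
  have f: "finite {b, c}" "a \<notin> {b, c}" "finite {c}" "b \<notin> {c}" using neq by auto
  have det: "det A = (\<Sum>p | p permutes {a, b, c}. of_int (sign p) * (\<Prod>i\<in>{a, b, c}. A $ i $ p i))"
    by (rule det_unit_rows) (rule assms(2))
  show ?thesis
    unfolding det
      sum_over_permutations_insert[OF f(1,2)] sum_over_permutations_insert[OF f(3,4)] permutes_sing
    using neq
    by (simp add: sign_swap_id permutation_swap_id sign_compose sign_id swap_id_eq
        transpose_def algebra_simps)
qed

text \<open>The zeros assumed are those of \<open>cubic_map'\<close>: its component \<open>t\<close>
  involves only the variables \<open>t\<close> and \<open>b\<close>, and among the components
  \<open>a\<close>, \<open>b\<close>, \<open>c\<close> only the last one involves
  \<open>t\<close>.\<close>

lemma det_four_rows: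
  fixes A :: "'a::comm_ring_1 ^ 'n::finite ^ 'n"
  assumes "distinct [t, a, b, c]"
    and "\<And>i j. i \<notin> {t, a, b, c} \<Longrightarrow> A $ i $ j = (if i = j then 1 else 0)"
    and row: "A$t$a = 0" "A$t$c = 0" "A$t$t = 1" and col: "A$a$t = 0" "A$b$t = 0"
  shows "det A = A$a$a * (A$b$b * A$c$c - A$b$c * A$c$b) - A$a$b * (A$b$a * A$c$c - A$b$c * A$c$a)
     + A$a$c * (A$b$a * A$c$b - A$b$b * A$c$a) + A$t$b * A$c$t * (A$a$a * A$b$c - A$a$c * A$b$a)"
proof -
  have neq: "a \<noteq> b" "a \<noteq> c" "b \<noteq> c" "b \<noteq> a" "c \<noteq> a" "c \<noteq> b" "t \<noteq> a" "t \<noteq> b" "t \<noteq> c"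
    "a \<noteq> t" "b \<noteq> t" "c \<noteq> t" using assms(1) by auto
  have f: "finite {a, b, c}" "t \<notin> {a, b, c}" "finite {b, c}" "a \<notin> {b, c}" "finite {c}" "b \<notin> {c}"
    using neq by auto
  have det: "det A = (\<Sum>p | p permutes {t, a, b, c}. of_int (sign p) * (\<Prod>i\<in>{t, a, b, c}. A $ i $ p i))"
    by (rule det_unit_rows) (rule assms(2))
  show ?thesis
    unfolding det
      sum_over_permutations_insert[OF f(1,2)] sum_over_permutations_insert[OF f(3,4)]
      sum_over_permutations_insert[OF f(5,6)] permutes_sing
    using neq row col
    by (simp add: sign_swap_id permutation_swap_id permutation_compose sign_compose sign_id swap_id_eq
        transpose_def algebra_simps)
qed

section \<open>Two explicit Keller mappings and their collisions\<close>

lemma deg_le_add_max: "deg_le d p \<Longrightarrow> deg_le e q \<Longrightarrow> deg_le (max d e) (p + q)"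
  by (intro deg_le_add) (auto elim: deg_le_mono)

lemma deg_le_diff_max:
  "deg_le d p \<Longrightarrow> deg_le e q \<Longrightarrow> deg_le (max d e) (p - q :: ('v, 'a::comm_ring_1) mpoly)"
  by (intro deg_le_diff) (auto elim: deg_le_mono)

lemma deg_le_Var_1: "deg_le 1 (Var v)"
  using deg_le_Var[of 0] by simp

lemma deg_le_numeral_0: "deg_le 0 (numeral k :: ('v, 'a::comm_semiring_1) mpoly)"
  by simp

lemma deg_le_one_0: "deg_le 0 (1 :: ('v, 'a::comm_semiring_1) mpoly)"
  by simp

lemmas deg_le_rules = deg_le_add_max deg_le_diff_max deg_le_mult deg_le_power deg_le_Var_1
  deg_le_numeral_0 deg_le_one_0

text \<open>
  A binary cubic \<open>A s\<^sup>3 + s\<^sup>2 t + C s t\<^sup>2 + D t\<^sup>3\<close> with a marked simple linear factor \<open>l\<close>,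
  and cofactor normalised by \<open>Res (l, q) = 1\<close>, is described by three affine coordinates: \<open>l = (x, 1 + 2 x u)\<close>
  and \<open>w\<close>. Forgetting the factor is etale of degree three in these coordinates.
\<close>

definition cubic_map :: "'n \<Rightarrow> 'n \<Rightarrow> 'n \<Rightarrow> 'n::finite poly_map" where
  "cubic_map a b c = (let x = Var a; u = Var b; w = Var c; l = 1 + 2 * x * u in
     \<chi> i. if i = a then x - 3 * x ^ 2 * u - x ^ 3 * w
          else if i = b then u + 3 * x * l ^ 2 * w + 12 * x * u ^ 2 * (2 + 3 * x * u)
          else if i = c then l ^ 3 * w + 4 * u ^ 2 * l * (2 + 3 * x * u)
          else Var i)"

text \<open>
  With one more variable, \<open>T = t + u\<^sup>3\<close> is a coordinate, and adding \<open>8 A T\<close> to the third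
  component of \<^const>\<open>cubic_map\<close> cancels its terms of degree six and seven.
\<close>

definition cubic_map' :: "'n \<Rightarrow> 'n \<Rightarrow> 'n \<Rightarrow> 'n \<Rightarrow> 'n::finite poly_map" where
  "cubic_map' t a b c = (let x = Var a; u = Var b; w = Var c; l = 1 + 2 * x * u;
       A = x - 3 * x ^ 2 * u - x ^ 3 * w in
     \<chi> i. if i = a then A
          else if i = b then u + 3 * x * l ^ 2 * w + 12 * x * u ^ 2 * (2 + 3 * x * u)
          else if i = c then w + 6 * x * u * w + 12 * x ^ 2 * u ^ 2 * w + 8 * u ^ 2
                 + 36 * x * u ^ 3 + 8 * Var t * A
          else if i = t then Var t + u ^ 3
          else Var i)"

lemma mp_pderiv_power2: "mp_pderiv v (p ^ 2) = 2 * p * (mp_pderiv v p :: ('v, 'a::comm_semiring_1) mpoly)"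
  by (simp only: power2_eq_square mp_pderiv_mult mult_2 distrib_right mult.commute[of "mp_pderiv v p" p])

lemma mp_pderiv_power3: "mp_pderiv v (p ^ 3) = 3 * p ^ 2 * (mp_pderiv v p :: ('v, 'a::comm_semiring_1) mpoly)"
  using mp_pderiv_power[of v p 2] by (simp add: numeral_3_eq_3 numeral_2_eq_2)

lemma cubic_map_in_X_var:
  assumes abc: "distinct [a, b, c]" and "d \<ge> 7"
  shows "cubic_map a b c \<in> X_var d"
proof -
  have neq: "a \<noteq> b" "a \<noteq> c" "b \<noteq> c" "b \<noteq> a" "c \<noteq> a" "c \<noteq> b" using abc by auto
  have "deg_le d (cubic_map a b c $ i)" for i
  proof -
    have "deg_le 7 (cubic_map a b c $ i)"
      by (cases "i = a"; cases "i = b"; cases "i = c"; simp add: cubic_map_def Let_def;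
          rule deg_le_mono, (rule deg_le_rules)+, simp)
    then show ?thesis using assms(2) by (rule deg_le_mono)
  qed
  moreover have "jacobian (cubic_map a b c) = 1"
    unfolding mp_eq_iff_eval_eq mp_eval_jacobian
  proof
    fix y :: "'a \<Rightarrow> complex"
    show "det (\<chi> i j. mp_eval y (mp_pderiv j (cubic_map a b c $ i))) = mp_eval y 1"
      apply (subst det_three_rows[OF abc])
       apply (simp add: cubic_map_def Let_def mp_pderiv_Var)
      apply (simp add: neq cubic_map_def Let_def mp_pderiv_simps mp_pderiv_power2 mp_pderiv_power3 mp_eval_simps)
      apply algebra
      done
  qed
  ultimately show ?thesis by (simp add: X_var_def Omega_deg_le)
qed

lemma cubic_map'_in_X_var:
  assumes abc: "distinct [t, a, b, c]" and "d \<ge> 6"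
  shows "cubic_map' t a b c \<in> X_var d"
proof -
  have neq: "a \<noteq> b" "a \<noteq> c" "b \<noteq> c" "b \<noteq> a" "c \<noteq> a" "c \<noteq> b" "t \<noteq> a" "t \<noteq> b" "t \<noteq> c"
    "a \<noteq> t" "b \<noteq> t" "c \<noteq> t" using abc by auto
  have "deg_le d (cubic_map' t a b c $ i)" for i
  proof -
    have "deg_le 6 (cubic_map' t a b c $ i)"
      by (cases "i = a"; cases "i = b"; cases "i = c"; cases "i = t"; simp add: cubic_map'_def Let_def;
          rule deg_le_mono, (rule deg_le_rules)+, simp)
    then show ?thesis using assms(2) by (rule deg_le_mono)
  qed
  moreover have "jacobian (cubic_map' t a b c) = 1"
    unfolding mp_eq_iff_eval_eq mp_eval_jacobian
  proof
    fix y :: "'a \<Rightarrow> complex"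
    show "det (\<chi> i j. mp_eval y (mp_pderiv j (cubic_map' t a b c $ i))) = mp_eval y 1"
      apply (subst det_four_rows[OF abc])
            apply (simp_all add: neq cubic_map'_def Let_def mp_pderiv_Var mp_pderiv_simps mp_pderiv_power2
                mp_pderiv_power3 mp_eval_simps)
      apply algebra
      done
  qed
  ultimately show ?thesis by (simp add: X_var_def Omega_deg_le)
qed

text \<open>The components \<open>a\<close>, \<open>b\<close>, \<open>c\<close> are the coefficients
  \<open>A\<close>, \<open>C\<close> and \<open>D / 2\<close> of the cubic. Both points give the
  cubic \<open>(6 s - t) (15 s + 2 t) (3 s + t) / 81\<close>, marked at its first and at its second
  factor.\<close>

lemma cubic_map_collision:
  assumes "distinct [a, b, c]"
  shows "pm_eval (cubic_map a b c) (\<chi> i. if i = a then 2 else if i = b then - 1 / 3 else if i = c then 1 / 3 else 0)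
       = pm_eval (cubic_map a b c) (\<chi> i. if i = a then - 5 else if i = b then 1 / 6 else if i = c then 1 / 6 else 0)"
  using assms
  by (auto simp: vec_eq_iff pm_eval_def cubic_map_def Let_def mp_eval_simps power2_eq_square power3_eq_cube)

text \<open>The points are those of \<open>cubic_map_collision\<close>; the value -1/24 makes
  \<open>t + u ^ 3\<close> equal to -1/27 at both, so the correction of the third component agrees
  as well.\<close>

lemma cubic_map'_collision:
  assumes "distinct [t, a, b, c]"
  shows "pm_eval (cubic_map' t a b c) (\<chi> i. if i = a then 2 else if i = b then - 1 / 3
           else if i = c then 1 / 3 else 0)
       = pm_eval (cubic_map' t a b c) (\<chi> i. if i = a then - 5 else if i = b then 1 / 6
           else if i = c then 1 / 6 else if i = t then - 1 / 24 else 0)"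
  using assms
  by (auto simp: vec_eq_iff pm_eval_def cubic_map'_def Let_def mp_eval_simps power2_eq_square power3_eq_cube)

lemma generic_counterexample_if_large:
  fixes d :: nat
  assumes irr: "irreducible_space (X_zariski d :: 'n::finite poly_map topology)"
    and large: "CARD('n) \<ge> 3 \<and> d \<ge> 7 \<or> CARD('n) \<ge> 4 \<and> d \<ge> 6"
  shows "\<exists>U :: 'n poly_map set. openin (X_zariski d) U \<and> U \<noteq> {} \<and>
           X_zariski d closure_of U = topspace (X_zariski d) \<and>
           (\<forall>F\<in>U. jc_counterexample d F)"
  using large
proof (elim disjE conjE)
  assume "CARD('n) \<ge> 3" "d \<ge> 7"
  then obtain S :: "'n set" where "card S = 3" using obtain_subset_with_card_n by metis
  then obtain a b c :: 'n where abc: "distinct [a, b, c]" by (auto simp: card_3_iff)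
  show ?thesis
    by (rule generic_counterexample[OF irr cubic_map_in_X_var[OF abc \<open>d \<ge> 7\<close>] cubic_map_collision[OF abc]])
      (auto simp: vec_eq_iff)
next
  assume "CARD('n) \<ge> 4" "d \<ge> 6"
  then obtain S :: "'n set" where "card S = 4" using obtain_subset_with_card_n by metis
  then obtain t a b c :: 'n where abc: "distinct [t, a, b, c]"
    by (auto simp: card_Suc_eq numeral_eq_Suc)
  show ?thesis
    by (rule generic_counterexample[OF irr cubic_map'_in_X_var[OF abc \<open>d \<ge> 6\<close>] cubic_map'_collision[OF abc]])
      (auto simp: vec_eq_iff)
qed

subsection \<open>Derivations and transcendence\<close>

text \<open>\<open>n\<close> only bounds the degree in \<open>y\<close>: the top coefficient may be
  zero, or zero modulo an ideal, which the division argument below has to respect.\<close>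

lemma mp_split_variable:
  fixes p :: "('v, 'a::comm_semiring_1) mpoly"
  assumes "mp_vars p \<subseteq> insert y V" "y \<notin> V"
  shows "\<exists>n c. p = (\<Sum>k\<le>n. c k * Var y ^ k) \<and> (\<forall>k. mp_vars (c k) \<subseteq> V)"
proof -
  define m0 where "m0 m = m - Poly_Mapping.single y (Poly_Mapping.lookup m y)" for m :: "'v monom"
  define c where "c k = (\<Sum>m\<in>{m \<in> Poly_Mapping.keys p. Poly_Mapping.lookup m y = k}.
      Poly_Mapping.single (m0 m) (Poly_Mapping.lookup p m))" for k
  define n where "n = (\<Sum>m\<in>Poly_Mapping.keys p. Poly_Mapping.lookup m y)"
  have split_m: "m0 m + Poly_Mapping.single y (Poly_Mapping.lookup m y) = m" for m
    by (rule poly_mapping_eqI) (auto simp: m0_def lookup_add lookup_minus lookup_single when_def)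
  have mon: "Poly_Mapping.single m (Poly_Mapping.lookup p m) =
      Poly_Mapping.single (m0 m) (Poly_Mapping.lookup p m) * Var y ^ Poly_Mapping.lookup m y" for m
    by (simp add: Var_power mult_single split_m)
  have le_n: "Poly_Mapping.lookup m y \<le> n" if "m \<in> Poly_Mapping.keys p" for m
    unfolding n_def by (rule member_le_sum) (use that in auto)
  have "p = (\<Sum>m\<in>Poly_Mapping.keys p. Poly_Mapping.single m (Poly_Mapping.lookup p m))"
    by (rule mp_monom_expansion)
  also have "\<dots> = (\<Sum>k\<le>n. \<Sum>m\<in>{m \<in> Poly_Mapping.keys p. Poly_Mapping.lookup m y = k}.
      Poly_Mapping.single m (Poly_Mapping.lookup p m))"
    by (rule sum.group[symmetric]) (use le_n in auto)
  also have "\<dots> = (\<Sum>k\<le>n. c k * Var y ^ k)"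
    unfolding c_def sum_distrib_right by (intro sum.cong refl) (use mon in auto)
  finally have "p = (\<Sum>k\<le>n. c k * Var y ^ k)" .
  moreover have "mp_vars (c k) \<subseteq> V" for k
  proof -
    have "mp_vars (Poly_Mapping.single (m0 m) (Poly_Mapping.lookup p m)) \<subseteq> V"
      if "m \<in> Poly_Mapping.keys p" for m
    proof -
      have "Poly_Mapping.keys (m0 m) \<subseteq> Poly_Mapping.keys m - {y}"
        by (auto simp: m0_def in_keys_iff lookup_minus lookup_single when_def split: if_splits)
      moreover have "Poly_Mapping.keys m \<subseteq> insert y V"
        using that assms(1) by (auto simp: mp_vars_def)
      ultimately show ?thesis using mp_vars_single_subset[of "m0 m"] by blast
    qed
    then show ?thesis unfolding c_def using mp_vars_sum by fastforce
  qed
  ultimately show ?thesis by blast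
qed

text \<open>A vector field with component \<open>d i\<close> in direction \<open>i\<close>; modulo
  an ideal that it preserves, it is a derivation of the quotient ring. A finite \<open>W\<close> is
  singled out because the type of coordinates is infinite in the application.\<close>

definition deriv_along :: "'v set \<Rightarrow> ('v \<Rightarrow> ('v, 'a) mpoly) \<Rightarrow> ('v, 'a::comm_ring_1) mpoly \<Rightarrow> ('v, 'a) mpoly" where
  "deriv_along W d p = (\<Sum>i\<in>W. d i * mp_pderiv i p)"

lemma deriv_along_add: "deriv_along W d (p + q) = deriv_along W d p + deriv_along W d q"
  by (simp add: deriv_along_def mp_pderiv_add distrib_left sum.distrib)

lemma deriv_along_diff: "deriv_along W d (p - q) = deriv_along W d p - deriv_along W d q"
  by (simp add: deriv_along_def mp_pderiv_diff right_diff_distrib sum_subtractf)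

lemma deriv_along_mult: "deriv_along W d (p * q) = deriv_along W d p * q + p * deriv_along W d q"
  by (simp add: deriv_along_def mp_pderiv_mult sum.distrib sum_distrib_left sum_distrib_right algebra_simps)

lemma deriv_along_Var:
  "finite W \<Longrightarrow> y \<in> W \<Longrightarrow> deriv_along W d (Var y) = d y"
  by (simp add: deriv_along_def mp_pderiv_Var if_distrib cong: if_cong)

lemma deriv_along_scale: "deriv_along W (\<lambda>i. f * d i) p = f * deriv_along W d p"
  by (simp add: deriv_along_def sum_distrib_left mult.assoc)

lemma deriv_along_diff_field:
  "deriv_along W (\<lambda>i. f * d i - g * e i) p = f * deriv_along W d p - g * deriv_along W e p"
  by (simp add: deriv_along_def sum_distrib_left sum_subtractf algebra_simps)

lemma deriv_along_zero [simp]: "deriv_along W d 0 = 0"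
  by (simp add: deriv_along_def)

lemma deriv_along_cong_vars:
  assumes "finite W" "\<And>i. i \<in> mp_vars p \<Longrightarrow> d i = e i"
  shows "deriv_along W d p = deriv_along W e p"
  unfolding deriv_along_def
  by (rule sum.cong[OF refl]) (metis assms(2) mp_pderiv_not_var mult_zero_right)

lemma add_diff_diff_add_cancel: "p + q - r - p + r = (q :: 'a::ab_group_add)"
  by simp

section \<open>Extending derivations modulo a prime ideal\<close>

locale mp_prime_ideal =
  fixes I :: "('v, complex) mpoly set"
  assumes zero: "0 \<in> I" and one: "1 \<notin> I"
    and add: "p \<in> I \<Longrightarrow> q \<in> I \<Longrightarrow> p + q \<in> I"
    and mult: "p \<in> I \<Longrightarrow> q * p \<in> I"
    and prime: "p * q \<in> I \<Longrightarrow> p \<in> I \<or> q \<in> I"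
begin

lemma mult': "p \<in> I \<Longrightarrow> p * q \<in> I"
  using mult[of p q] by (simp add: mult.commute)

lemma uminus: "p \<in> I \<Longrightarrow> - p \<in> I"
  using mult[of p "- 1"] by simp

lemma diff: "p \<in> I \<Longrightarrow> q \<in> I \<Longrightarrow> p - q \<in> I"
  using add[of p "- q"] uminus[of q] by simp

lemma sum: "(\<And>i. i \<in> A \<Longrightarrow> f i \<in> I) \<Longrightarrow> (\<Sum>i\<in>A. f i) \<in> I"
  by (induction A rule: infinite_finite_induct) (auto simp: zero add)

text \<open>Characteristic zero enters here; it keeps the derivative of a minimal relation outside
  the ideal.\<close>

lemma of_nat_Suc_not_mem: "of_nat (Suc k) \<notin> I"
proof
  assume "of_nat (Suc k) \<in> I"
  then have "Const (1 / of_nat (Suc k)) * of_nat (Suc k) \<in> I" by (rule mult)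
  moreover have "Const (1 / of_nat (Suc k)) * of_nat (Suc k) = (1 :: ('v, complex) mpoly)"
    by (simp add: mp_eq_iff_eval_eq mp_eval_mult mp_eval_of_nat del: of_nat_Suc)
  ultimately show False using one by metis
qed

text \<open>
  If \<open>y\<close> satisfies an algebraic relation \<open>h\<close> of minimal degree over the variables in \<open>V\<close>, a
  derivation extends to \<open>y\<close> after multiplication with \<open>\<partial>h/\<partial>y\<close>; every other relation is a
  pseudo-multiple of \<open>h\<close>.
\<close>

lemma derivation_extend:
  assumes W: "finite W" "insert y V \<subseteq> W" "y \<notin> V"
  shows "\<exists>g. g \<notin> I \<and> (\<forall>d. (\<forall>i. i \<notin> V \<longrightarrow> d i = 0) \<longrightarrow>
      (\<forall>p\<in>I. mp_vars p \<subseteq> V \<longrightarrow> deriv_along W d p \<in> I) \<longrightarrow>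
      (\<exists>e. \<forall>p\<in>I. mp_vars p \<subseteq> insert y V \<longrightarrow> deriv_along W ((\<lambda>i. g * d i)(y := e)) p \<in> I))"
proof -
  let ?P = "\<lambda>n c. (\<Sum>k\<le>n. c k * Var y ^ k :: ('v, complex) mpoly)"
  let ?rel = "\<lambda>n c. ?P n c \<in> I \<and> (\<forall>k. mp_vars (c k) \<subseteq> V)"
  have P_deriv: "deriv_along W D (?P n c) = (\<Sum>k\<le>n. deriv_along W D (c k) * Var y ^ k)
      + mp_pderiv y (?P n c) * D y"
    if c: "\<forall>k. mp_vars (c k) \<subseteq> V" for D n c
  proof -
    have y0: "mp_pderiv y (c k) = 0" for k using c W(3) by (intro mp_pderiv_not_var) auto
    have pow: "deriv_along W D (Var y ^ k) = mp_pderiv y (Var y ^ k) * D y" for k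
    proof (induction k)
      case 0
      show ?case by (simp add: deriv_along_def)
    next
      case (Suc k)
      then show ?case using W
        by (simp add: deriv_along_mult deriv_along_Var mp_pderiv_mult algebra_simps)
    qed
    show ?thesis
      using W by (induction n) (simp_all add: deriv_along_add deriv_along_mult deriv_along_Var
          mp_pderiv_add mp_pderiv_mult y0 pow algebra_simps)
  qed
  show ?thesis
  proof (cases "\<exists>n c. ?rel n c \<and> c n \<notin> I")
    \<comment> \<open>\<open>y\<close> is transcendental over \<open>V\<close> modulo the ideal: the
      coefficients of every relation lie in \<open>I\<close>, so the value at \<open>y\<close> is
      free, and 0 is taken.\<close>
    case False
    have coeffs: "c k \<in> I" if "?rel n c" "k \<le> n" for n c k
      using that
    proof (induction n arbitrary: k)
      case 0
      with False show ?case by blast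
    next
      case (Suc n)
      have lead: "c (Suc n) \<in> I" using False Suc.prems(1) by blast
      then have "?P (Suc n) c - c (Suc n) * Var y ^ Suc n \<in> I"
        using Suc.prems(1) by (intro diff mult') auto
      then have "?rel n c" using Suc.prems(1) by simp
      with Suc.IH Suc.prems(2) lead show ?case by (cases "k = Suc n") auto
    qed
    show ?thesis
    proof (rule exI[of _ 1], intro conjI allI impI one, rule exI[of _ 0], intro ballI impI)
      fix d p
      assume d: "\<forall>i. i \<notin> V \<longrightarrow> d i = 0" "\<forall>p\<in>I. mp_vars p \<subseteq> V \<longrightarrow> deriv_along W d p \<in> I"
        and p: "p \<in> I" "mp_vars p \<subseteq> insert y V"
      obtain n c where c: "p = ?P n c" "\<forall>k. mp_vars (c k) \<subseteq> V"
        using mp_split_variable[OF p(2) W(3)] by blast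
      have D: "(\<lambda>i. 1 * d i)(y := 0) = d" using d(1) W(3) by auto
      have "d y = 0" using d(1) W(3) by blast
      then have "deriv_along W d p = (\<Sum>k\<le>n. deriv_along W d (c k) * Var y ^ k)"
        unfolding c(1) P_deriv[OF c(2)] by simp
      also have "\<dots> \<in> I"
        using d(2) c coeffs[OF conjI[OF p(1)[unfolded c(1)] c(2)]] by (intro sum mult') auto
      finally show "deriv_along W ((\<lambda>i. 1 * d i)(y := 0)) p \<in> I" unfolding D .
    qed
  next
    case True
    \<comment> \<open>The minimum is over relations whose leading coefficient is not in
      \<open>I\<close>.\<close>
    define e where "e = (LEAST n. \<exists>c. ?rel n c \<and> c n \<notin> I)"
    obtain h where h: "?rel e h" "h e \<notin> I"
      using LeastI_ex[OF True] unfolding e_def by blast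
    have minimal: "c n \<in> I" if "?rel n c" "n < e" for n c
      using not_less_Least[of n "\<lambda>n. \<exists>c. ?rel n c \<and> c n \<notin> I"] that unfolding e_def by blast
    have e0: "e \<noteq> 0"
    proof
      assume "e = 0"
      with h show False by simp
    qed
    then obtain e' where e': "e = Suc e'" using not0_implies_Suc by blast
    let ?h = "?P e h"
    define g where "g = mp_pderiv y ?h"
    have g_P: "g = ?P e' (\<lambda>k. of_nat (Suc k) * h (Suc k))"
    proof -
      have y0: "mp_pderiv y (h k) = 0" for k using h W(3) by (intro mp_pderiv_not_var) auto
      have "mp_pderiv y (?P (Suc n) h) = ?P n (\<lambda>k. of_nat (Suc k) * h (Suc k))" for n
      proof (induction n)
        case 0
        show ?case by (simp add: mp_pderiv_add mp_pderiv_mult y0)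
      next
        case (Suc n)
        have "mp_pderiv y (?P (Suc (Suc n)) h) = mp_pderiv y (?P (Suc n) h)
            + h (Suc (Suc n)) * mp_pderiv y (Var y ^ Suc (Suc n))"
          by (subst sum.atMost_Suc) (simp only: mp_pderiv_add mp_pderiv_mult y0 mult_zero_left add_0_left)
        then show ?case
          unfolding Suc mp_pderiv_power by (simp add: mult_ac)
      qed
      then show ?thesis unfolding g_def e' .
    qed
    \<comment> \<open>\<open>g\<close> has formal degree \<open>e - 1\<close> in \<open>y\<close>
      and leading coefficient \<open>e * h e\<close>; if it were in \<open>I\<close>, minimality and
      primeness would put \<open>h e\<close> into \<open>I\<close>.\<close>
    have "g \<notin> I"
    proof
      assume "g \<in> I"
      moreover have "mp_vars (of_nat (Suc k) * h (Suc k)) \<subseteq> V" for k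
      proof -
        have "(of_nat j :: ('v, complex) mpoly) = Const (of_nat j)" for j
          by (simp only: single_of_nat)
        then have "mp_vars (of_nat (Suc k) :: ('v, complex) mpoly) \<subseteq> {}"
          using mp_vars_single_subset[of 0 "of_nat (Suc k) :: complex"] by (simp only: keys_zero)
        with mp_vars_mult[of "of_nat (Suc k)" "h (Suc k)"] h show ?thesis by blast
      qed
      ultimately have "?rel e' (\<lambda>k. of_nat (Suc k) * h (Suc k))" unfolding g_P by blast
      from minimal[OF this] have "of_nat (Suc e') * h (Suc e') \<in> I" by (simp only: e' lessI)
      from prime[OF this] show False using of_nat_Suc_not_mem h(2) unfolding e' by simp
    qed
    show ?thesis
    proof (rule exI[of _ g], intro conjI allI impI)
      show "g \<notin> I" by fact
      fix d
      assume d: "\<forall>i. i \<notin> V \<longrightarrow> d i = 0" "\<forall>p\<in>I. mp_vars p \<subseteq> V \<longrightarrow> deriv_along W d p \<in> I"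
      \<comment> \<open>The value at \<open>y\<close> is the one forced by annihilating
        \<open>h\<close>; the scaling by \<open>g\<close> on \<open>V\<close> avoids a
        division.\<close>
      define D where "D = (\<lambda>i. g * d i)(y := - (\<Sum>k\<le>e. deriv_along W d (h k) * Var y ^ k))"
      have D_V: "deriv_along W D p = g * deriv_along W d p" if "mp_vars p \<subseteq> V" for p
      proof -
        have "deriv_along W D p = deriv_along W (\<lambda>i. g * d i) p"
          unfolding D_def by (rule deriv_along_cong_vars[OF W(1)]) (use that W(3) in auto)
        then show ?thesis by (simp add: deriv_along_scale)
      qed
      have D_h: "deriv_along W D ?h = 0"
      proof -
        have "D y = - (\<Sum>k\<le>e. deriv_along W d (h k) * Var y ^ k)" by (simp add: D_def)
        moreover have "deriv_along W D (h k) = g * deriv_along W d (h k)" for k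
          using h(1) by (intro D_V) blast
        ultimately show ?thesis
          unfolding P_deriv[OF conjunct2[OF h(1)]] g_def[symmetric]
          by (simp add: sum_distrib_left mult.assoc)
      qed
      have D_I: "deriv_along W D (?P n c) \<in> I" if "?rel n c" for n c
        using that
      proof (induction n arbitrary: c rule: less_induct)
        case (less n)
        show ?case
        proof (cases "c n \<in> I")
          \<comment> \<open>The leading coefficient is in \<open>I\<close>, so dropping the leading
            term leaves a relation of lower degree.\<close>
          case True
          then have Dc: "deriv_along W D (c n) \<in> I" using less.prems d(2) by (auto simp: D_V intro: mult)
          show ?thesis
          proof (cases n)
            case 0
            with Dc show ?thesis by simp
          next
            case (Suc n')
            have "?P n c - c n * Var y ^ n \<in> I" using less.prems True by (intro diff mult') auto
            then have "?rel n' c" using less.prems by (simp add: Suc)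
            from less.IH[OF _ this] Suc have "deriv_along W D (?P n' c) \<in> I" by simp
            moreover have "deriv_along W D (c n * Var y ^ n) \<in> I"
              unfolding deriv_along_mult using Dc True by (intro add mult')
            ultimately show ?thesis unfolding Suc by (simp add: deriv_along_add add)
          qed
        next
          case False
          then have n: "e \<le> n" using minimal[OF less.prems] by (meson not_le)
          \<comment> \<open>Pseudo-division: multiplying by \<open>h e\<close> and subtracting a
            multiple of \<open>h\<close> removes the leading term. Primeness disposes of the factor
            \<open>h e\<close> afterwards.\<close>
          define c' where "c' k = h e * c k - (if k \<ge> n - e then c n * h (k - (n - e)) else 0)" for k
          have shift: "(\<Sum>k\<le>n. (if k \<ge> n - e then c n * h (k - (n - e)) else 0) * Var y ^ k)
              = c n * Var y ^ (n - e) * ?h"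
          proof -
            have "(\<Sum>k\<le>n. (if k \<ge> n - e then c n * h (k - (n - e)) else 0) * Var y ^ k)
                = (\<Sum>k\<in>{n - e..n}. c n * h (k - (n - e)) * Var y ^ k)"
              by (rule sum.mono_neutral_cong_right) auto
            also have "\<dots> = (\<Sum>k\<le>e. c n * h k * Var y ^ (k + (n - e)))"
              by (rule sum.reindex_bij_witness[of _ "\<lambda>k. k + (n - e)" "\<lambda>k. k - (n - e)"]) (use n in auto)
            also have "\<dots> = c n * Var y ^ (n - e) * ?h"
              by (simp add: sum_distrib_left power_add mult_ac)
            finally show ?thesis .
          qed
          have "?P n c' = h e * ?P n c - (\<Sum>k\<le>n. (if k \<ge> n - e then c n * h (k - (n - e)) else 0) * Var y ^ k)"
            by (simp only: c'_def left_diff_distrib sum_subtractf sum_distrib_left mult.assoc)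
          then have c'_P: "?P n c' = h e * ?P n c - c n * Var y ^ (n - e) * ?h" unfolding shift .
          have "c' n = 0" using n by (simp add: c'_def mult.commute)
          then obtain n' where n': "n = Suc n'" "?P n c' = ?P n' c'"
            using n e' by (cases n) auto
          have vars: "mp_vars (c' k) \<subseteq> V" for k
          proof -
            have neg: "mp_vars (- q) = mp_vars q" for q :: "('v, complex) mpoly" by (simp add: mp_vars_def)
            have prod: "mp_vars (p * q) \<subseteq> V" if "mp_vars p \<subseteq> V" "mp_vars q \<subseteq> V" for p q :: "('v, complex) mpoly"
              using mp_vars_mult[of p q] that by blast
            have minus: "mp_vars (p - q) \<subseteq> V" if "mp_vars p \<subseteq> V" "mp_vars q \<subseteq> V" for p q :: "('v, complex) mpoly"
              using mp_vars_add[of p "- q"] that by (simp add: neg) blast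
            have "mp_vars (c j) \<subseteq> V" "mp_vars (h j) \<subseteq> V" for j using less.prems h(1) by simp_all
            note in_V = this
            have "mp_vars (if k \<ge> n - e then c n * h (k - (n - e)) else 0) \<subseteq> V"
              using prod[OF in_V(1)[of n] in_V(2)[of "k - (n - e)"]] by (simp add: mp_vars_def[of 0])
            then show ?thesis unfolding c'_def by (intro minus prod in_V)
          qed
          have "?P n c \<in> I" "?h \<in> I" using less.prems h(1) by simp_all
          then have "?P n' c' \<in> I"
            unfolding n'(2)[symmetric] c'_P by (intro diff mult)
          then have "?rel n' c'" using vars by simp
          moreover have "n' < n" using n'(1) by simp
          ultimately have "deriv_along W D (?P n c') \<in> I"
            unfolding n'(2) by (intro less.IH)
          then have in_I: "deriv_along W D (h e) * ?P n c + h e * deriv_along W D (?P n c)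
              - deriv_along W D (c n * Var y ^ (n - e)) * ?h \<in> I"
            by (simp only: c'_P deriv_along_diff deriv_along_mult[of W D "h e"]
              deriv_along_mult[of W D "c n * Var y ^ (n - e)"] D_h mult_zero_right add_0_right)
          have "deriv_along W D (h e) * ?P n c \<in> I" "deriv_along W D (c n * Var y ^ (n - e)) * ?h \<in> I"
            by (rule mult[OF \<open>?P n c \<in> I\<close>], rule mult[OF \<open>?h \<in> I\<close>])
          from add[OF diff[OF in_I this(1)] this(2)] have "h e * deriv_along W D (?P n c) \<in> I"
            unfolding add_diff_diff_add_cancel .
          from prime[OF this] show ?thesis
          proof
            assume "h e \<in> I"
            with h(2) show ?thesis by contradiction
          qed
        qed
      qed
      show "\<exists>e. \<forall>p\<in>I. mp_vars p \<subseteq> insert y V \<longrightarrow> deriv_along W ((\<lambda>i. g * d i)(y := e)) p \<in> I"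
      proof (rule exI[of _ "- (\<Sum>k\<le>e. deriv_along W d (h k) * Var y ^ k)"], unfold D_def[symmetric], intro ballI impI)
        fix p assume p: "p \<in> I" "mp_vars p \<subseteq> insert y V"
        obtain n c where c: "p = ?P n c" "\<forall>k. mp_vars (c k) \<subseteq> V"
          using mp_split_variable[OF p(2) W(3)] by blast
        with p(1) have "?rel n c" by simp
        then have "deriv_along W D (?P n c) \<in> I" by (rule D_I)
        then show "deriv_along W D p \<in> I" by (simp only: c(1))
      qed
    qed
  qed
qed

text \<open>Since \<open>I\<close> contains only 0 among the polynomials in \<open>S\<close>, the
  partial derivatives on \<open>S\<close> preserve it trivially. The remaining coordinates are
  adjoined one at a time by \<open>derivation_extend\<close>, and \<open>g\<close> collects the
  denominators.\<close>

lemma independent_derivations: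
  assumes W: "finite W" "S \<subseteq> W"
    and indep: "\<And>p. p \<in> I \<Longrightarrow> mp_vars p \<subseteq> S \<Longrightarrow> p = 0"
  shows "\<exists>g d. g \<notin> I \<and> (\<forall>s\<in>S. \<forall>t\<in>S. d s t = (if s = t then g else 0)) \<and>
    (\<forall>s\<in>S. \<forall>p\<in>I. mp_vars p \<subseteq> W \<longrightarrow> deriv_along W (d s) p \<in> I)"
proof -
  have "\<exists>g d. g \<notin> I \<and> (\<forall>s\<in>S. (\<forall>t\<in>S. d s t = (if s = t then g else 0)) \<and> (\<forall>i. i \<notin> S \<union> V \<longrightarrow> d s i = 0) \<and>
      (\<forall>p\<in>I. mp_vars p \<subseteq> S \<union> V \<longrightarrow> deriv_along W (d s) p \<in> I))"
    if "finite V" "V \<subseteq> W - S" for V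
    using that
  proof (induction V)
    case empty
    show ?case
      by (intro exI[of _ 1] exI[of _ "\<lambda>s t. if s = t then 1 else 0"]) (auto simp: one zero dest: indep)
  next
    case (insert y V)
    then have "V \<subseteq> W - S" by simp
    from insert.IH[OF this] obtain g d where g: "g \<notin> I" and
      "\<forall>s\<in>S. (\<forall>t\<in>S. d s t = (if s = t then g else 0)) \<and> (\<forall>i. i \<notin> S \<union> V \<longrightarrow> d s i = 0) \<and>
        (\<forall>p\<in>I. mp_vars p \<subseteq> S \<union> V \<longrightarrow> deriv_along W (d s) p \<in> I)"
      by (elim exE conjE)
    then have d: "\<And>s t. s \<in> S \<Longrightarrow> t \<in> S \<Longrightarrow> d s t = (if s = t then g else 0)"
      "\<And>s. s \<in> S \<Longrightarrow> \<forall>i. i \<notin> S \<union> V \<longrightarrow> d s i = 0"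
      "\<And>s. s \<in> S \<Longrightarrow> \<forall>p\<in>I. mp_vars p \<subseteq> S \<union> V \<longrightarrow> deriv_along W (d s) p \<in> I"
      by blast+
    have y: "insert y (S \<union> V) \<subseteq> W" "y \<notin> S \<union> V" using insert.prems insert.hyps W(2) by auto
    obtain f where f: "f \<notin> I" and ext: "\<forall>d. (\<forall>i. i \<notin> S \<union> V \<longrightarrow> d i = 0) \<longrightarrow>
      (\<forall>p\<in>I. mp_vars p \<subseteq> S \<union> V \<longrightarrow> deriv_along W d p \<in> I) \<longrightarrow>
      (\<exists>e. \<forall>p\<in>I. mp_vars p \<subseteq> insert y (S \<union> V) \<longrightarrow> deriv_along W ((\<lambda>i. f * d i)(y := e)) p \<in> I)"
      using derivation_extend[OF W(1) y] by (elim exE conjE)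
    have "\<forall>s\<in>S. \<exists>e. \<forall>p\<in>I. mp_vars p \<subseteq> insert y (S \<union> V) \<longrightarrow>
        deriv_along W ((\<lambda>i. f * d s i)(y := e)) p \<in> I"
      by (intro ballI ext[rule_format, OF d(2)[rule_format] d(3)[rule_format]])
    from bchoice[OF this] obtain e where e: "\<forall>s\<in>S. \<forall>p\<in>I. mp_vars p \<subseteq> insert y (S \<union> V) \<longrightarrow>
        deriv_along W ((\<lambda>i. f * d s i)(y := e s)) p \<in> I" ..
    show ?case
    proof (intro exI[of _ "f * g"] exI[of _ "\<lambda>s. (\<lambda>i. f * d s i)(y := e s)"] conjI ballI impI)
      show "f * g \<notin> I" using f g prime by blast
      fix s assume s: "s \<in> S"
      have "s \<noteq> y" "t \<noteq> y" if "t \<in> S" for t using s that y(2) by auto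
      then show "((\<lambda>i. f * d s i)(y := e s)) t = (if s = t then f * g else 0)" if "t \<in> S" for t
        using that s by (simp add: d(1))
      show "\<forall>i. i \<notin> S \<union> insert y V \<longrightarrow> ((\<lambda>i. f * d s i)(y := e s)) i = 0"
        using d(2)[OF s] by simp
      show "deriv_along W ((\<lambda>i. f * d s i)(y := e s)) p \<in> I"
        if "p \<in> I" "mp_vars p \<subseteq> S \<union> insert y V" for p
        using e s that by simp
    qed
  qed
  from this[of "W - S"] W have "\<exists>g d. g \<notin> I \<and> (\<forall>s\<in>S. (\<forall>t\<in>S. d s t = (if s = t then g else 0)) \<and>
      (\<forall>i. i \<notin> S \<union> (W - S) \<longrightarrow> d s i = 0) \<and>
      (\<forall>p\<in>I. mp_vars p \<subseteq> S \<union> (W - S) \<longrightarrow> deriv_along W (d s) p \<in> I))" by blast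
  moreover have "S \<union> (W - S) = W" using W(2) by blast
  ultimately obtain g d where "g \<notin> I" and "\<forall>s\<in>S. (\<forall>t\<in>S. d s t = (if s = t then g else 0)) \<and>
      (\<forall>i. i \<notin> W \<longrightarrow> d s i = 0) \<and> (\<forall>p\<in>I. mp_vars p \<subseteq> W \<longrightarrow> deriv_along W (d s) p \<in> I)"
    by (elim exE conjE) simp
  then show ?thesis by (intro exI[of _ g] exI[of _ d]) blast
qed

text \<open>Linear algebra over the fraction field in cross-multiplied form: each condition
  \<open>d j \<in> I\<close> costs at most one of the \<open>card S\<close> independent vector
  fields. The survivors stay diagonal on \<open>T\<close>, so that \<open>g\<close> witnesses that
  they are nonzero.\<close>

lemma derivation_vanishing_on:
  assumes W: "finite W" "S \<subseteq> W" and J: "finite J" "card J < card S"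
    and indep: "\<And>p. p \<in> I \<Longrightarrow> mp_vars p \<subseteq> S \<Longrightarrow> p = 0"
  shows "\<exists>d. (\<exists>s\<in>S. d s \<notin> I) \<and> (\<forall>j\<in>J. d j \<in> I) \<and>
    (\<forall>p\<in>I. mp_vars p \<subseteq> W \<longrightarrow> deriv_along W d p \<in> I)"
proof -
  have finS: "finite S" using W finite_subset by blast
  have "\<exists>T g d. T \<subseteq> S \<and> card S \<le> card T + card J \<and> g \<notin> I \<and>
      (\<forall>s\<in>T. (\<forall>t\<in>T. d s t = (if s = t then g else 0)) \<and> (\<forall>j\<in>J. d s j \<in> I) \<and>
        (\<forall>p\<in>I. mp_vars p \<subseteq> W \<longrightarrow> deriv_along W (d s) p \<in> I))"
    using J(1)
  proof (induction J)
    case empty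
    have "\<exists>g d. g \<notin> I \<and> (\<forall>s\<in>S. \<forall>t\<in>S. d s t = (if s = t then g else 0)) \<and>
        (\<forall>s\<in>S. \<forall>p\<in>I. mp_vars p \<subseteq> W \<longrightarrow> deriv_along W (d s) p \<in> I)"
      by (rule independent_derivations[OF W]) (rule indep)
    then obtain g d where
      "g \<notin> I" "\<forall>s\<in>S. \<forall>t\<in>S. d s t = (if s = t then g else 0)"
      "\<forall>s\<in>S. \<forall>p\<in>I. mp_vars p \<subseteq> W \<longrightarrow> deriv_along W (d s) p \<in> I" by (elim exE conjE)
    then show ?case by (intro exI[of _ S] exI[of _ g] exI[of _ d]) auto
  next
    case (insert j J)
    then obtain T g d where T: "T \<subseteq> S" "card S \<le> card T + card J" and g: "g \<notin> I" and
      d: "\<forall>s\<in>T. (\<forall>t\<in>T. d s t = (if s = t then g else 0)) \<and> (\<forall>j\<in>J. d s j \<in> I) \<and>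
        (\<forall>p\<in>I. mp_vars p \<subseteq> W \<longrightarrow> deriv_along W (d s) p \<in> I)" by (elim exE conjE)
    show ?case
    proof (cases "\<forall>s\<in>T. d s j \<in> I")
      case True
      then have "\<forall>s\<in>T. (\<forall>t\<in>T. d s t = (if s = t then g else 0)) \<and> (\<forall>i\<in>insert j J. d s i \<in> I) \<and>
          (\<forall>p\<in>I. mp_vars p \<subseteq> W \<longrightarrow> deriv_along W (d s) p \<in> I)"
        using d by simp
      moreover have "card S \<le> card T + card (insert j J)" using T(2) insert.hyps by simp
      ultimately show ?thesis using T(1) g
        by (intro exI[of _ T] exI[of _ g] exI[of _ d]) simp
    next
      case False
      then have "\<exists>s0\<in>T. d s0 j \<notin> I" by simp
      then obtain s0 where s0: "s0 \<in> T" "d s0 j \<notin> I" by (elim bexE)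
      \<comment> \<open>This combination vanishes exactly at \<open>j\<close>. The pivot
        \<open>s0\<close> leaves \<open>T\<close>, and the diagonal entry becomes
        \<open>d s0 j * g\<close>.\<close>
      define d' where "d' s i = d s0 j * d s i - d s j * d s0 i" for s i
      have "finite T" by (rule finite_subset[OF T(1) finS])
      then have "card T = Suc (card (T - {s0}))" using s0(1) by (rule card.remove)
      then have "card S \<le> card (T - {s0}) + card (insert j J)" using T(2) insert.hyps by simp
      moreover have "d s0 j * g \<notin> I" using s0(2) g prime[of "d s0 j" g] by auto
      moreover have "(\<forall>t\<in>T - {s0}. d' s t = (if s = t then d s0 j * g else 0)) \<and>
          (\<forall>i\<in>insert j J. d' s i \<in> I) \<and> (\<forall>p\<in>I. mp_vars p \<subseteq> W \<longrightarrow> deriv_along W (d' s) p \<in> I)"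
        if s: "s \<in> T - {s0}" for s
      proof (intro conjI ballI impI)
        show "d' s t = (if s = t then d s0 j * g else 0)" if "t \<in> T - {s0}" for t
          using that s d s0(1) by (auto simp: d'_def)
        show "d' s i \<in> I" if "i \<in> insert j J" for i
        proof (cases "i = j")
          case True
          then show ?thesis by (simp add: d'_def mult.commute zero)
        next
          case False
          then have "d s i \<in> I" "d s0 i \<in> I" using that s d s0(1) by auto
          then show ?thesis unfolding d'_def by (intro diff mult)
        qed
        show "deriv_along W (d' s) p \<in> I" if "p \<in> I" "mp_vars p \<subseteq> W" for p
        proof -
          have "deriv_along W (d s) p \<in> I" "deriv_along W (d s0) p \<in> I" using that s d s0(1) by auto
          then show ?thesis unfolding d'_def deriv_along_diff_field by (intro diff mult)
        qed
      qed
      ultimately show ?thesis using T(1)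
        by (intro exI[of _ "T - {s0}"] exI[of _ "d s0 j * g"] exI[of _ d']) blast
    qed
  qed
  then obtain T g d where T: "T \<subseteq> S" "card S \<le> card T + card J" and g: "g \<notin> I" and
      d: "\<forall>s\<in>T. (\<forall>t\<in>T. d s t = (if s = t then g else 0)) \<and> (\<forall>j\<in>J. d s j \<in> I) \<and>
        (\<forall>p\<in>I. mp_vars p \<subseteq> W \<longrightarrow> deriv_along W (d s) p \<in> I)" by (elim exE conjE)
  from T(2) J(2) have "card T \<noteq> 0" by linarith
  then obtain s where "s \<in> T" by fastforce
  with T(1) g d show ?thesis by (intro exI[of _ "d s"]) (auto intro!: bexI[of _ s])
qed

end

subsection \<open>The ideal of the normalised Keller mappings\<close>

lemma lookup_single_mult:
  fixes p :: "('v, 'a::comm_semiring_1) mpoly"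
  shows "Poly_Mapping.lookup (Poly_Mapping.single m c * p) q =
    (if \<forall>v. Poly_Mapping.lookup m v \<le> Poly_Mapping.lookup q v then c * Poly_Mapping.lookup p (q - m) else 0)"
proof -
  have iff: "m + k = q \<longleftrightarrow> (\<forall>v. Poly_Mapping.lookup m v \<le> Poly_Mapping.lookup q v) \<and> k = q - m" for k
  proof
    assume "m + k = q"
    then show "(\<forall>v. Poly_Mapping.lookup m v \<le> Poly_Mapping.lookup q v) \<and> k = q - m"
      by (auto simp: lookup_add)
  next
    assume "(\<forall>v. Poly_Mapping.lookup m v \<le> Poly_Mapping.lookup q v) \<and> k = q - m"
    then show "m + k = q" by (intro poly_mapping_eqI) (simp add: lookup_add lookup_minus)
  qed
  have "Poly_Mapping.single m c * p =
      (\<Sum>k\<in>Poly_Mapping.keys p. Poly_Mapping.single (m + k) (c * Poly_Mapping.lookup p k))"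
    by (subst mp_monom_expansion[of p]) (simp add: sum_distrib_left mult_single)
  then have "Poly_Mapping.lookup (Poly_Mapping.single m c * p) q =
      (\<Sum>k\<in>Poly_Mapping.keys p. if m + k = q then c * Poly_Mapping.lookup p k else 0)"
    by (simp add: lookup_sum lookup_single when_def)
  also have "\<dots> = (if \<forall>v. Poly_Mapping.lookup m v \<le> Poly_Mapping.lookup q v
      then \<Sum>k\<in>Poly_Mapping.keys p. if k = q - m then c * Poly_Mapping.lookup p k else 0 else 0)"
    by (auto simp: iff intro!: sum.neutral)
  finally show ?thesis by (simp add: sum.delta in_keys_iff)
qed

definition normalised :: "nat \<Rightarrow> 'n::finite poly_map set" where
  "normalised d = {F \<in> X_var d. (\<forall>i. Poly_Mapping.lookup (F $ i) 0 = 0) \<and>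
     (\<forall>i j. Poly_Mapping.lookup (F $ i) (Poly_Mapping.single j 1) = (if i = j then 1 else 0))}"

definition linear_part :: "'n::finite poly_map \<Rightarrow> complex ^ 'n ^ 'n" where
  "linear_part F = (\<chi> i j. Poly_Mapping.lookup (F $ i) (Poly_Mapping.single j 1))"

lemma normalised_iff:
  "F \<in> normalised d \<longleftrightarrow> F \<in> X_var d \<and> (\<forall>i. Poly_Mapping.lookup (F $ i) 0 = 0) \<and> linear_part F = mat 1"
  by (auto simp: normalised_def linear_part_def mat_def vec_eq_iff)

lemma lookup_zero_eval: "Poly_Mapping.lookup p 0 = mp_eval (\<lambda>_. 0) (p :: ('v, complex) mpoly)"
proof -
  have "mp_eval (\<lambda>_. 0) p = (\<Sum>m\<in>Poly_Mapping.keys p. if m = 0 then Poly_Mapping.lookup p m else 0)"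
    unfolding mp_eval_def
  proof (intro sum.cong refl)
    fix m :: "'v monom"
    show "Poly_Mapping.lookup p m * mon_eval (\<lambda>_. 0) m = (if m = 0 then Poly_Mapping.lookup p m else 0)"
    proof (cases "m = 0")
      case False
      then obtain v where "v \<in> Poly_Mapping.keys m" by fastforce
      then have "mon_eval (\<lambda>_. 0 :: complex) m = 0"
        unfolding mon_eval_def by (intro prod_zero) (auto simp: in_keys_iff)
      with False show ?thesis by simp
    qed simp
  qed
  also have "\<dots> = Poly_Mapping.lookup p 0" by (simp add: sum.delta in_keys_iff)
  finally show ?thesis ..
qed

lemma lookup_linear_eval:
  "Poly_Mapping.lookup p (Poly_Mapping.single j 1) = mp_eval (\<lambda>_. 0) (mp_pderiv j (p :: ('v, complex) mpoly))"
  unfolding lookup_zero_eval[symmetric] by (simp add: lookup_mp_pderiv)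

lemma det_linear_part:
  assumes "F \<in> X_var d"
  shows "det (linear_part F) = 1"
proof -
  have "mp_eval (($) (0 :: complex ^ 'a)) (jacobian F) = 1" using assms by (simp add: X_var_def)
  moreover have "($) (0 :: complex ^ 'a) = (\<lambda>_. 0)" by auto
  ultimately show ?thesis by (simp only: mp_eval_jacobian linear_part_def lookup_linear_eval)
qed

text \<open>Cramer's formula without the division by the determinant, which is 1 in the application:
  the entries are polynomials in those of \<open>A\<close>, as a regular retraction
  requires.\<close>

definition cofactor_inverse :: "complex ^ 'n ^ 'n \<Rightarrow> complex ^ 'n ^ 'n::finite" where
  "cofactor_inverse A = (\<chi> i j. det (\<chi> k l. if l = i then (if k = j then 1 else 0) else A $ k $ l))"

lemma cofactor_inverse:
  fixes A :: "complex ^ 'n ^ 'n::finite"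
  assumes "det A = 1"
  shows "cofactor_inverse A ** A = mat 1"
proof -
  have "A ** cofactor_inverse A = mat 1"
  proof -
    have "A *v (\<chi> i. cofactor_inverse A $ i $ j) = (\<chi> k. if k = j then 1 else 0)" for j
      using cramer[of A "\<chi> i. cofactor_inverse A $ i $ j" "\<chi> k. if k = j then 1 else 0"] assms
      by (simp add: cofactor_inverse_def cong: if_cong)
    then show ?thesis
      by (simp add: vec_eq_iff matrix_matrix_mult_def matrix_vector_mult_def mat_def)
  qed
  then show ?thesis using matrix_left_right_inverse by blast
qed

text \<open>Composition with an affine map of the target, chosen so that \<open>X_var d\<close> is
  retracted onto the normalised mappings by polynomials in the coefficients.\<close>

definition normalise :: "'n::finite poly_map \<Rightarrow> 'n poly_map" where
  "normalise F = (\<chi> i. \<Sum>j\<in>UNIV. Const (cofactor_inverse (linear_part F) $ i $ j) *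
     (F $ j - Const (Poly_Mapping.lookup (F $ j) 0)))"

lemma lookup_normalise:
  "Poly_Mapping.lookup (normalise F $ i) m = (if m = 0 then 0 else
     \<Sum>j\<in>UNIV. cofactor_inverse (linear_part F) $ i $ j * Poly_Mapping.lookup (F $ j) m)"
  by (simp add: normalise_def lookup_sum lookup_single_mult lookup_minus lookup_single)

lemma normalise_in_normalised:
  assumes "F \<in> X_var d"
  shows "normalise F \<in> normalised d"
proof -
  let ?B = "cofactor_inverse (linear_part F)"
  have inv: "?B ** linear_part F = mat 1"
    using det_linear_part[OF assms] by (rule cofactor_inverse)
  have "det ?B = det (?B ** linear_part F)"
    using det_linear_part[OF assms] by (simp add: det_mul)
  then have det_B: "det ?B = 1" by (simp add: inv)
  have "deg_le d (normalise F $ i)" for i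
    using assms unfolding normalise_def X_var_def Omega_deg_le
    by (auto intro!: deg_le_sum deg_le_diff deg_le_mult[of 0, simplified])
  then have "normalise F \<in> Omega d" by (simp add: Omega_deg_le)
  moreover have "mp_eval x (jacobian (normalise F)) = mp_eval x 1" for x
  proof -
    have "(\<chi> i j. mp_eval x (mp_pderiv j (normalise F $ i))) = ?B ** (\<chi> i j. mp_eval x (mp_pderiv j (F $ i)))"
      by (simp add: normalise_def mp_pderiv_simps mp_eval_simps matrix_matrix_mult_def vec_eq_iff)
    then have "mp_eval x (jacobian (normalise F)) = mp_eval x (jacobian F)"
      unfolding mp_eval_jacobian by (simp add: det_mul det_B)
    then show ?thesis using assms by (simp add: X_var_def)
  qed
  then have "jacobian (normalise F) = 1" by (simp add: mp_eq_iff_eval_eq)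
  moreover have "linear_part (normalise F) = ?B ** linear_part F"
  proof -
    have "Poly_Mapping.single j (1::nat) \<noteq> 0" for j :: 'a
      by (metis lookup_single_eq lookup_zero one_neq_zero)
    then show ?thesis
      by (simp only: linear_part_def[of "normalise F"] lookup_normalise matrix_matrix_mult_def vec_eq_iff
          vec_lambda_beta if_False) (simp add: linear_part_def)
  qed
  ultimately show ?thesis unfolding normalised_iff X_var_def by (simp add: inv lookup_normalise)
qed

lemma normalise_ident:
  assumes "F \<in> normalised d"
  shows "normalise F = F"
proof -
  have F: "linear_part F = mat 1" "\<And>i. Poly_Mapping.lookup (F $ i) 0 = 0"
    using assms by (auto simp: normalised_iff)
  then have "cofactor_inverse (linear_part F) = mat 1"
    using cofactor_inverse[of "mat 1"] by simp
  then have "Poly_Mapping.lookup (normalise F $ i) m = Poly_Mapping.lookup (F $ i) m" for i m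
    unfolding lookup_normalise using F(2) by (simp add: mat_def if_distrib[of "\<lambda>c. c * _"] cong: if_cong)
  then show ?thesis by (simp add: vec_eq_iff poly_mapping_eqI)
qed

lemma regular_normalise: "regular d (\<lambda>F. mp_eval (coords (normalise F)) p)"
  using subset_UNIV
proof (induction p rule: mp_induct)
  case (Var v)
  obtain i m where v: "v = (i, m)" by (cases v)
  have entry: "regular d (\<lambda>F. if l = i then (if k = j then 1 else 0) else Poly_Mapping.lookup (F $ k) (Poly_Mapping.single l 1))"
    for j k l :: 'a
    by (cases "l = i"; cases "k = j") (simp_all add: regular_coord)
  have "regular d (\<lambda>F. cofactor_inverse (linear_part F) $ i $ j)" for j
    unfolding cofactor_inverse_def linear_part_def
    by (simp only: vec_lambda_beta) (intro regular_det entry)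
  then have "regular d (\<lambda>F. Poly_Mapping.lookup (normalise F $ i) m)"
    unfolding lookup_normalise by (cases "m = 0") (simp_all add: regular_sum regular_mult regular_coord)
  then show ?case by (simp add: v coords_def)
qed (simp_all add: mp_eval_simps regular_add regular_mult)

definition vanishing_ideal :: "nat \<Rightarrow> ('n::finite \<times> 'n monom, complex) mpoly set" where
  "vanishing_ideal d = {p. \<forall>F\<in>normalised d. mp_eval (coords F) p = 0}"

text \<open>The normalised mappings are the image of \<open>X_var d\<close> under the regular
  retraction \<open>normalise\<close>, so a product that vanishes on them pulls back to a product
  that vanishes on \<open>X_var d\<close>.\<close>

lemma vanishing_ideal_prime:
  assumes irr: "irreducible_space (X_zariski d :: 'n::finite poly_map topology)"
  shows "mp_prime_ideal (vanishing_ideal d :: ('n \<times> 'n monom, complex) mpoly set)"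
proof
  from irr obtain F :: "'n poly_map" where "F \<in> X_var d"
    by (auto simp: irreducible_space_def)
  then show "1 \<notin> (vanishing_ideal d :: ('n \<times> 'n monom, complex) mpoly set)"
    using normalise_in_normalised[of F d] by (auto simp: vanishing_ideal_def)
next
  fix p q :: "('n \<times> 'n monom, complex) mpoly"
  assume pq: "p * q \<in> vanishing_ideal d"
  have "(\<forall>F\<in>X_var d. mp_eval (coords (normalise F)) p = 0) \<or> (\<forall>F\<in>X_var d. mp_eval (coords (normalise F)) q = 0)"
  proof (rule irreducible_product[OF irr regular_normalise regular_normalise])
    fix F :: "'n poly_map" assume "F \<in> X_var d"
    from normalise_in_normalised[OF this] pq
    show "mp_eval (coords (normalise F)) p * mp_eval (coords (normalise F)) q = 0"
      unfolding vanishing_ideal_def mem_Collect_eq mp_eval_mult by blast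
  qed
  moreover have "F \<in> X_var d" "normalise F = F" if "F \<in> normalised d" for F :: "'n poly_map"
    using that normalise_ident by (auto simp: normalised_iff)
  ultimately show "p \<in> vanishing_ideal d \<or> q \<in> vanishing_ideal d"
    unfolding vanishing_ideal_def mem_Collect_eq by metis
qed (auto simp: vanishing_ideal_def mp_eval_simps)

text \<open>
  If \<open>X_var d\<close> were irreducible, the tangent spaces to the normalised mappings would generically
  have dimension at least \<open>card S\<close>, and they are no larger at a generic point than at the special
  point \<open>F0\<close>, where the tangent space meets the coordinate subspace \<open>J = 0\<close> trivially.
\<close>

lemma reducible_by_tangent_space:
  fixes F0 :: "'n::finite poly_map" and S J :: "('n \<times> 'n monom) set"
  assumes F0: "F0 \<in> normalised d" and S: "S \<subseteq> coord_index d"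
    and indep: "\<And>p. p \<in> vanishing_ideal d \<Longrightarrow> mp_vars p \<subseteq> S \<Longrightarrow> p = 0"
    and J: "finite J" "card J < card S"
    and tangent: "\<And>v. \<forall>p\<in>vanishing_ideal d \<inter> coord_polys d.
        (\<Sum>j\<in>coord_index d - J. mp_eval (coords F0) (mp_pderiv j p) * v j) = 0 \<Longrightarrow>
        \<forall>j\<in>coord_index d - J. v j = 0"
  shows "\<not> irreducible_space (X_zariski d :: 'n poly_map topology)"
proof
  assume irr: "irreducible_space (X_zariski d :: 'n poly_map topology)"
  let ?I = "vanishing_ideal d :: ('n \<times> 'n monom, complex) mpoly set"
  let ?W = "coord_index d :: ('n \<times> 'n monom) set"
  interpret mp_prime_ideal ?I by (rule vanishing_ideal_prime[OF irr])
  \<comment> \<open>With more independent coordinates than conditions, some vector field preserves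
    the ideal and has its \<open>J\<close>-components in the ideal without being zero modulo
    it.\<close>
  have "\<exists>e. (\<exists>s\<in>S. e s \<notin> ?I) \<and> (\<forall>j\<in>J. e j \<in> ?I) \<and>
      (\<forall>p\<in>?I. mp_vars p \<subseteq> ?W \<longrightarrow> deriv_along ?W e p \<in> ?I)"
    by (rule derivation_vanishing_on[OF finite_coord_index S J]) (rule indep)
  then obtain e s where s: "s \<in> S" "e s \<notin> ?I" and e_J: "\<forall>j\<in>J. e j \<in> ?I"
    and e_I: "\<forall>p\<in>?I. mp_vars p \<subseteq> ?W \<longrightarrow> deriv_along ?W e p \<in> ?I"
    by (elim exE conjE bexE)
  have "\<exists>\<delta>. regular d \<delta> \<and> \<delta> F0 \<noteq> 0 \<and> (\<forall>F v. \<delta> F \<noteq> 0 \<longrightarrow>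
      (\<forall>p\<in>?I \<inter> coord_polys d. (\<Sum>j\<in>?W - J. mp_eval (coords F) (mp_pderiv j p) * v j) = 0) \<longrightarrow>
      (\<forall>j\<in>?W - J. v j = 0))"
  proof (rule injective_system_open)
    show "finite (?W - J)" using finite_coord_index by blast
    fix p j assume "p \<in> ?I \<inter> coord_polys d" "j \<in> ?W - J"
    then have "mp_pderiv j p \<in> coord_polys d" using mp_vars_pderiv[of j p] by (auto simp: coord_polys_def)
    then show "regular d (\<lambda>F. mp_eval (coords F) (mp_pderiv j p))" by (auto simp: regular_def)
  qed (simp_all add: regular_mult regular_diff tangent)
  then obtain \<delta> where \<delta>: "regular d \<delta>" "\<delta> F0 \<noteq> 0" and
    inj: "\<forall>F v. \<delta> F \<noteq> 0 \<longrightarrow>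
      (\<forall>p\<in>?I \<inter> coord_polys d. (\<Sum>j\<in>?W - J. mp_eval (coords F) (mp_pderiv j p) * v j) = 0) \<longrightarrow>
      (\<forall>j\<in>?W - J. v j = 0)"
    by (elim exE conjE)
  from \<delta>(1) obtain D where D: "\<forall>F\<in>Omega d. \<delta> F = mp_eval (coords F) D"
    by (auto simp: regular_def)
  have Omega: "F \<in> Omega d" if "F \<in> normalised d" for F :: "'n poly_map"
    using that by (simp add: normalised_def X_var_def)
  \<comment> \<open>Where \<open>\<delta>\<close> does not vanish, the values of \<open>e\<close>
    form a tangent vector with zero \<open>J\<close>-part, hence the zero vector. So
    \<open>D * e s\<close> lies in the ideal, and primeness will force \<open>D\<close> to vanish at
    \<open>F0\<close>.\<close>
  have "mp_eval (coords F) (D * e s) = 0" if F: "F \<in> normalised d" for F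
  proof (cases "\<delta> F = 0")
    case True
    with D Omega[OF F] show ?thesis by (simp add: mp_eval_mult)
  next
    case False
    have rows: "\<forall>p\<in>?I \<inter> coord_polys d.
        (\<Sum>j\<in>?W - J. mp_eval (coords F) (mp_pderiv j p) * mp_eval (coords F) (e j)) = 0"
    proof
      fix p assume p: "p \<in> ?I \<inter> coord_polys d"
      have "deriv_along ?W e p \<in> ?I" using e_I p by (simp add: coord_polys_def)
      then have "mp_eval (coords F) (deriv_along ?W e p) = 0" using F by (simp add: vanishing_ideal_def)
      then have "(\<Sum>j\<in>?W. mp_eval (coords F) (mp_pderiv j p) * mp_eval (coords F) (e j)) = 0"
        by (simp add: deriv_along_def mp_eval_simps mult.commute)
      moreover have "mp_eval (coords F) (e j) = 0" if "j \<in> J" for j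
        using e_J that F by (simp add: vanishing_ideal_def)
      ultimately show "(\<Sum>j\<in>?W - J. mp_eval (coords F) (mp_pderiv j p) * mp_eval (coords F) (e j)) = 0"
        by (subst sum.mono_neutral_left[OF finite_coord_index]) auto
    qed
    from inj[THEN spec[of _ F], THEN spec[of _ "\<lambda>j. mp_eval (coords F) (e j)"], THEN mp, OF False, THEN mp, OF rows]
    have "mp_eval (coords F) (e j) = 0" if "j \<in> ?W - J" for j using that by (rule bspec)
    moreover have "s \<in> ?W - J" using s S e_J by auto
    ultimately show ?thesis by (simp add: mp_eval_mult)
  qed
  then have "D * e s \<in> ?I" by (simp add: vanishing_ideal_def)
  from prime[OF this] s(2) have "D \<in> ?I" by simp
  with F0 have "mp_eval (coords F0) D = 0" by (simp add: vanishing_ideal_def)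
  with \<delta>(2) D Omega[OF F0] show False by simp
qed

subsection \<open>A linearised Jacobian determinant\<close>

text \<open>
  \<open>Dx p q r g\<close> is the coefficient function of \<open>x\<^sup>p y\<^sup>q z\<^sup>r \<partial>P/\<partial>x\<close> if
  \<open>g\<close> is that of \<open>P\<close>; likewise \<open>Dy\<close> and \<open>Dz\<close>.
\<close>

definition Dx :: "nat \<Rightarrow> nat \<Rightarrow> nat \<Rightarrow> (nat \<Rightarrow> nat \<Rightarrow> nat \<Rightarrow> 'a::semiring_1) \<Rightarrow> nat \<Rightarrow> nat \<Rightarrow> nat \<Rightarrow> 'a" where
  "Dx p q r g i j k = (if p \<le> i \<and> q \<le> j \<and> r \<le> k then of_nat (i - p + 1) * g (i - p + 1) (j - q) (k - r) else 0)"

definition Dy :: "nat \<Rightarrow> nat \<Rightarrow> nat \<Rightarrow> (nat \<Rightarrow> nat \<Rightarrow> nat \<Rightarrow> 'a::semiring_1) \<Rightarrow> nat \<Rightarrow> nat \<Rightarrow> nat \<Rightarrow> 'a" where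
  "Dy p q r g i j k = (if p \<le> i \<and> q \<le> j \<and> r \<le> k then of_nat (j - q + 1) * g (i - p) (j - q + 1) (k - r) else 0)"

definition Dz :: "nat \<Rightarrow> nat \<Rightarrow> nat \<Rightarrow> (nat \<Rightarrow> nat \<Rightarrow> nat \<Rightarrow> 'a::semiring_1) \<Rightarrow> nat \<Rightarrow> nat \<Rightarrow> nat \<Rightarrow> 'a" where
  "Dz p q r g i j k = (if p \<le> i \<and> q \<le> j \<and> r \<le> k then of_nat (k - r + 1) * g (i - p) (j - q) (k - r + 1) else 0)"

text \<open>
  The derivative of the Jacobian determinant at
  \<open>(x + y\<^sup>3, y + (z + x\<^sup>3)\<^sup>2, z + x\<^sup>3 + (x + y\<^sup>3)\<^sup>2)\<close> in the direction with coefficient functions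
  \<open>u\<close>, \<open>v\<close>, \<open>w\<close>: the summands are the monomials of the cofactors of the Jacobian matrix.
\<close>

definition linearised_jacobian ::
  "(nat \<Rightarrow> nat \<Rightarrow> nat \<Rightarrow> 'a::ring_1) \<Rightarrow> (nat \<Rightarrow> nat \<Rightarrow> nat \<Rightarrow> 'a) \<Rightarrow> (nat \<Rightarrow> nat \<Rightarrow> nat \<Rightarrow> 'a) \<Rightarrow> nat \<Rightarrow> nat \<Rightarrow> nat \<Rightarrow> 'a" where
  "linearised_jacobian u v w i j k =
     Dx 0 0 0 u i j k - 12 * Dx 0 5 1 u i j k - 12 * Dx 1 2 1 u i j k - 12 * Dx 3 5 0 u i j k
     - 12 * Dx 4 2 0 u i j k + 4 * Dy 0 3 1 u i j k + 4 * Dy 1 0 1 u i j k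
     + 4 * Dy 3 3 0 u i j k + 4 * Dy 4 0 0 u i j k - 2 * Dz 0 3 0 u i j k
     - 2 * Dz 1 0 0 u i j k - 3 * Dz 2 0 0 u i j k + 36 * Dz 2 5 1 u i j k
     + 36 * Dz 3 2 1 u i j k + 36 * Dz 5 5 0 u i j k + 36 * Dz 6 2 0 u i j k
     - 3 * Dx 0 2 0 v i j k + Dy 0 0 0 v i j k + 9 * Dz 2 2 0 v i j k + 6 * Dx 0 2 1 w i j k
     + 6 * Dx 3 2 0 w i j k - 2 * Dy 0 0 1 w i j k - 2 * Dy 3 0 0 w i j k + Dz 0 0 0 w i j k
     - 18 * Dz 2 2 1 w i j k - 18 * Dz 5 2 0 w i j k"

text \<open>
  The kernel in degrees two to six has dimension 31; the 31 unknowns set to zero and the order of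
  elimination, in which every equation determines one more unknown, were found by computer.
\<close>

lemma linearised_jacobian_injective:
  fixes u v w :: "nat \<Rightarrow> nat \<Rightarrow> nat \<Rightarrow> real"
  assumes eq: "\<And>i j k. linearised_jacobian u v w i j k = 0"
    and deg: "\<And>i j k. i + j + k < 2 \<or> 6 < i + j + k \<Longrightarrow> u i j k = 0 \<and> v i j k = 0 \<and> w i j k = 0"
    and J:
      "u 0 2 0 = 0" "u 0 2 1 = 0" "u 0 3 0 = 0" "u 0 6 0 = 0" "u 1 1 0 = 0" "u 2 0 1 = 0" "u 2 1 0 = 0"
      "u 3 3 0 = 0" "u 6 0 0 = 0" "v 0 0 2 = 0" "v 0 3 0 = 0" "v 0 3 1 = 0" "v 0 4 0 = 0" "v 0 6 0 = 0"
      "v 1 0 1 = 0" "v 3 2 0 = 0" "v 3 2 1 = 0" "v 4 0 1 = 0" "v 4 1 0 = 0" "v 4 1 1 = 0" "v 4 2 0 = 0"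
      "v 5 0 0 = 0" "v 5 1 0 = 0" "v 6 0 0 = 0" "w 0 0 2 = 0" "w 0 1 1 = 0" "w 0 3 1 = 0" "w 0 6 0 = 0"
      "w 1 4 1 = 0" "w 2 0 1 = 0" "w 6 0 0 = 0"
  shows "u i j k = 0" "v i j k = 0" "w i j k = 0"
proof -
  \<comment> \<open>Writing 1 instead of \<open>Suc 0\<close> keeps the indices in the form in which
    the equations below serve as rewrite rules.\<close>
  note [simp] = linearised_jacobian_def Dx_def Dy_def Dz_def deg J One_nat_def[symmetric] and [simp del] = One_nat_def
  have [simp]: "u 0 0 5 = 0" using eq[of 2 5 5] by simp
  have [simp]: "w 1 0 5 = 0" using eq[of 3 2 5] by simp
  have [simp]: "u 0 0 6 = 0" using eq[of 3 2 6] by simp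
  have [simp]: "u 1 1 4 = 0" using eq[of 2 0 5] by simp
  have [simp]: "u 0 1 4 = 0" using eq[of 2 6 4] by simp
  have [simp]: "w 1 1 4 = 0" using eq[of 1 0 5] by simp
  have [simp]: "u 0 1 5 = 0" using eq[of 1 0 6] by simp
  have [simp]: "u 1 2 3 = 0" using eq[of 2 1 4] by simp
  have [simp]: "u 0 2 2 = 0" using eq[of 5 7 1] by simp
  have [simp]: "u 3 2 1 = 0" using eq[of 2 7 2] by simp
  have [simp]: "w 1 2 2 = 0" using eq[of 6 4 1] by simp
  have [simp]: "v 1 2 3 = 0" using eq[of 0 4 3] by simp
  have [simp]: "u 2 1 3 = 0" using eq[of 1 1 3] by simp
  have [simp]: "u 0 2 3 = 0" using eq[of 2 7 3] by simp
  have [simp]: "w 1 2 3 = 0" using eq[of 1 1 4] by simp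
  have [simp]: "u 0 2 4 = 0" using eq[of 1 1 5] by simp
  have [simp]: "u 0 3 1 = 0" using eq[of 2 8 1] by simp
  have [simp]: "v 1 4 0 = 0" using eq[of 0 6 0] by simp
  have [simp]: "u 0 3 2 = 0" using eq[of 2 8 2] by simp
  have [simp]: "u 0 3 3 = 0" using eq[of 2 8 3] by simp
  have [simp]: "u 1 0 3 = 0" using eq[of 0 5 4] by simp
  have [simp]: "u 4 0 2 = 0" using eq[of 3 5 3] by simp
  have [simp]: "u 0 4 1 = 0" using eq[of 2 9 1] by simp
  have [simp]: "u 1 1 1 = 0" using eq[of 0 6 2] by simp
  have [simp]: "u 4 1 0 = 0" using eq[of 3 6 1] by simp
  have [simp]: "v 1 5 0 = 0" using eq[of 0 7 0] by simp
  have [simp]: "u 0 4 2 = 0" using eq[of 2 9 2] by simp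
  have [simp]: "u 1 1 2 = 0" using eq[of 0 6 3] by simp
  have [simp]: "u 4 1 1 = 0" using eq[of 3 6 2] by simp
  have [simp]: "u 0 5 1 = 0" using eq[of 2 10 1] by simp
  have [simp]: "u 1 2 1 = 0" using eq[of 0 7 2] by simp
  have [simp]: "u 4 2 0 = 0" using eq[of 3 7 1] by simp
  have [simp]: "v 2 3 0 = 0" using eq[of 1 5 0] by simp
  have [simp]: "u 1 3 0 = 0" using eq[of 0 8 1] by simp
  have [simp]: "w 2 0 3 = 0" using eq[of 7 2 2] by simp
  have [simp]: "v 2 0 4 = 0" using eq[of 1 2 4] by simp
  have [simp]: "u 1 0 4 = 0" using eq[of 0 5 5] by simp
  have [simp]: "w 2 0 4 = 0" using eq[of 1 2 5] by simp
  have [simp]: "u 1 0 5 = 0" using eq[of 1 2 6] by simp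
  have [simp]: "w 0 1 4 = 0" using eq[of 3 0 4] by simp
  have [simp]: "v 0 2 0 = 0" using eq[of 0 1 0] by simp
  have [simp]: "w 2 1 2 = 0" using eq[of 7 3 1] by simp
  have [simp]: "v 2 1 3 = 0" using eq[of 1 3 3] by simp
  have [simp]: "u 3 0 3 = 0" using eq[of 5 0 2] by simp
  have [simp]: "u 0 0 4 = 0" using eq[of 2 5 4] by simp
  have [simp]: "w 1 0 4 = 0" using eq[of 6 2 3] by simp
  have [simp]: "v 1 0 5 = 0" using eq[of 3 2 4] by simp
  have [simp]: "u 1 1 3 = 0" using eq[of 0 6 4] by simp
  have [simp]: "w 2 1 3 = 0" using eq[of 2 0 4] by simp
  have [simp]: "w 2 2 1 = 0" using eq[of 7 4 0] by simp
  have [simp]: "v 2 2 2 = 0" using eq[of 1 4 2] by simp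
  have [simp]: "u 3 1 2 = 0" using eq[of 5 1 1] by simp
  have [simp]: "u 0 1 3 = 0" using eq[of 2 6 3] by simp
  have [simp]: "w 1 1 3 = 0" using eq[of 6 3 2] by simp
  have [simp]: "v 1 1 4 = 0" using eq[of 0 3 4] by simp
  have [simp]: "u 2 0 4 = 0" using eq[of 1 0 4] by simp
  have [simp]: "u 1 2 2 = 0" using eq[of 0 7 3] by simp
  have [simp]: "w 2 2 2 = 0" using eq[of 2 1 3] by simp
  have [simp]: "w 2 3 1 = 0" using eq[of 1 5 2] by simp
  have [simp]: "v 1 1 0 = 0" using eq[of 0 3 0] by simp
  have [simp]: "u 1 3 1 = 0" using eq[of 0 8 2] by simp
  have [simp]: "u 5 0 0 = 0" using eq[of 4 5 1] by simp
  have [simp]: "v 3 0 2 = 0" using eq[of 5 2 1] by simp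
  have [simp]: "v 2 4 0 = 0" using eq[of 1 6 0] by simp
  have [simp]: "u 1 3 2 = 0" using eq[of 0 8 3] by simp
  have [simp]: "u 1 4 0 = 0" using eq[of 0 9 1] by simp
  have [simp]: "w 2 4 0 = 0" using eq[of 1 6 1] by simp
  have [simp]: "u 1 4 1 = 0" using eq[of 0 9 2] by simp
  have [simp]: "u 2 1 1 = 0" using eq[of 1 6 2] by simp
  have [simp]: "v 0 2 1 = 0" using eq[of 2 4 0] by simp
  have [simp]: "u 5 1 0 = 0" using eq[of 4 6 1] by simp
  have [simp]: "u 1 5 0 = 0" using eq[of 0 10 1] by simp
  have [simp]: "u 2 2 0 = 0" using eq[of 1 7 1] by simp
  have [simp]: "w 3 0 1 = 0" using eq[of 8 2 0] by simp
  have [simp]: "v 0 0 3 = 0" using eq[of 2 2 2] by simp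
  have [simp]: "u 2 0 2 = 0" using eq[of 1 5 3] by simp
  have [simp]: "u 5 0 1 = 0" using eq[of 4 5 2] by simp
  have [simp]: "w 3 0 2 = 0" using eq[of 8 2 1] by simp
  have [simp]: "u 2 0 3 = 0" using eq[of 1 5 4] by simp
  have [simp]: "w 3 0 3 = 0" using eq[of 8 2 2] by simp
  have [simp]: "w 0 0 4 = 0" using eq[of 5 2 3] by simp
  have [simp]: "v 0 0 5 = 0" using eq[of 2 2 4] by simp
  have [simp]: "w 0 0 5 = 0" using eq[of 5 2 4] by simp
  have [simp]: "v 0 0 6 = 0" using eq[of 2 2 5] by simp
  have [simp]: "w 3 1 1 = 0" using eq[of 6 0 1] by simp
  have [simp]: "w 0 2 0 = 0" using eq[of 3 1 0] by simp
  have [simp]: "w 0 1 2 = 0" using eq[of 0 1 1] by simp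
  have [simp]: "v 0 1 3 = 0" using eq[of 0 0 3] by simp
  have [simp]: "v 3 1 2 = 0" using eq[of 2 3 2] by simp
  have [simp]: "u 2 1 2 = 0" using eq[of 1 6 3] by simp
  have [simp]: "w 3 1 2 = 0" using eq[of 6 0 2] by simp
  have [simp]: "w 0 1 3 = 0" using eq[of 3 0 3] by simp
  have [simp]: "v 0 1 4 = 0" using eq[of 0 0 4] by simp
  have [simp]: "v 0 1 5 = 0" using eq[of 2 3 4] by simp
  have [simp]: "w 0 0 6 = 0" using eq[of 0 0 5] by simp
  have [simp]: "w 3 2 0 = 0" using eq[of 6 1 0] by simp
  have [simp]: "w 0 2 1 = 0" using eq[of 3 1 1] by simp
  have [simp]: "v 0 2 2 = 0" using eq[of 2 4 1] by simp
  have [simp]: "u 1 2 0 = 0" using eq[of 0 2 0] by simp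
  have [simp]: "u 2 2 1 = 0" using eq[of 1 7 2] by simp
  have [simp]: "v 3 3 0 = 0" using eq[of 2 5 0] by simp
  have [simp]: "w 0 2 2 = 0" using eq[of 5 4 1] by simp
  have [simp]: "v 0 2 3 = 0" using eq[of 0 1 3] by simp
  have [simp]: "w 3 2 1 = 0" using eq[of 3 1 2] by simp
  have [simp]: "w 0 3 0 = 0" using eq[of 0 2 1] by simp
  have [simp]: "v 4 0 0 = 0" using eq[of 3 2 0] by simp
  have [simp]: "u 2 2 2 = 0" using eq[of 1 7 3] by simp
  have [simp]: "w 0 2 3 = 0" using eq[of 3 1 3] by simp
  have [simp]: "v 0 2 4 = 0" using eq[of 2 4 3] by simp
  have [simp]: "w 0 1 5 = 0" using eq[of 0 1 4] by simp
  have [simp]: "u 2 3 0 = 0" using eq[of 1 8 1] by simp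
  have [simp]: "u 2 3 1 = 0" using eq[of 1 8 2] by simp
  have [simp]: "u 3 0 1 = 0" using eq[of 8 5 0] by simp
  have [simp]: "v 0 4 1 = 0" using eq[of 2 6 0] by simp
  have [simp]: "u 2 4 0 = 0" using eq[of 1 9 1] by simp
  have [simp]: "v 2 2 0 = 0" using eq[of 1 4 0] by simp
  have [simp]: "w 4 0 1 = 0" using eq[of 9 2 0] by simp
  have [simp]: "w 1 1 0 = 0" using eq[of 4 0 0] by simp
  have [simp]: "u 3 0 2 = 0" using eq[of 8 5 1] by simp
  have [simp]: "w 4 0 2 = 0" using eq[of 9 2 1] by simp
  have [simp]: "u 3 1 1 = 0" using eq[of 8 6 0] by simp
  have [simp]: "w 2 2 0 = 0" using eq[of 5 1 0] by simp
  have [simp]: "w 4 1 1 = 0" using eq[of 7 0 1] by simp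
  have [simp]: "w 1 2 0 = 0" using eq[of 4 1 0] by simp
  have [simp]: "u 4 0 1 = 0" using eq[of 9 5 0] by simp
  have [simp]: "w 3 1 0 = 0" using eq[of 6 0 0] by simp
  have [simp]: "v 3 1 1 = 0" using eq[of 5 3 0] by simp
  have [simp]: "v 0 1 2 = 0" using eq[of 2 3 1] by simp
  have [simp]: "u 1 0 2 = 0" using eq[of 3 0 1] by simp
  have [simp]: "w 1 3 2 = 0" using eq[of 0 5 3] by simp
  have [simp]: "w 0 0 3 = 0" using eq[of 0 0 2] by simp
  have [simp]: "v 3 0 3 = 0" using eq[of 5 2 2] by simp
  have [simp]: "v 0 0 4 = 0" using eq[of 2 2 3] by simp
  have [simp]: "w 5 0 1 = 0" using eq[of 10 2 0] by simp
  have [simp]: "w 2 0 2 = 0" using eq[of 7 2 1] by simp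
  have [simp]: "v 2 0 3 = 0" using eq[of 1 2 3] by simp
  have [simp]: "w 2 1 0 = 0" using eq[of 5 0 0] by simp
  have [simp]: "w 5 1 0 = 0" using eq[of 8 0 0] by simp
  have [simp]: "w 2 1 1 = 0" using eq[of 5 0 1] by simp
  have [simp]: "v 2 1 2 = 0" using eq[of 1 3 2] by simp
  have [simp]: "u 0 0 3 = 0" using eq[of 2 0 2] by simp
  have [simp]: "w 0 3 3 = 0" using eq[of 2 5 3] by simp
  have [simp]: "w 1 0 3 = 0" using eq[of 6 2 2] by simp
  have [simp]: "v 1 0 4 = 0" using eq[of 3 2 3] by simp
  have [simp]: "v 0 5 1 = 0" using eq[of 2 7 0] by simp
  have [simp]: "w 0 2 4 = 0" using eq[of 0 1 5] by simp
  \<comment> \<open>From here on some unknowns are only expressed through others, such as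
    \<open>u 0 0 2\<close>, whose own vanishing follows at the very end.\<close>
  have [simp]: "w 0 3 2 = (2) * u 0 0 2" using eq[of 5 5 1] by simp
  have [simp]: "v 0 3 3 = 0" using eq[of 2 5 2] by simp
  have [simp]: "v 2 1 1 = (6) * u 0 0 2" using eq[of 2 0 1] by simp
  have [simp]: "w 0 4 0 = (-3/8) * v 1 1 1" using eq[of 0 3 1] by simp
  have [simp]: "v 1 1 1 = 0" using eq[of 3 3 0] by simp
  have [simp]: "w 1 0 2 = (2) * u 0 0 2" using eq[of 1 0 1] by simp
  have [simp]: "v 4 0 2 = 0" using eq[of 6 2 1] by simp
  have [simp]: "v 1 0 3 = 0" using eq[of 3 2 2] by simp
  have [simp]: "u 3 1 0 = (1) * u 0 1 1" using eq[of 2 1 0] by simp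
  have [simp]: "w 0 4 1 = 0" using eq[of 5 6 0] by simp
  have [simp]: "v 0 4 2 = 0" using eq[of 2 6 1] by simp
  have [simp]: "w 1 1 2 = (2) * u 0 1 2" using eq[of 4 0 2] by simp
  have [simp]: "v 1 1 3 = 0" using eq[of 1 0 3] by simp
  have [simp]: "v 1 2 1 = 0" using eq[of 1 1 1] by simp
  have [simp]: "w 0 5 0 = 0" using eq[of 3 4 0] by simp
  have [simp]: "w 0 4 2 = (2) * u 0 1 2" using eq[of 0 3 3] by simp
  have [simp]: "v 2 2 1 = (3) * u 0 1 2" using eq[of 2 1 1] by simp
  have [simp]: "w 1 2 1 = (1/2) * v 1 2 2" using eq[of 1 1 2] by simp
  have [simp]: "w 0 5 1 = 0" using eq[of 0 4 2] by simp
  have [simp]: "u 3 2 0 = 0" using eq[of 2 7 1] by simp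
  have [simp]: "v 3 0 0 = 0" using eq[of 2 2 0] by simp
  have [simp]: "v 1 3 0 = 0" using eq[of 0 5 0] by simp
  have [simp]: "w 4 2 0 = 0" using eq[of 7 1 0] by simp
  have [simp]: "v 1 2 2 = 0" using eq[of 4 1 1] by simp
  have [simp]: "v 2 0 0 = 0" using eq[of 1 2 0] by simp
  have [simp]: "w 1 3 0 = (1/2) * v 1 3 1" using eq[of 0 5 1] by simp
  have [simp]: "v 1 3 1 = 0" using eq[of 3 5 0] by simp
  have [simp]: "w 2 0 0 = (1/2) * v 2 0 1" using eq[of 1 2 1] by simp
  have [simp]: "v 2 0 1 = 0" using eq[of 4 2 0] by simp
  have [simp]: "v 3 1 0 = (1) * v 0 1 1" using eq[of 2 3 0] by simp
  have [simp]: "w 1 5 0 = (-10/3) * u 0 5 0" using eq[of 0 7 1] by simp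
  have [simp]: "u 0 5 0 = (27/80) * u 0 1 2" using eq[of 1 4 1] by simp
  have [simp]: "u 0 1 2 = 0" using eq[of 4 4 0] by simp
  have [simp]: "v 0 1 1 = (-1) * u 1 0 1" using eq[of 0 0 1] by simp
  have [simp]: "u 4 0 0 = (1) * u 1 0 1" using eq[of 3 0 0] by simp
  have [simp]: "w 1 3 1 = (-2/3) * u 1 0 1" using eq[of 6 5 0] by simp
  have [simp]: "v 1 3 2 = (-16/3) * u 1 0 1" using eq[of 0 5 2] by simp
  have [simp]: "u 1 0 1 = 0" using eq[of 3 5 1] by simp
  have [simp]: "v 2 0 2 = 0" using eq[of 1 2 2] by simp
  have [simp]: "v 2 1 0 = 0" using eq[of 1 3 0] by simp
  have [simp]: "u 3 0 0 = 0" using eq[of 2 0 0] by simp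
  have [simp]: "w 3 3 0 = 0" using eq[of 5 5 0] by simp
  have [simp]: "v 0 3 2 = 0" using eq[of 2 5 1] by simp
  have [simp]: "w 5 0 0 = (1/2) * v 5 0 1" using eq[of 4 2 1] by simp
  have [simp]: "v 5 0 1 = 0" using eq[of 7 2 0] by simp
  have [simp]: "w 1 0 1 = (1/2) * v 1 0 2" using eq[of 0 2 2] by simp
  have [simp]: "w 4 0 0 = (-1/2) * v 1 0 2" using eq[of 3 2 1] by simp
  have [simp]: "v 1 0 2 = 0" using eq[of 6 2 0] by simp
  have [simp]: "u 2 0 0 = 0" using eq[of 1 0 0] by simp
  have [simp]: "w 2 3 0 = (1/2) * v 2 3 1" using eq[of 1 5 1] by simp
  have [simp]: "v 2 3 1 = 0" using eq[of 4 5 0] by simp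
  have [simp]: "w 3 0 0 = (1/2) * v 3 0 1" using eq[of 2 2 1] by simp
  have [simp]: "v 3 0 1 = 0" using eq[of 5 2 0] by simp
  have [simp]: "w 4 1 0 = (2) * u 0 1 1" using eq[of 7 0 0] by simp
  have [simp]: "w 1 1 1 = (2) * u 0 1 1" using eq[of 4 0 1] by simp
  have [simp]: "v 1 1 2 = 0" using eq[of 1 0 2] by simp
  have [simp]: "u 0 1 1 = 0" using eq[of 0 3 2] by simp
  have [simp]: "v 1 2 0 = 0" using eq[of 1 1 0] by simp
  have [simp]: "v 0 5 0 = 0" using eq[of 0 4 0] by simp
  have [simp]: "w 1 4 0 = (-8/3) * u 0 4 0 + (1/2) * v 1 4 1" using eq[of 0 6 1] by simp
  have [simp]: "v 1 4 1 = 0" using eq[of 3 6 0] by simp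
  have [simp]: "u 0 4 0 = (27/28) * u 0 0 2" using eq[of 1 3 1] by simp
  have [simp]: "u 0 0 2 = 0" using eq[of 4 3 0] by simp
  have "u i j k = 0 \<and> v i j k = 0 \<and> w i j k = 0"
  proof (cases "i + j + k < 2 \<or> 6 < i + j + k")
    case True
    then show ?thesis by (rule deg)
  next
    case False
    then have "i \<in> {0, 1, 2, 3, 4, 5, 6}" "j \<in> {0, 1, 2, 3, 4, 5, 6}" "k \<in> {0, 1, 2, 3, 4, 5, 6}" by auto
    with False show ?thesis
      unfolding insert_iff empty_iff
      by (elim disjE) simp_all
  qed
  then show "u i j k = 0" "v i j k = 0" "w i j k = 0" by auto
qed

subsection \<open>The space of normalised mappings of degree six in dimension three\<close>

lemma mp_eval_cong_vars:
  assumes "\<And>v. v \<in> mp_vars p \<Longrightarrow> x v = y v"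
  shows "mp_eval x p = mp_eval y p"
proof -
  have "mon_eval x m = mon_eval y m" if "m \<in> Poly_Mapping.keys p" for m
  proof -
    have "x v = y v" if "v \<in> Poly_Mapping.keys m" for v
      using assms[of v] that \<open>m \<in> Poly_Mapping.keys p\<close> by (auto simp: mp_vars_def)
    then show ?thesis by (simp add: mon_eval_def)
  qed
  then show ?thesis by (simp add: mp_eval_def)
qed

lemma mp_pderiv_power_nat:
  "mp_pderiv v (p ^ k) = of_nat k * p ^ (k - 1) * (mp_pderiv v p :: ('v, 'a::comm_semiring_1) mpoly)"
  by (cases k) (simp_all only: mp_pderiv_power diff_Suc_1, simp)

text \<open>Setting the variables in \<open>C\<close> to zero erases exactly the monomials that
  involve them, and the rest is determined by its values. Coefficients of a mapping can thus be read
  off without expanding it.\<close>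

lemma lookup_eq_if_eval_eq_on_subspace:
  fixes P Q :: "('v, complex) mpoly"
  assumes eq: "\<And>x. (\<forall>v\<in>C. x v = 0) \<Longrightarrow> mp_eval x P = mp_eval x Q" and m: "Poly_Mapping.keys m \<inter> C = {}"
  shows "Poly_Mapping.lookup P m = Poly_Mapping.lookup Q m"
proof -
  let ?K = "{m \<in> Poly_Mapping.keys (P - Q). Poly_Mapping.keys m \<inter> C = {}}"
  define R where "R = (\<Sum>m\<in>?K. Poly_Mapping.single m (Poly_Mapping.lookup (P - Q) m))"
  have "mp_eval x R = 0" for x
  proof -
    define x' where "x' v = (if v \<in> C then 0 else x v)" for v
    have mon: "mon_eval x' m = (if Poly_Mapping.keys m \<inter> C = {} then mon_eval x m else 0)" for m
    proof (cases "Poly_Mapping.keys m \<inter> C = {}")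
      case True
      then show ?thesis unfolding mon_eval_def by (auto simp: x'_def intro!: prod.cong)
    next
      case False
      then show ?thesis unfolding mon_eval_def
        by (auto simp: x'_def in_keys_iff intro!: prod_zero)
    qed
    have "mp_eval x' (P - Q) = 0" using eq[of x'] by (simp add: mp_eval_diff x'_def)
    also have "mp_eval x' (P - Q) = (\<Sum>m\<in>Poly_Mapping.keys (P - Q).
        if Poly_Mapping.keys m \<inter> C = {} then Poly_Mapping.lookup (P - Q) m * mon_eval x m else 0)"
      unfolding mp_eval_def mon by (intro sum.cong) auto
    also have "\<dots> = mp_eval x R"
      unfolding R_def mp_eval_sum mp_eval_single by (rule sum.inter_filter[symmetric]) simp
    finally show ?thesis by simp
  qed
  then have "R = 0" by (simp add: mp_eq_iff_eval_eq)
  then have "Poly_Mapping.lookup R m = 0" by simp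
  moreover have "Poly_Mapping.lookup R m = (\<Sum>k\<in>?K. if k = m then Poly_Mapping.lookup (P - Q) k else 0)"
    by (simp add: R_def lookup_sum lookup_single when_def)
  ultimately have "Poly_Mapping.lookup (P - Q) m = 0" using m by (auto simp: sum.delta in_keys_iff split: if_splits)
  then show ?thesis by (simp add: lookup_minus)
qed

section \<open>Coordinates in dimension three and the base map\<close>

locale three_variables =
  fixes a b c :: "'n::finite"
  assumes neq: "a \<noteq> b" "a \<noteq> c" "b \<noteq> c" and UNIV_abc: "UNIV = {a, b, c}"
begin

lemmas neqs = neq neq[symmetric]

lemma all_abc: "(\<forall>v. P v) \<longleftrightarrow> P a \<and> P b \<and> P c"
  by (metis UNIV_I UNIV_abc empty_iff insert_iff)

lemma abc_cases: obtains "v = a" | "v = b" | "v = c"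
  using UNIV_abc by blast

definition mon3 :: "nat \<Rightarrow> nat \<Rightarrow> nat \<Rightarrow> 'n monom" where
  "mon3 i j k = Poly_Mapping.single a i + Poly_Mapping.single b j + Poly_Mapping.single c k"

lemma lookup_mon3 [simp]:
  "Poly_Mapping.lookup (mon3 i j k) a = i" "Poly_Mapping.lookup (mon3 i j k) b = j"
  "Poly_Mapping.lookup (mon3 i j k) c = k"
  using neqs by (auto simp: mon3_def lookup_add lookup_single when_def)

lemma monom_eq_iff: "m = m' \<longleftrightarrow> (\<forall>v \<in> {a, b, c}. Poly_Mapping.lookup m v = Poly_Mapping.lookup (m' :: 'n monom) v)"
  using UNIV_abc by (auto intro!: poly_mapping_eqI)

lemma mon3_eq_iff [simp]: "mon3 i j k = mon3 i' j' k' \<longleftrightarrow> i = i' \<and> j = j' \<and> k = k'"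
  by (auto simp: monom_eq_iff)

lemma mon3_exists: "\<exists>i j k. m = mon3 i j k"
  by (rule exI[of _ "Poly_Mapping.lookup m a"], rule exI[of _ "Poly_Mapping.lookup m b"],
      rule exI[of _ "Poly_Mapping.lookup m c"]) (simp add: monom_eq_iff)

lemma mon_degree_mon3 [simp]: "mon_degree (mon3 i j k) = i + j + k"
  by (simp add: mon3_def mon_degree_add)

lemma mon_eval_mon3 [simp]: "mon_eval x (mon3 i j k) = x a ^ i * x b ^ j * x c ^ k"
  by (simp add: mon3_def mon_eval_add)

lemma mon3_special: "mon3 0 0 0 = 0" "mon3 1 0 0 = Poly_Mapping.single a 1" "mon3 0 1 0 = Poly_Mapping.single b 1"
  "mon3 0 0 1 = Poly_Mapping.single c 1"
  by (simp_all add: mon3_def)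

lemma mon3_plus: "mon3 i j k + Poly_Mapping.single a 1 = mon3 (i + 1) j k"
  "mon3 i j k + Poly_Mapping.single b 1 = mon3 i (j + 1) k"
  "mon3 i j k + Poly_Mapping.single c 1 = mon3 i j (k + 1)"
  using neqs by (auto simp: monom_eq_iff lookup_add lookup_single when_def)

lemma mon3_minus: "mon3 i j k - mon3 i' j' k' = mon3 (i - i') (j - j') (k - k')"
  by (simp add: monom_eq_iff lookup_minus)

lemma lookup_Var_mon3:
  "Poly_Mapping.lookup (Var v :: ('n, complex) mpoly) (mon3 i j k) =
    (if mon3 i j k = Poly_Mapping.single v 1 then 1 else 0)"
  by (simp add: Var_def lookup_single when_def eq_commute)

text \<open>The bridge from polynomials to coefficient functions, which turns a vanishing polynomial
  into the equations of \<open>linearised_jacobian\<close>.\<close>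

lemma lookup_mon3_mult_pderiv:
  "Poly_Mapping.lookup (Poly_Mapping.single (mon3 p q r) t * mp_pderiv a P) (mon3 i j k) =
    t * Dx p q r (\<lambda>i j k. Poly_Mapping.lookup P (mon3 i j k)) i j k"
  "Poly_Mapping.lookup (Poly_Mapping.single (mon3 p q r) t * mp_pderiv b P) (mon3 i j k) =
    t * Dy p q r (\<lambda>i j k. Poly_Mapping.lookup P (mon3 i j k)) i j k"
  "Poly_Mapping.lookup (Poly_Mapping.single (mon3 p q r) t * mp_pderiv c P) (mon3 i j k) =
    t * Dz p q r (\<lambda>i j k. Poly_Mapping.lookup P (mon3 i j k)) i j k"
  by (simp_all only: lookup_single_mult lookup_mp_pderiv all_abc lookup_mon3 mon3_minus mon3_plus Dx_def Dy_def Dz_def)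
    simp_all

lemma det_abc: "det (A :: 'a::comm_ring_1 ^ 'n ^ 'n) =
    A$a$a * (A$b$b * A$c$c - A$b$c * A$c$b) - A$a$b * (A$b$a * A$c$c - A$b$c * A$c$a)
     + A$a$c * (A$b$a * A$c$b - A$b$b * A$c$a)"
  by (rule det_three_rows) (use neqs UNIV_abc in auto)

definition vec3 :: "'a \<Rightarrow> 'a \<Rightarrow> 'a \<Rightarrow> 'a ^ 'n" where
  "vec3 p q r = (\<chi> i. if i = a then p else if i = b then q else r)"

lemma vec3_nth [simp]: "vec3 p q r $ a = p" "vec3 p q r $ b = q" "vec3 p q r $ c = r"
  using neqs by (simp_all add: vec3_def)

lemma normalisedI:
  assumes deg: "deg_le d (F $ a)" "deg_le d (F $ b)" "deg_le d (F $ c)"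
    and jac: "\<And>x. mp_eval x (jacobian F) = 1"
    and zero: "mp_eval (\<lambda>_. 0) (F $ a) = 0" "mp_eval (\<lambda>_. 0) (F $ b) = 0" "mp_eval (\<lambda>_. 0) (F $ c) = 0"
    and lin: "\<And>v. mp_eval (\<lambda>_. 0) (mp_pderiv v (F $ a)) = (if v = a then 1 else 0)"
      "\<And>v. mp_eval (\<lambda>_. 0) (mp_pderiv v (F $ b)) = (if v = b then 1 else 0)"
      "\<And>v. mp_eval (\<lambda>_. 0) (mp_pderiv v (F $ c)) = (if v = c then 1 else 0)"
  shows "F \<in> normalised d"
proof -
  have "\<forall>i. deg_le d (F $ i)" "\<forall>i. mp_eval (\<lambda>_. 0) (F $ i) = 0"
    "\<forall>i v. mp_eval (\<lambda>_. 0) (mp_pderiv v (F $ i)) = (if i = v then 1 else 0)"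
    unfolding all_abc[of "\<lambda>i. deg_le d (F $ i)"] all_abc[of "\<lambda>i. mp_eval (\<lambda>_. 0) (F $ i) = 0"]
      all_abc[of "\<lambda>i. \<forall>v. mp_eval (\<lambda>_. 0) (mp_pderiv v (F $ i)) = (if i = v then 1 else 0)"]
    using deg zero lin by auto
  moreover have "jacobian F = 1" using jac by (simp add: mp_eq_iff_eval_eq)
  ultimately show ?thesis
    unfolding normalised_def X_var_def Omega_deg_le mem_Collect_eq
    by (simp add: lookup_zero_eval lookup_linear_eval del: One_nat_def)
qed

text \<open>
  A composition of three elementary mappings of degrees two and three; its tangent space is smaller
  than the number of parameters of the triangular mappings below.
\<close>

definition base_map :: "'n poly_map" where
  "base_map = (let x = Var a; y = Var b; z = Var c in
     vec3 (x + y ^ 3) (y + (z + x ^ 3) ^ 2) (z + x ^ 3 + (x + y ^ 3) ^ 2))"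

lemma base_map_partials:
  "mp_eval x (mp_pderiv a (base_map $ a)) = 1" "mp_eval x (mp_pderiv b (base_map $ a)) = 3 * x b ^ 2"
      "mp_eval x (mp_pderiv c (base_map $ a)) = 0"
      "mp_eval x (mp_pderiv a (base_map $ b)) = 6 * x a ^ 2 * (x c + x a ^ 3)"
      "mp_eval x (mp_pderiv b (base_map $ b)) = 1"
      "mp_eval x (mp_pderiv c (base_map $ b)) = 2 * (x c + x a ^ 3)"
      "mp_eval x (mp_pderiv a (base_map $ c)) = 3 * x a ^ 2 + 2 * (x a + x b ^ 3)"
      "mp_eval x (mp_pderiv b (base_map $ c)) = 6 * x b ^ 2 * (x a + x b ^ 3)"
      "mp_eval x (mp_pderiv c (base_map $ c)) = 1"
  by (simp_all only: base_map_def Let_def vec3_nth)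
    (simp_all add: neqs mp_pderiv_add mp_pderiv_power2 mp_pderiv_power3 mp_eval_simps algebra_simps)

lemma base_map_normalised: "base_map \<in> normalised 6"
proof (rule normalisedI)
  show "deg_le 6 (base_map $ a)" "deg_le 6 (base_map $ b)" "deg_le 6 (base_map $ c)"
  proof -
    have "deg_le (max 1 (3 * 1)) (Var a + Var b ^ 3 :: ('n, complex) mpoly)"
      "deg_le (max 1 (2 * max 1 (3 * 1))) (Var b + (Var c + Var a ^ 3) ^ 2 :: ('n, complex) mpoly)"
      "deg_le (max (max 1 (3 * 1)) (2 * max 1 (3 * 1))) (Var c + Var a ^ 3 + (Var a + Var b ^ 3) ^ 2 :: ('n, complex) mpoly)"
      by (intro deg_le_add_max deg_le_power deg_le_Var_1)+
    note deg = this
    have "deg_le 6 (Var a + Var b ^ 3 :: ('n, complex) mpoly)"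
      "deg_le 6 (Var b + (Var c + Var a ^ 3) ^ 2 :: ('n, complex) mpoly)"
      "deg_le 6 (Var c + Var a ^ 3 + (Var a + Var b ^ 3) ^ 2 :: ('n, complex) mpoly)"
      by (rule deg[THEN deg_le_mono], simp)+
    then show "deg_le 6 (base_map $ a)" "deg_le 6 (base_map $ b)" "deg_le 6 (base_map $ c)"
      unfolding base_map_def Let_def vec3_nth .
  qed
  show "mp_eval x (jacobian base_map) = 1" for x
  proof -
    show ?thesis unfolding mp_eval_jacobian det_abc by (simp only: vec_lambda_beta base_map_partials) algebra
  qed
next
  show "mp_eval (\<lambda>_. 0) (base_map $ a) = 0" "mp_eval (\<lambda>_. 0) (base_map $ b) = 0"
    "mp_eval (\<lambda>_. 0) (base_map $ c) = 0"
    unfolding base_map_def Let_def vec3_nth by (simp_all add: mp_eval_simps)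
next
  show "mp_eval (\<lambda>_. 0) (mp_pderiv v (base_map $ a)) = (if v = a then 1 else 0)"
    "mp_eval (\<lambda>_. 0) (mp_pderiv v (base_map $ b)) = (if v = b then 1 else 0)"
    "mp_eval (\<lambda>_. 0) (mp_pderiv v (base_map $ c)) = (if v = c then 1 else 0)" for v
    using UNIV_abc neqs by (cases v rule: abc_cases; simp add: base_map_partials)+
qed

text \<open>The 31 unknowns set to zero in \<open>linearised_jacobian_injective\<close>, with
  components \<open>a\<close>, \<open>b\<close>, \<open>c\<close> for \<open>u\<close>,
  \<open>v\<close>, \<open>w\<close>.\<close>

definition tangent_coordinates :: "('n \<times> 'n monom) set" where
  "tangent_coordinates = {(a, mon3 0 2 0), (a, mon3 0 2 1), (a, mon3 0 3 0), (a, mon3 0 6 0), (a, mon3 1 1 0),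
     (a, mon3 2 0 1), (a, mon3 2 1 0), (a, mon3 3 3 0), (a, mon3 6 0 0), (b, mon3 0 0 2),
     (b, mon3 0 3 0), (b, mon3 0 3 1), (b, mon3 0 4 0), (b, mon3 0 6 0), (b, mon3 1 0 1),
     (b, mon3 3 2 0), (b, mon3 3 2 1), (b, mon3 4 0 1), (b, mon3 4 1 0), (b, mon3 4 1 1),
     (b, mon3 4 2 0), (b, mon3 5 0 0), (b, mon3 5 1 0), (b, mon3 6 0 0), (c, mon3 0 0 2),
     (c, mon3 0 1 1), (c, mon3 0 3 1), (c, mon3 0 6 0), (c, mon3 1 4 1), (c, mon3 2 0 1),
     (c, mon3 6 0 0)}"

lemma base_map_low_coefficients:
  assumes "F \<in> normalised 6" "mon_degree m < 2"
  shows "Poly_Mapping.lookup (F $ i) m = Poly_Mapping.lookup (base_map $ i) m"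
proof -
  obtain p q r where m: "m = mon3 p q r" using mon3_exists by blast
  with assms(2) have "m \<in> {mon3 0 0 0, mon3 1 0 0, mon3 0 1 0, mon3 0 0 1}" by auto
  then have "m = 0 \<or> (\<exists>v. m = Poly_Mapping.single v 1)" unfolding mon3_special by blast
  then show ?thesis using assms(1) base_map_normalised by (auto simp: normalised_def)
qed

text \<open>Two kinds of ideal elements suffice: a coefficient of degree below two minus its
  constant value, and the Jacobian determinant at a point \<open>x\<close> minus 1. Differentiating
  the latter along \<open>base_map + t * G\<close>, where \<open>G\<close> has the coefficients of
  the tangent vector, shows that the linearised determinant vanishes at every
  \<open>x\<close>.\<close>

lemma base_map_tangent:
  fixes v :: "'n \<times> 'n monom \<Rightarrow> complex"
  assumes v: "\<forall>p\<in>vanishing_ideal 6 \<inter> coord_polys 6.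
    (\<Sum>j\<in>coord_index 6 - tangent_coordinates. mp_eval (coords base_map) (mp_pderiv j p) * v j) = 0"
  shows "\<forall>j\<in>coord_index 6 - tangent_coordinates. v j = 0"
proof -
  let ?W = "coord_index 6 :: ('n \<times> 'n monom) set"
  define v' where "v' j = (if j \<in> ?W - tangent_coordinates then v j else 0)" for j
  have rows: "(\<Sum>j\<in>?W. mp_eval (coords base_map) (mp_pderiv j p) * v' j) = 0"
    if "p \<in> vanishing_ideal 6" "p \<in> coord_polys 6" for p
  proof -
    have "(\<Sum>j\<in>?W. mp_eval (coords base_map) (mp_pderiv j p) * v' j) =
        (\<Sum>j\<in>?W - tangent_coordinates. mp_eval (coords base_map) (mp_pderiv j p) * v j)"
      by (rule sum.mono_neutral_cong_right[OF finite_coord_index]) (auto simp: v'_def)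
    then show ?thesis using v that by auto
  qed
  have low: "v' (i, m) = 0" if "mon_degree m < 2" for i m
  proof -
    have W: "(i, m) \<in> ?W" using that by (simp add: coord_index_def)
    define p where "p = Var (i, m) - Const (Poly_Mapping.lookup (base_map $ i) m)"
    have "mp_eval (coords F) p = 0" if "F \<in> normalised 6" for F
      using base_map_low_coefficients[OF that \<open>mon_degree m < 2\<close>]
      by (simp add: p_def mp_eval_diff coords_def)
    then have "p \<in> vanishing_ideal 6" by (simp add: vanishing_ideal_def)
    moreover have "p \<in> coord_polys 6"
    proof -
      have "Poly_Mapping.keys p \<subseteq> {Poly_Mapping.single (i, m) 1, 0}"
        unfolding p_def Var_def
        by (rule order_trans[OF keys_diff]) (simp add: keys_single split: if_split)
      then show ?thesis using W by (auto simp: coord_polys_def mp_vars_def)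
    qed
    ultimately have "(\<Sum>j\<in>?W. mp_eval (coords base_map) (mp_pderiv j p) * v' j) = 0" by (rule rows)
    moreover have "mp_eval (coords base_map) (mp_pderiv j p) * v' j = (if j = (i, m) then v' j else 0)" for j
      by (simp add: p_def mp_pderiv_diff mp_pderiv_Var)
    ultimately show ?thesis using W by (simp add: sum.delta[OF finite_coord_index])
  qed
  define G :: "'n poly_map" where
    "G = (\<chi> i. \<Sum>m | mon_degree m \<le> 6. Poly_Mapping.single m (v' (i, m)))"
  have lookup_G: "Poly_Mapping.lookup (G $ i) m = v' (i, m)" for i m
  proof -
    have "Poly_Mapping.lookup (G $ i) m = (\<Sum>k | mon_degree k \<le> 6. if k = m then v' (i, k) else 0)"
      by (simp add: G_def lookup_sum lookup_single when_def)
    then show ?thesis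
      by (simp add: sum.delta[OF finite_mon_degree_le] v'_def coord_index_def)
  qed
  define F where "F t = (\<chi> i. base_map $ i + Const t * G $ i)" for t
  have F_Omega: "F t \<in> Omega 6" for t
  proof -
    have "deg_le 6 (G $ i)" for i
      by (auto simp: deg_le_def in_keys_iff lookup_G v'_def coord_index_def split: if_splits)
    moreover have "deg_le 6 (base_map $ i)" for i
      using base_map_normalised by (auto simp: normalised_def X_var_def Omega_deg_le)
    ultimately show ?thesis
      unfolding Omega_deg_le F_def by (auto intro!: deg_le_add deg_le_mult[of 0, simplified])
  qed
  \<comment> \<open>The cofactors are expanded so that every summand is one monomial times one
    partial derivative and matches a summand of \<open>linearised_jacobian\<close>.\<close>
  define J1 where "J1 = Poly_Mapping.single (mon3 0 0 0) 1 * mp_pderiv a (G $ a) + Poly_Mapping.single (mon3 0 5 1) (- 12) * mp_pderiv a (G $ a)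
      + Poly_Mapping.single (mon3 1 2 1) (- 12) * mp_pderiv a (G $ a) + Poly_Mapping.single (mon3 3 5 0) (- 12) * mp_pderiv a (G $ a)
      + Poly_Mapping.single (mon3 4 2 0) (- 12) * mp_pderiv a (G $ a) + Poly_Mapping.single (mon3 0 3 1) 4 * mp_pderiv b (G $ a)
      + Poly_Mapping.single (mon3 1 0 1) 4 * mp_pderiv b (G $ a) + Poly_Mapping.single (mon3 3 3 0) 4 * mp_pderiv b (G $ a)
      + Poly_Mapping.single (mon3 4 0 0) 4 * mp_pderiv b (G $ a) + Poly_Mapping.single (mon3 0 3 0) (- 2) * mp_pderiv c (G $ a)
      + Poly_Mapping.single (mon3 1 0 0) (- 2) * mp_pderiv c (G $ a) + Poly_Mapping.single (mon3 2 0 0) (- 3) * mp_pderiv c (G $ a)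
      + Poly_Mapping.single (mon3 2 5 1) 36 * mp_pderiv c (G $ a) + Poly_Mapping.single (mon3 3 2 1) 36 * mp_pderiv c (G $ a)
      + Poly_Mapping.single (mon3 5 5 0) 36 * mp_pderiv c (G $ a) + Poly_Mapping.single (mon3 6 2 0) 36 * mp_pderiv c (G $ a)
      + Poly_Mapping.single (mon3 0 2 0) (- 3) * mp_pderiv a (G $ b) + Poly_Mapping.single (mon3 0 0 0) 1 * mp_pderiv b (G $ b)
      + Poly_Mapping.single (mon3 2 2 0) 9 * mp_pderiv c (G $ b) + Poly_Mapping.single (mon3 0 2 1) 6 * mp_pderiv a (G $ c)
      + Poly_Mapping.single (mon3 3 2 0) 6 * mp_pderiv a (G $ c) + Poly_Mapping.single (mon3 0 0 1) (- 2) * mp_pderiv b (G $ c)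
      + Poly_Mapping.single (mon3 3 0 0) (- 2) * mp_pderiv b (G $ c) + Poly_Mapping.single (mon3 0 0 0) 1 * mp_pderiv c (G $ c)
      + Poly_Mapping.single (mon3 2 2 1) (- 18) * mp_pderiv c (G $ c) + Poly_Mapping.single (mon3 5 2 0) (- 18) * mp_pderiv c (G $ c)"
  have "mp_eval x' J1 = 0" for x'
  proof -
    define x where "x = x'"
    \<comment> \<open>The Jacobian determinant at the fixed point \<open>x\<close>, as a polynomial
      in the coefficients of the mapping.\<close>
    obtain p where p: "p \<in> coord_polys 6" "\<forall>F\<in>Omega 6. mp_eval x (jacobian F) = mp_eval (coords (F :: 'n poly_map)) p"
      using regular_eval_jacobian[of 6 x] unfolding regular_def by (elim bexE)
    have "p - 1 \<in> vanishing_ideal 6"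
      using p(2) by (auto simp: vanishing_ideal_def normalised_def X_var_def mp_eval_diff)
    moreover have "p - 1 \<in> coord_polys 6"
    proof -
      have "Poly_Mapping.keys (p - 1) \<subseteq> insert 0 (Poly_Mapping.keys p)" using keys_diff[of p 1] by auto
      from UN_mono[OF this, of Poly_Mapping.keys Poly_Mapping.keys]
      show ?thesis using p(1) by (simp add: coord_polys_def mp_vars_def)
    qed
    ultimately have "(\<Sum>j\<in>?W. mp_eval (coords base_map) (mp_pderiv j (p - 1)) * v' j) = 0" by (rule rows)
    then have row: "(\<Sum>j\<in>?W. mp_eval (coords (F 0)) (mp_pderiv j p) * v' j) = 0"
      by (simp add: mp_pderiv_diff F_def)
    have "((\<lambda>t. mp_eval (coords (F t)) p) has_field_derivative
        (\<Sum>j\<in>?W. mp_eval (coords (F 0)) (mp_pderiv j p) * v' j)) (at 0)"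
    proof (rule mp_eval_chain_rule[OF _ finite_coord_index])
      show "mp_vars p \<subseteq> ?W" using p(1) by (simp add: coord_polys_def)
      fix j :: "'n \<times> 'n monom"
      obtain i m where j: "j = (i, m)" by (cases j)
      have "coords (F t) j = coords base_map j + t * v' j" for t
        by (simp add: j coords_def F_def lookup_add lookup_single_mult lookup_G)
      then show "((\<lambda>t. coords (F t) j) has_field_derivative v' j) (at 0)"
        by (auto intro!: derivative_eq_intros)
    qed
    then have der: "((\<lambda>t. mp_eval x (jacobian (F t))) has_field_derivative 0) (at 0)"
      using p(2) F_Omega by (simp add: row)
    define A where "A i j = mp_eval x (mp_pderiv j (base_map $ i))" for i j
    define B where "B i j = mp_eval x (mp_pderiv j (G $ i))" for i j
    have "mp_eval x (jacobian (F t)) =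
        (A a a + t * B a a) * ((A b b + t * B b b) * (A c c + t * B c c) - (A b c + t * B b c) * (A c b + t * B c b))
      - (A a b + t * B a b) * ((A b a + t * B b a) * (A c c + t * B c c) - (A b c + t * B b c) * (A c a + t * B c a))
      + (A a c + t * B a c) * ((A b a + t * B b a) * (A c b + t * B c b) - (A b b + t * B b b) * (A c a + t * B c a))" for t
      unfolding mp_eval_jacobian det_abc
      by (simp add: F_def A_def B_def mp_pderiv_add mp_pderiv_mult mp_eval_simps)
    \<comment> \<open>The derivative of the determinant at \<open>t = 0\<close>: entries of
      \<open>B\<close> times cofactors of \<open>A\<close>.\<close>
    moreover have "((\<lambda>t. (A a a + t * B a a) * ((A b b + t * B b b) * (A c c + t * B c c) - (A b c + t * B b c) * (A c b + t * B c b))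
      - (A a b + t * B a b) * ((A b a + t * B b a) * (A c c + t * B c c) - (A b c + t * B b c) * (A c a + t * B c a))
      + (A a c + t * B a c) * ((A b a + t * B b a) * (A c b + t * B c b) - (A b b + t * B b b) * (A c a + t * B c a)))
      has_field_derivative
        (B a a * (A b b * A c c - A b c * A c b) - B a b * (A b a * A c c - A b c * A c a) + B a c * (A b a * A c b - A b b * A c a)
        + B b a * (A a c * A c b - A a b * A c c) + B b b * (A a a * A c c - A a c * A c a) + B b c * (A a b * A c a - A a a * A c b)
        + B c a * (A a b * A b c - A a c * A b b) + B c b * (A a c * A b a - A a a * A b c) + B c c * (A a a * A b b - A a b * A b a))) (at 0)"
      by (auto intro!: derivative_eq_intros simp: algebra_simps)
    ultimately have "B a a * (A b b * A c c - A b c * A c b) - B a b * (A b a * A c c - A b c * A c a) + B a c * (A b a * A c b - A b b * A c a)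
        + B b a * (A a c * A c b - A a b * A c c) + B b b * (A a a * A c c - A a c * A c a) + B b c * (A a b * A c a - A a a * A c b)
        + B c a * (A a b * A b c - A a c * A b b) + B c b * (A a c * A b a - A a a * A b c) + B c c * (A a a * A b b - A a b * A b a) = 0"
      using DERIV_unique[OF _ der] by simp
    moreover have "A a a = 1" "A a b = 3 * x b ^ 2" "A a c = 0"
      "A b a = 6 * x a ^ 2 * (x c + x a ^ 3)" "A b b = 1" "A b c = 2 * (x c + x a ^ 3)"
      "A c a = 3 * x a ^ 2 + 2 * (x a + x b ^ 3)" "A c b = 6 * x b ^ 2 * (x a + x b ^ 3)" "A c c = 1"
      unfolding A_def by (simp_all only: base_map_partials)
    ultimately show ?thesis
      unfolding x_def[symmetric] J1_def mp_eval_add mp_eval_mult mp_eval_single mon_eval_mon3 B_def[symmetric]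
      by algebra
  qed
  then have "J1 = 0" by (simp add: mp_eq_iff_eval_eq)
  have lin: "linearised_jacobian (\<lambda>i j k. v' (a, mon3 i j k)) (\<lambda>i j k. v' (b, mon3 i j k))
      (\<lambda>i j k. v' (c, mon3 i j k)) i j k = 0" for i j k
  proof -
    have "Poly_Mapping.lookup J1 (mon3 i j k) = 0" by (simp add: \<open>J1 = 0\<close>)
    then show ?thesis
      unfolding J1_def lookup_add lookup_mon3_mult_pderiv lookup_G linearised_jacobian_def by simp
  qed
  have Re_D: "Re (Dx p q r g i j k) = Dx p q r (\<lambda>i j k. Re (g i j k)) i j k"
    "Re (Dy p q r g i j k) = Dy p q r (\<lambda>i j k. Re (g i j k)) i j k"
    "Re (Dz p q r g i j k) = Dz p q r (\<lambda>i j k. Re (g i j k)) i j k"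
    "Im (Dx p q r g i j k) = Dx p q r (\<lambda>i j k. Im (g i j k)) i j k"
    "Im (Dy p q r g i j k) = Dy p q r (\<lambda>i j k. Im (g i j k)) i j k"
    "Im (Dz p q r g i j k) = Dz p q r (\<lambda>i j k. Im (g i j k)) i j k"
    for p q r i j k and g :: "nat \<Rightarrow> nat \<Rightarrow> nat \<Rightarrow> complex"
    by (simp_all add: Dx_def Dy_def Dz_def)
  have high: "v' (i, m) = 0" if "6 < mon_degree m" for i m
    using that by (simp add: v'_def coord_index_def)
  have J_zero: "v' j = 0" if "j \<in> tangent_coordinates" for j using that by (simp add: v'_def)
  have deg: "v' (l, mon3 i j k) = 0" if "i + j + k < 2 \<or> 6 < i + j + k" for l i j k
    using that low[of "mon3 i j k" l] high[of "mon3 i j k" l] by auto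
  \<comment> \<open>The system has integer coefficients, so the real elimination applies to real and
    imaginary parts separately; \<open>\<phi>\<close> will be \<open>Re\<close> or
    \<open>Im\<close>.\<close>
  have functional: "\<phi> (v' (a, mon3 i j k)) = 0 \<and> \<phi> (v' (b, mon3 i j k)) = 0 \<and> \<phi> (v' (c, mon3 i j k)) = 0"
    if \<phi>: "\<And>i j k. linearised_jacobian (\<lambda>i j k. \<phi> (v' (a, mon3 i j k))) (\<lambda>i j k. \<phi> (v' (b, mon3 i j k)))
        (\<lambda>i j k. \<phi> (v' (c, mon3 i j k))) i j k = 0" "\<phi> 0 = 0" for \<phi> :: "complex \<Rightarrow> real" and i j k
  proof -
    note inj = linearised_jacobian_injective[where u = "\<lambda>i j k. \<phi> (v' (a, mon3 i j k))" and
        v = "\<lambda>i j k. \<phi> (v' (b, mon3 i j k))" and w = "\<lambda>i j k. \<phi> (v' (c, mon3 i j k))", OF \<phi>(1)]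
    show ?thesis
      by (intro conjI; rule inj; simp add: deg J_zero tangent_coordinates_def \<phi>(2))
  qed
  have "Re (v' (a, mon3 i j k)) = 0 \<and> Re (v' (b, mon3 i j k)) = 0 \<and> Re (v' (c, mon3 i j k)) = 0"
    "Im (v' (a, mon3 i j k)) = 0 \<and> Im (v' (b, mon3 i j k)) = 0 \<and> Im (v' (c, mon3 i j k)) = 0" for i j k
  proof -
    have "linearised_jacobian (\<lambda>i j k. Re (v' (a, mon3 i j k))) (\<lambda>i j k. Re (v' (b, mon3 i j k)))
        (\<lambda>i j k. Re (v' (c, mon3 i j k))) i j k = 0" for i j k
      using arg_cong[OF lin[of i j k], of Re] by (simp add: linearised_jacobian_def Re_D)
    then show "Re (v' (a, mon3 i j k)) = 0 \<and> Re (v' (b, mon3 i j k)) = 0 \<and> Re (v' (c, mon3 i j k)) = 0"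
      by (rule functional) simp
    have "linearised_jacobian (\<lambda>i j k. Im (v' (a, mon3 i j k))) (\<lambda>i j k. Im (v' (b, mon3 i j k)))
        (\<lambda>i j k. Im (v' (c, mon3 i j k))) i j k = 0" for i j k
      using arg_cong[OF lin[of i j k], of Im] by (simp add: linearised_jacobian_def Re_D)
    then show "Im (v' (a, mon3 i j k)) = 0 \<and> Im (v' (b, mon3 i j k)) = 0 \<and> Im (v' (c, mon3 i j k)) = 0"
      by (rule functional) simp
  qed
  note parts = this
  have "v' (i, m) = 0" for i m
  proof -
    obtain p q r where m: "m = mon3 p q r" using mon3_exists by blast
    have "i \<in> {a, b, c}" using UNIV_abc by blast
    then show ?thesis using parts[of p q r] by (auto simp: m complex_eq_iff)
  qed
  then have "v' j = 0" for j by (cases j) simp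
  then show ?thesis unfolding v'_def by (metis (full_types))
qed

end

section \<open>A family of triangular mappings with 33 parameters\<close>

context three_variables
begin

text \<open>All 25 pairs with \<open>2 \<le> i + j \<le> 6\<close>, listed so that sums and filters
  over them can be evaluated.\<close>

definition exponents :: "(nat \<times> nat) set" where
  "exponents = {(0,2), (0,3), (0,4), (0,5), (0,6), (1,1), (1,2), (1,3), (1,4), (1,5),
    (2,0), (2,1), (2,2), (2,3), (2,4), (3,0), (3,1), (3,2), (3,3), (4,0), (4,1), (4,2), (5,0), (5,1), (6,0)}"

lemma exponents_bounds: "(i, j) \<in> exponents \<Longrightarrow> 2 \<le> i + j \<and> i + j \<le> 6"
  unfolding exponents_def by auto

lemma finite_exponents [simp]: "finite exponents"
  by (simp add: exponents_def)

text \<open>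
  The nonlinear part is \<open>A (-p, 1, 0) + B (-q, -r, 1)\<close>, where \<open>A\<close> depends on a linear form that
  annihilates both vectors and \<open>B\<close> on two linear forms that annihilate the second one. Hence the
  Jacobian matrix is unipotent.
\<close>

definition triangular_map :: "(nat \<Rightarrow> nat \<Rightarrow> complex) \<Rightarrow> (nat \<Rightarrow> complex) \<Rightarrow> complex \<Rightarrow> complex \<Rightarrow> complex \<Rightarrow> 'n poly_map" where
  "triangular_map \<beta> \<alpha> p q r =
    (let x = Var a; y = Var b; z = Var c;
       A = \<Sum>k\<in>{2..6}. Const (\<alpha> k) * (x + Const p * y + Const (q + p * r) * z) ^ k;
       B = \<Sum>(i, j)\<in>exponents. Const (\<beta> i j) * (x + Const q * z) ^ i * (y + Const r * z) ^ j
     in vec3 (x - Const p * A - Const q * B) (y + A - Const r * B) (z + B))"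

context
  fixes \<beta> :: "nat \<Rightarrow> nat \<Rightarrow> complex" and \<alpha> :: "nat \<Rightarrow> complex" and p q r :: complex
begin

definition "formA = (Var a + Const p * Var b + Const (q + p * r) * Var c :: ('n, complex) mpoly)"
definition "formU = (Var a + Const q * Var c :: ('n, complex) mpoly)"
definition "formV = (Var b + Const r * Var c :: ('n, complex) mpoly)"
definition "partA = (\<Sum>k\<in>{2..6}. Const (\<alpha> k) * formA ^ k)"
definition "partB = (\<Sum>(i, j)\<in>exponents. Const (\<beta> i j) * formU ^ i * formV ^ j)"

lemmas parts = formA_def formU_def formV_def partA_def partB_def

lemma triangular_map_eq:
  "triangular_map \<beta> \<alpha> p q r = vec3 (Var a - Const p * partA - Const q * partB) (Var b + partA - Const r * partB) (Var c + partB)"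
  by (simp only: triangular_map_def Let_def parts)

lemma form_evals:
  "mp_eval x formA = x a + p * x b + (q + p * r) * x c"
  "mp_eval x formU = x a + q * x c" "mp_eval x formV = x b + r * x c"
  by (simp_all add: parts mp_eval_simps)

lemma form_partials:
  "mp_eval x (mp_pderiv a formA) = 1" "mp_eval x (mp_pderiv b formA) = p" "mp_eval x (mp_pderiv c formA) = q + p * r"
  "mp_eval x (mp_pderiv a formU) = 1" "mp_eval x (mp_pderiv b formU) = 0" "mp_eval x (mp_pderiv c formU) = q"
  "mp_eval x (mp_pderiv a formV) = 0" "mp_eval x (mp_pderiv b formV) = 1" "mp_eval x (mp_pderiv c formV) = r"
  by (simp_all add: parts neqs mp_pderiv_add mp_pderiv_mult mp_eval_simps)

text \<open>\<open>dA\<close> is the derivative of \<open>partA\<close> by its form,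
  \<open>dU\<close> and \<open>dV\<close> are those of \<open>partB\<close> by its two forms. An
  exponent truncated at zero comes with the factor 0.\<close>

definition "dA x = (\<Sum>k\<in>{2..6}. \<alpha> k * of_nat k * mp_eval x formA ^ (k - 1))"
definition "dU x = (\<Sum>(i, j)\<in>exponents. \<beta> i j * of_nat i * mp_eval x formU ^ (i - 1) * mp_eval x formV ^ j)"
definition "dV x = (\<Sum>(i, j)\<in>exponents. \<beta> i j * of_nat j * mp_eval x formU ^ i * mp_eval x formV ^ (j - 1))"

lemma partA_partial: "mp_eval x (mp_pderiv v partA) = dA x * mp_eval x (mp_pderiv v formA)"
  by (simp add: partA_def dA_def mp_pderiv_sum mp_pderiv_mult mp_pderiv_power_nat mp_eval_simps
      sum_distrib_right mult.assoc)

lemma partB_partial: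
  "mp_eval x (mp_pderiv v partB) = dU x * mp_eval x (mp_pderiv v formU) + dV x * mp_eval x (mp_pderiv v formV)"
proof -
  have "mp_eval x (mp_pderiv v partB) = (\<Sum>(i, j)\<in>exponents.
      \<beta> i j * of_nat i * mp_eval x formU ^ (i - 1) * mp_eval x formV ^ j * mp_eval x (mp_pderiv v formU)
      + \<beta> i j * of_nat j * mp_eval x formU ^ i * mp_eval x formV ^ (j - 1) * mp_eval x (mp_pderiv v formV))"
    unfolding partB_def mp_pderiv_sum mp_eval_sum
    by (intro sum.cong refl) (auto simp: mp_pderiv_mult mp_pderiv_power_nat mp_eval_simps algebra_simps)
  then show ?thesis by (simp only: dU_def dV_def sum.distrib sum_distrib_right case_prod_unfold)
qed

lemma partials_at_zero: "dA (\<lambda>_. 0) = 0" "dU (\<lambda>_. 0) = 0" "dV (\<lambda>_. 0) = 0"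
  unfolding dA_def dU_def dV_def
  by (auto simp: form_evals power_0_left dest!: exponents_bounds intro!: sum.neutral)

lemma parts_at_zero: "mp_eval (\<lambda>_. 0) partA = 0" "mp_eval (\<lambda>_. 0) partB = 0"
  unfolding partA_def partB_def mp_eval_sum
  by (auto simp: form_evals mp_eval_simps power_0_left dest!: exponents_bounds intro!: sum.neutral)

lemma deg_le_parts: "deg_le 6 partA" "deg_le 6 partB"
proof -
  have C: "deg_le 1 (Const t * Var v :: ('n, complex) mpoly)" for t v
    using deg_le_mult[of 0 "Const t" 1 "Var v"] by (simp add: deg_le_Var_1 del: One_nat_def)
  have forms: "deg_le 1 formA" "deg_le 1 formU" "deg_le 1 formV"
    unfolding parts by (intro deg_le_add deg_le_Var_1 C)+
  show "deg_le 6 partA" unfolding partA_def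
  proof (rule deg_le_sum)
    fix k :: nat assume "k \<in> {2..6}"
    then show "deg_le 6 (Const (\<alpha> k) * formA ^ k)"
      using deg_le_mult[OF deg_le_Const deg_le_power[OF forms(1), of k], of 0 "\<alpha> k"]
      by (auto intro: deg_le_mono)
  qed
  show "deg_le 6 partB" unfolding partB_def case_prod_unfold
  proof (rule deg_le_sum)
    fix k assume k: "k \<in> exponents"
    have "deg_le (0 + fst k * 1 + snd k * 1) (Const (\<beta> (fst k) (snd k)) * formU ^ fst k * formV ^ snd k)"
      by (intro deg_le_mult deg_le_Const deg_le_power forms)
    then show "deg_le 6 (Const (\<beta> (fst k) (snd k)) * formU ^ fst k * formV ^ snd k)"
      by (rule deg_le_mono) (use exponents_bounds[of "fst k" "snd k"] k in auto)
  qed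
qed

lemma triangular_map_partials:
  "mp_eval x (mp_pderiv v (triangular_map \<beta> \<alpha> p q r $ a)) = (if v = a then 1 else 0)
     - p * mp_eval x (mp_pderiv v partA) - q * mp_eval x (mp_pderiv v partB)"
  "mp_eval x (mp_pderiv v (triangular_map \<beta> \<alpha> p q r $ b)) = (if v = b then 1 else 0)
     + mp_eval x (mp_pderiv v partA) - r * mp_eval x (mp_pderiv v partB)"
  "mp_eval x (mp_pderiv v (triangular_map \<beta> \<alpha> p q r $ c)) = (if v = c then 1 else 0)
     + mp_eval x (mp_pderiv v partB)"
  by (auto simp: triangular_map_eq mp_pderiv_add mp_pderiv_diff mp_pderiv_mult mp_pderiv_Var mp_eval_simps)

lemma triangular_map_normalised: "triangular_map \<beta> \<alpha> p q r \<in> normalised 6"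
proof (rule normalisedI)
  let ?F = "triangular_map \<beta> \<alpha> p q r"
  have V: "deg_le 6 (Var v :: ('n, complex) mpoly)" for v using deg_le_Var[of 5 v] by simp
  have C: "deg_le 6 (Const t * P)" if "deg_le 6 P" for t and P :: "('n, complex) mpoly"
    using deg_le_mult[of 0 "Const t" 6 P] that by simp
  show "deg_le 6 (?F $ a)" "deg_le 6 (?F $ b)" "deg_le 6 (?F $ c)"
    unfolding triangular_map_eq vec3_nth by (intro deg_le_add deg_le_diff V C deg_le_parts)+
  show "mp_eval x (jacobian ?F) = 1" for x
    unfolding mp_eval_jacobian det_abc vec_lambda_beta triangular_map_partials partA_partial partB_partial form_partials
    by (simp only: neqs simp_thms if_True if_False) algebra
  show "mp_eval (\<lambda>_. 0) (?F $ a) = 0" "mp_eval (\<lambda>_. 0) (?F $ b) = 0" "mp_eval (\<lambda>_. 0) (?F $ c) = 0"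
    unfolding triangular_map_eq vec3_nth by (simp_all add: mp_eval_simps parts_at_zero)
  show "mp_eval (\<lambda>_. 0) (mp_pderiv v (?F $ a)) = (if v = a then 1 else 0)"
    "mp_eval (\<lambda>_. 0) (mp_pderiv v (?F $ b)) = (if v = b then 1 else 0)"
    "mp_eval (\<lambda>_. 0) (mp_pderiv v (?F $ c)) = (if v = c then 1 else 0)" for v
    by (simp_all add: triangular_map_partials partA_partial partB_partial partials_at_zero)
qed

lemma keys_mon3_disjoint: "Poly_Mapping.keys (mon3 i j 0) \<inter> {c} = {}" "Poly_Mapping.keys (mon3 i 0 0) \<inter> {b, c} = {}"
  by (auto simp: in_keys_iff)

lemma lookup_sum_mon3:
  "Poly_Mapping.lookup (\<Sum>s\<in>T. Poly_Mapping.single (mon3 (f s) (g s) (h s)) (t s)) (mon3 i j k) =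
    (\<Sum>s\<in>T. if f s = i \<and> g s = j \<and> h s = k then t s else (0::complex))"
  by (simp add: lookup_sum lookup_single when_def)

text \<open>On \<open>z = 0\<close> the forms \<open>formU\<close> and \<open>formV\<close> are the
  variables \<open>x\<close> and \<open>y\<close>, so \<open>\<beta>\<close> appears
  unchanged.\<close>

lemma triangular_map_coeff_c:
  assumes "(i, j) \<in> exponents"
  shows "Poly_Mapping.lookup (triangular_map \<beta> \<alpha> p q r $ c) (mon3 i j 0) = \<beta> i j"
proof -
  have "Poly_Mapping.lookup (triangular_map \<beta> \<alpha> p q r $ c) (mon3 i j 0) =
      Poly_Mapping.lookup (\<Sum>s\<in>exponents. Poly_Mapping.single (mon3 (fst s) (snd s) 0) (\<beta> (fst s) (snd s))) (mon3 i j 0)"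
  proof (rule lookup_eq_if_eval_eq_on_subspace[OF _ keys_mon3_disjoint(1)])
    fix x :: "'n \<Rightarrow> complex" assume "\<forall>v\<in>{c}. x v = 0"
    then show "mp_eval x (triangular_map \<beta> \<alpha> p q r $ c) = mp_eval x
        (\<Sum>s\<in>exponents. Poly_Mapping.single (mon3 (fst s) (snd s) 0) (\<beta> (fst s) (snd s)))"
      by (simp add: triangular_map_eq partB_def form_evals mp_eval_simps mp_eval_single case_prod_unfold mult.assoc)
  qed
  also have "\<dots> = (\<Sum>s\<in>exponents. if s = (i, j) then \<beta> (fst s) (snd s) else 0)"
    unfolding lookup_sum_mon3 by (intro sum.cong refl) (auto simp: prod_eq_iff)
  also have "\<dots> = \<beta> i j" using assms by (simp add: sum.delta)
  finally show ?thesis .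
qed

text \<open>The terms linear in \<open>z\<close> are seen in the derivative by \<open>z\<close> on
  \<open>z = 0\<close>, where \<open>q\<close> and \<open>r\<close> enter linearly. The two
  coefficients chosen give two linear equations for \<open>q\<close> and \<open>r\<close>.\<close>

lemma triangular_map_coeff_c_pderiv:
  "Poly_Mapping.lookup (triangular_map \<beta> \<alpha> p q r $ c) (mon3 5 0 1) = 6 * \<beta> 6 0 * q + \<beta> 5 1 * r"
  "Poly_Mapping.lookup (triangular_map \<beta> \<alpha> p q r $ c) (mon3 0 5 1) = \<beta> 1 5 * q + 6 * \<beta> 0 6 * r"
proof -
  let ?F = "triangular_map \<beta> \<alpha> p q r $ c"
  define Q where "Q = (\<Sum>s\<in>exponents. Poly_Mapping.single (mon3 (fst s - 1) (snd s) 0) (q * (\<beta> (fst s) (snd s) * of_nat (fst s))))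
      + (\<Sum>s\<in>exponents. Poly_Mapping.single (mon3 (fst s) (snd s - 1) 0) (r * (\<beta> (fst s) (snd s) * of_nat (snd s))))
      + (1 :: ('n, complex) mpoly)"
  have lookup: "Poly_Mapping.lookup ?F (mon3 i j 1) = Poly_Mapping.lookup Q (mon3 i j 0)" for i j
  proof -
    have "Poly_Mapping.lookup ?F (mon3 i j 1) = Poly_Mapping.lookup (mp_pderiv c ?F) (mon3 i j 0)"
      unfolding lookup_mp_pderiv mon3_plus by simp
    also have "\<dots> = Poly_Mapping.lookup Q (mon3 i j 0)"
    proof (rule lookup_eq_if_eval_eq_on_subspace[OF _ keys_mon3_disjoint(1)])
      fix x :: "'n \<Rightarrow> complex" assume "\<forall>v\<in>{c}. x v = 0"
      then show "mp_eval x (mp_pderiv c ?F) = mp_eval x Q"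
        by (simp add: triangular_map_partials partB_partial form_partials dU_def dV_def form_evals Q_def mp_eval_add
            mp_eval_sum mp_eval_single case_prod_unfold sum_distrib_left sum_distrib_right mult_ac)
    qed
    finally show ?thesis .
  qed
  have nz: "mon3 5 0 0 \<noteq> 0" "mon3 0 5 0 \<noteq> 0" unfolding mon3_special(1)[symmetric] by simp_all
  have one: "Poly_Mapping.lookup (1 :: ('n, complex) mpoly) (mon3 5 0 0) = 0"
    "Poly_Mapping.lookup (1 :: ('n, complex) mpoly) (mon3 0 5 0) = 0"
    using nz by (simp_all add: lookup_one when_def)
  have sum: "(\<Sum>s\<in>exponents. if f s then t s else 0) = (\<Sum>s\<in>{s \<in> exponents. f s}. t s)"
    for f and t :: "nat \<times> nat \<Rightarrow> complex"
    by (simp add: sum.inter_filter)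
  \<comment> \<open>Truncated subtraction also admits \<open>(5, 0)\<close> and
    \<open>(0, 5)\<close>, whose terms carry the factor 0.\<close>
  have filters: "{s \<in> exponents. fst s - 1 = 5 \<and> snd s = 0 \<and> (0::nat) = 0} = {(6, 0)}"
    "{s \<in> exponents. fst s = 5 \<and> snd s - 1 = 0 \<and> (0::nat) = 0} = {(5, 0), (5, 1)}"
    "{s \<in> exponents. fst s - 1 = 0 \<and> snd s = 5 \<and> (0::nat) = 0} = {(0, 5), (1, 5)}"
    "{s \<in> exponents. fst s = 0 \<and> snd s - 1 = 5 \<and> (0::nat) = 0} = {(0, 6)}"
    by (auto simp: exponents_def)
  show "Poly_Mapping.lookup ?F (mon3 5 0 1) = 6 * \<beta> 6 0 * q + \<beta> 5 1 * r"
    "Poly_Mapping.lookup ?F (mon3 0 5 1) = \<beta> 1 5 * q + 6 * \<beta> 0 6 * r"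
    unfolding lookup unfolding Q_def lookup_add lookup_sum_mon3 one sum filters by simp_all
qed

text \<open>On the line \<open>y = z = 0\<close> the forms \<open>formA\<close> and
  \<open>formU\<close> become \<open>x\<close> and \<open>formV\<close> becomes 0, so only
  \<open>\<alpha> k\<close> and \<open>\<beta> k 0\<close> remain.\<close>

lemma triangular_map_coeff_power:
  assumes "k \<in> {2..6}"
  shows "Poly_Mapping.lookup (triangular_map \<beta> \<alpha> p q r $ a) (mon3 k 0 0) = - p * \<alpha> k - q * \<beta> k 0"
    "Poly_Mapping.lookup (triangular_map \<beta> \<alpha> p q r $ b) (mon3 k 0 0) = \<alpha> k - r * \<beta> k 0"
proof -
  let ?Q = "\<lambda>f. \<Sum>k\<in>{2..6}. Poly_Mapping.single (mon3 k 0 0) (f k) :: ('n, complex) mpoly"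
  have B: "mp_eval x partB = (\<Sum>k\<in>{2..6}. \<beta> k 0 * x a ^ k)" if "\<forall>v\<in>{b, c}. x v = 0" for x
  proof -
    have "mp_eval x partB = (\<Sum>(i, j)\<in>exponents. \<beta> i j * x a ^ i * 0 ^ j)"
      using that by (simp add: partB_def form_evals mp_eval_simps case_prod_unfold)
    also have "\<dots> = (\<Sum>k\<in>{2, 3, 4, 5, 6}. \<beta> k 0 * x a ^ k)"
      by (simp add: exponents_def)
    also have "{2, 3, 4, 5, 6} = {2..6::nat}" by auto
    finally show ?thesis .
  qed
  have A: "mp_eval x partA = (\<Sum>k\<in>{2..6}. \<alpha> k * x a ^ k)" if "\<forall>v\<in>{b, c}. x v = 0" for x
    using that by (simp add: partA_def form_evals mp_eval_simps)
  have Q: "mp_eval x (?Q f) = (\<Sum>k\<in>{2..6}. f k * x a ^ k)" for x f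
    by (simp add: mp_eval_sum mp_eval_single)
  have lookup_Q: "Poly_Mapping.lookup (?Q f) (mon3 k 0 0) = f k" for f
    unfolding lookup_sum_mon3[of "\<lambda>k. k" "\<lambda>_. 0" "\<lambda>_. 0"] using assms by (simp add: sum.delta)
  have "Poly_Mapping.lookup (triangular_map \<beta> \<alpha> p q r $ a - Var a) (mon3 k 0 0) =
      Poly_Mapping.lookup (?Q (\<lambda>k. - p * \<alpha> k - q * \<beta> k 0)) (mon3 k 0 0)"
    by (rule lookup_eq_if_eval_eq_on_subspace[OF _ keys_mon3_disjoint(2)])
      (simp add: triangular_map_eq mp_eval_diff mp_eval_uminus mp_eval_mult A B Q sum_distrib_left left_diff_distrib
        sum_subtractf sum_negf mult.assoc)
  moreover have "Poly_Mapping.lookup (triangular_map \<beta> \<alpha> p q r $ b) (mon3 k 0 0) =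
      Poly_Mapping.lookup (?Q (\<lambda>k. \<alpha> k - r * \<beta> k 0)) (mon3 k 0 0)"
    by (rule lookup_eq_if_eval_eq_on_subspace[OF _ keys_mon3_disjoint(2)])
      (simp add: triangular_map_eq mp_eval_diff mp_eval_add mp_eval_mult A B Q sum_distrib_left left_diff_distrib
        sum_subtractf mult.assoc)
  moreover have "Poly_Mapping.lookup (Var a :: ('n, complex) mpoly) (mon3 k 0 0) = 0"
    using assms by (simp add: lookup_Var_mon3 mon3_special(2)[symmetric] del: One_nat_def)
  ultimately show "Poly_Mapping.lookup (triangular_map \<beta> \<alpha> p q r $ a) (mon3 k 0 0) = - p * \<alpha> k - q * \<beta> k 0"
    "Poly_Mapping.lookup (triangular_map \<beta> \<alpha> p q r $ b) (mon3 k 0 0) = \<alpha> k - r * \<beta> k 0"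
    unfolding lookup_Q by (simp_all add: lookup_minus)
qed

end

section \<open>Algebraic independence and reducibility\<close>

definition free_coordinates :: "('n \<times> 'n monom) set" where
  "free_coordinates = (\<lambda>(i, j). (c, mon3 i j 0)) ` exponents \<union> {(c, mon3 5 0 1), (c, mon3 0 5 1)}
     \<union> (\<lambda>k. (b, mon3 k 0 0)) ` {2..6} \<union> {(a, mon3 6 0 0)}"

lemma card_free_coordinates: "card free_coordinates = 33"
proof -
  have "{2..6::nat} = {2, 3, 4, 5, 6}" by auto
  then show ?thesis using neqs
    by (simp add: free_coordinates_def exponents_def del: One_nat_def)
qed

lemma free_coordinates_subset: "free_coordinates \<subseteq> coord_index 6"
  by (auto simp: free_coordinates_def coord_index_def dest: exponents_bounds)

text \<open>For generic prescribed values of the 33 coordinates one can solve for the parameters: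
  \<open>\<beta>\<close> is read off, a linear system gives \<open>q\<close> and \<open>r\<close>,
  then \<open>\<alpha>\<close> follows, and finally \<open>p\<close>. So a relation \<open>P\<close>
  would vanish at a point chosen outside its zeros.\<close>

lemma free_coordinates_independent:
  assumes P: "P \<in> vanishing_ideal 6" "mp_vars P \<subseteq> free_coordinates"
  shows "P = 0"
proof (rule ccontr)
  assume "P \<noteq> 0"
  let ?C = "\<lambda>i j k. Var (c, mon3 i j k) :: ('n \<times> 'n monom, complex) mpoly"
  \<comment> \<open>The determinant of the linear system for \<open>q\<close> and \<open>r\<close>;
    \<open>E\<close> is \<open>\<Delta>\<close> times the future \<open>\<alpha> 6\<close>, cleared
    of denominators. Nonvanishing of both justifies the divisions below.\<close>
  define \<Delta> where "\<Delta> = 36 * ?C 6 0 0 * ?C 0 6 0 - ?C 5 1 0 * ?C 1 5 0"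
  define E where "E = \<Delta> * Var (b, mon3 6 0 0) + (6 * ?C 6 0 0 * ?C 0 5 1 - ?C 1 5 0 * ?C 5 0 1) * ?C 6 0 0"
  \<comment> \<open>A sample point at which both polynomials take the value 36, so that neither is
    zero.\<close>
  define s0 where "s0 v = (if v \<in> {(c, mon3 6 0 0), (c, mon3 0 6 0), (b, mon3 6 0 0)} then 1 else 0 :: complex)" for v
  have "mp_eval s0 \<Delta> = 36" "mp_eval s0 E = 36"
    using neqs by (simp_all add: \<Delta>_def E_def s0_def mp_eval_simps)
  then have "\<Delta> \<noteq> 0" "E \<noteq> 0" by auto
  with \<open>P \<noteq> 0\<close> obtain s where s: "\<And>p. p \<in> {P, \<Delta>, E} \<Longrightarrow> mp_eval s p \<noteq> 0"
    using common_nonvanishing_point[of "{P, \<Delta>, E}"] by auto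
  define \<beta> where "\<beta> i j = s (c, mon3 i j 0)" for i j
  define D where "D = 36 * \<beta> 6 0 * \<beta> 0 6 - \<beta> 5 1 * \<beta> 1 5"
  \<comment> \<open>Cramer's rule for \<open>q\<close> and \<open>r\<close>.\<close>
  define q where "q = (6 * \<beta> 0 6 * s (c, mon3 5 0 1) - \<beta> 5 1 * s (c, mon3 0 5 1)) / D"
  define r where "r = (6 * \<beta> 6 0 * s (c, mon3 0 5 1) - \<beta> 1 5 * s (c, mon3 5 0 1)) / D"
  define \<alpha> where "\<alpha> k = s (b, mon3 k 0 0) + r * \<beta> k 0" for k
  define p where "p = - (s (a, mon3 6 0 0) + q * \<beta> 6 0) / \<alpha> 6"
  have D: "D \<noteq> 0" using s[of \<Delta>] by (simp add: \<Delta>_def D_def \<beta>_def mp_eval_simps)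
  have "mp_eval s E = D * \<alpha> 6"
    using D by (simp add: E_def \<Delta>_def D_def[symmetric] \<alpha>_def r_def \<beta>_def mp_eval_simps field_simps)
      (simp add: D_def \<beta>_def algebra_simps)
  with s[of E] have \<alpha>6: "\<alpha> 6 \<noteq> 0" by auto
  have q: "6 * \<beta> 6 0 * q + \<beta> 5 1 * r = s (c, mon3 5 0 1)"
  proof -
    have "D * (6 * \<beta> 6 0 * q + \<beta> 5 1 * r) = D * s (c, mon3 5 0 1)"
      using D by (simp add: q_def r_def distrib_left) (simp add: D_def algebra_simps)
    with D show ?thesis by simp
  qed
  have r: "\<beta> 1 5 * q + 6 * \<beta> 0 6 * r = s (c, mon3 0 5 1)"
  proof -
    have "D * (\<beta> 1 5 * q + 6 * \<beta> 0 6 * r) = D * s (c, mon3 0 5 1)"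
      using D by (simp add: q_def r_def distrib_left) (simp add: D_def algebra_simps)
    with D show ?thesis by simp
  qed
  let ?F = "triangular_map \<beta> \<alpha> p q r"
  have "coords ?F v = s v" if "v \<in> free_coordinates" for v
    using that unfolding free_coordinates_def
  proof (elim UnE)
    assume "v \<in> (\<lambda>(i, j). (c, mon3 i j 0)) ` exponents"
    then show ?thesis by (auto simp: coords_def triangular_map_coeff_c \<beta>_def)
  next
    assume "v \<in> {(c, mon3 5 0 1), (c, mon3 0 5 1)}"
    then show ?thesis by (auto simp: coords_def triangular_map_coeff_c_pderiv q r simp del: One_nat_def)
  next
    assume "v \<in> (\<lambda>k. (b, mon3 k 0 0)) ` {2..6}"
    then show ?thesis by (auto simp: coords_def triangular_map_coeff_power(2) \<alpha>_def)
  next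
    assume "v \<in> {(a, mon3 6 0 0)}"
    then show ?thesis using \<alpha>6 by (simp add: coords_def triangular_map_coeff_power(1) p_def)
  qed
  then have "mp_eval (coords ?F) P = mp_eval s P"
    using P(2) by (intro mp_eval_cong_vars) auto
  moreover have "mp_eval (coords ?F) P = 0"
    using P(1) triangular_map_normalised by (simp add: vanishing_ideal_def)
  ultimately show False using s[of P] by simp
qed

lemma degree_six_reducible: "\<not> irreducible_space (X_zariski 6 :: 'n poly_map topology)"
proof (rule reducible_by_tangent_space[OF base_map_normalised free_coordinates_subset
      free_coordinates_independent _ _ base_map_tangent])
  show "finite tangent_coordinates" by (simp add: tangent_coordinates_def)
  have "card tangent_coordinates = 31"
    using neqs by (simp add: tangent_coordinates_def del: One_nat_def)
  then show "card tangent_coordinates < card free_coordinates" by (simp add: card_free_coordinates)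
qed

end

theorem corollary2p3:
  fixes d :: nat
  assumes "CARD('n::finite) \<ge> 3" and "d \<ge> 6"
    and "irreducible_space (X_zariski d :: 'n poly_map topology)"
  shows "\<exists>U :: 'n poly_map set. openin (X_zariski d) U \<and> U \<noteq> {} \<and>
           X_zariski d closure_of U = topspace (X_zariski d) \<and>
           (\<forall>F\<in>U. jc_counterexample d F)"
proof (cases "CARD('n) = 3 \<and> d = 6")
  case True
  then obtain a b c :: 'n where "UNIV = {a, b, c}" "a \<noteq> b" "a \<noteq> c" "b \<noteq> c"
    unfolding card_3_iff by metis
  then interpret three_variables a b c by unfold_locales auto
  \<comment> \<open>Irreducibility is refuted here, so the claim holds vacuously.\<close>
  show ?thesis using assms(3) degree_six_reducible True by simp
next
  case False
  with assms show ?thesis by (intro generic_counterexample_if_large) auto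
qed

end
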